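(* Consider the sequences of stochastic decisions $x_n^k$ and of functions $\mathcal{Q}_t^k$ generated by the ISDDP algorithm (described in the context). Let Assumptions (Sto-H0), (Sto-H1), (Sto-H2), and (Sto-H3) (stated in the context) hold and assume that $\lim_{k\to+\infty}\varepsilon_t^k=0$ for $t=1,\ldots,T$. Then: (i) Almost surely, for $t=2,\ldots,T+1$, $$\forall n\in\mathrm{Nodes}(t-1),\qquad \lim_{k\to+\infty}\ \mathcal{Q}_t(x_n^k)-\mathcal{Q}_t^k(x_n^k)=0.$$ (ii) Almost surely, the limit of the sequence $(F_1^{k-1}(x_{n_1}^k,x_0,\xi_1))_k$ of approximate first stage optimal values and of the sequence $(\underline{\mathfrak{Q}}_1^k(x_0,\xi_1))_k$ is the optimal value $\mathcal{Q}_1(x_0)$ of problem (SP) of the context. Moreover, let $\Omega=(\Theta_2\times\cdots\times\Theta_T)^\infty$ be the sample space of all possible sequences of scenarios, equipped with the product $\mathbb{P}$ of the corresponding probability measures, and define on $\Omega$ the random variable $x^*=(x_1^*,\ldots,x_T^* )$ as follows: for $\omega\in\Omega$ consider the corresponding sequence of decisions $((x_n^k(\omega))_{n\in\mathcal{N}})_{k\ge1}$ computed by ISDDP, take any accumulation point $(x_n^*(\omega))_{n\in\mathcal{N}}$ of this sequence, and for $t=1,\ldots,T$ let $x_t^*(\omega)$ be the ($\mathbb{R}^n$-valued, $\mathcal{F}_t$-measurable) decision given by $x_t^*(\omega)(\xi_1,\ldots,\xi_t)=x_m^*(\omega)$, where $m$ is the stage-$t$ node with $\xi_{[m]}=(\xi_1,\ldots,\xi_t)$.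 Then $$\mathbb{P}\big((x_1^*,\ldots,x_T^* )\text{ is an optimal solution to (SP)}\big)=1.$$
   Context: **Notation.** $\mathbb{B}_n(x_0,r)$: closed Euclidean ball; $\mathrm{ri}$: relative interior; $\mathrm{Aff}$: affine span; $X^{\varepsilon}=X+\varepsilon\mathbb{B}_n(0,1)$; $\mathcal{C}^1(\mathcal{X})$: real-valued continuously differentiable functions on $\mathcal{X}$. **Problem.** Given $x_0$ and a stochastic process $(\xi_t)$ with $\xi_1$ deterministic, $\mathcal{F}_t=\sigma(\xi_j,j\le t)$, consider $$(SP)\qquad \inf_{x_1,\ldots,x_T}\ \mathbb{E}_{\xi_2,\ldots,\xi_T}\Big[\sum_{t=1}^Tf_t(x_t(\xi_1,\ldots,\xi_t),x_{t-1}(\xi_1,\ldots,\xi_{t-1}),\xi_t)\Big]$$ subject to $x_t(\xi_1,\ldots,\xi_t)\in X_t(x_{t-1}(\xi_1,\ldots,\xi_{t-1}),\xi_t)$ a.s., $x_t$ $\mathcal{F}_t$-measurable, $t=1,\ldots,T$. For each $t$, $X_t$ is of type S1: $X_t(x_{t-1},\xi_t)=\mathcal{X}_t\subset\mathbb{R}^n$, or of type S2: $X_t(x_{t-1},\xi_t)=\{x_t\in\mathcal{X}_t:g_t(x_t,x_{t-1},\xi_t)\le0,\ A_tx_t+B_tx_{t-1}=b_t\}$, where $\xi_t$ contains in particular the random elements of $A_t,B_t,b_t$ and $g_t$ has $p$ components $g_{ti}$. Types may vary with $t$. Set $\mathcal{X}_0=\{x_0\}$. Dynamic programming equations: $\mathcal{Q}_{T+1}\equiv0$;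 $F_t(x_t,x_{t-1},\xi_t)=f_t(x_t,x_{t-1},\xi_t)+\mathcal{Q}_{t+1}(x_t)$; for $t=2,\ldots,T$, $\mathcal{Q}_t(x_{t-1})=\mathbb{E}_{\xi_t}[\mathfrak{Q}_t(x_{t-1},\xi_t)]$ with $\mathfrak{Q}_t(x_{t-1},\xi_t)=\inf\{F_t(x_t,x_{t-1},\xi_t):x_t\in X_t(x_{t-1},\xi_t)\}$; $\mathcal{Q}_1(x_0)=\inf\{F_1(x_1,x_0,\xi_1):x_1\in X_1(x_0,\xi_1)\}$. **(Sto-H0).** $(\xi_t)$ is interstage independent; for $t=2,\ldots,T$, $\xi_t$ takes values in $\mathbb{R}^K$ with a discrete distribution with finite support $\Theta_t=\{\xi_{t1},\ldots,\xi_{tM}\}$; $\xi_1$ is deterministic. $A_{tj},B_{tj},b_{tj}$ denote the realizations of $A_t,B_t,b_t$ in $\xi_{tj}$. **(Sto-H1).** For $t=1,\ldots,T$: (a) $\mathcal{X}_t$ is nonempty, convex, compact; (b) $f_t(x_t,x_{t-1},\cdot)$ is measurable for all $x_t,x_{t-1}\in\mathbb{R}^n$, and for every $j$, $f_t(\cdot,\cdot,\xi_{tj})$ is convex on $\mathcal{X}_t\times\mathcal{X}_{t-1}$ and belongs to $\mathcal{C}^1(\mathcal{X}_t\times\mathcal{X}_{t-1})$. There is $\varepsilon>0$ such that for every $t$ with $X_t$ of type S2 and every $j=1,\ldots,M$: (c) each $g_{ti}(\cdot,\cdot,\xi_{tj})$ is convex on $\mathcal{X}_t\times\mathcal{X}_{t-1}^\varepsilon$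 and belongs to $\mathcal{C}^1(\mathcal{X}_t\times\mathcal{X}_{t-1})$; (d) for every $x_{t-1}\in\mathcal{X}_{t-1}^\varepsilon$, $X_t(x_{t-1},\xi_{tj})\cap\mathrm{ri}(\mathcal{X}_t)\ne\emptyset$; (e) if $t\ge2$ there is $(\bar x_{tjt},\bar x_{tj\,t-1})\in\mathrm{ri}(\mathcal{X}_t)\times\mathcal{X}_{t-1}$ with $g_t(\bar x_{tjt},\bar x_{tj\,t-1},\xi_{tj})<0$ and $A_{tj}\bar x_{tjt}+B_{tj}\bar x_{tj\,t-1}=b_{tj}$. **(Sto-H2).** For $t=2,\ldots,T$ (with $X_t$ of type S2) there are $\kappa_t>0,r_t>0$ such that for every $x_{t-1}\in\mathcal{X}_{t-1}$ and every $j=1,\ldots,M$ there is $x_t\in\mathcal{X}_t$ with $\mathbb{B}_n(x_t,r_t)\cap\mathrm{Aff}(\mathcal{X}_t)\subseteq\mathcal{X}_t$, $A_{tj}x_t+B_{tj}x_{t-1}=b_{tj}$ and $g_{ti}(x_t,x_{t-1},\xi_{tj})\le-\kappa_t$ for $i=1,\ldots,p$. **(Sto-H3).** The samples in the backward passes are independent: $(\tilde\xi_2^k,\ldots,\tilde\xi_T^k)$ is a realization of $\xi^k=(\xi_2^k,\ldots,\xi_T^k)\sim(\xi_2,\ldots,\xi_T)$ and $\xi^1,\xi^2,\ldots$ are independent. **Scenario tree.** The realizations of $(\xi_t)_{t=1}^T$ form a tree with root $n_0$ (stage 0, decision $x_0$) having one child $n_1$ (stage 1). $\mathcal{N}$ is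 the set of nodes, $\mathrm{Nodes}(t)$ the set of stage-$t$ nodes, $C(n)$ the children of $n$, $p_n$ the transition probability from the parent of $n$ to $n$, $\xi_n$ the realization of the process at node $n$ (containing the realizations $A_n,B_n,b_n$), and $\xi_{[n]}$ the history of realizations from $n_1$ to $n$. **ISDDP algorithm.** Noises $\varepsilon_t^k\ge0$ are given. An $\varepsilon$-optimal solution is a feasible point with objective value within $\varepsilon$ of the optimal value (any feasible point if the objective is identically $-\infty$). Initially $\mathcal{Q}_t^0\equiv-\infty$ for $t=2,\ldots,T$; $\mathcal{Q}_{T+1}^k\equiv0$ for all $k$. Let $F_t^k(y,x,\xi)=f_t(y,x,\xi)+\mathcal{Q}_{t+1}^k(y)$ and $\underline{\mathfrak{Q}}_t^k(x,\xi)=\inf\{F_t^k(y,x,\xi):y\in X_t(x,\xi)\}$. Iteration $k\ge1$: *Forward pass* (done before the scenario $\xi^k$ is sampled, hence depending only on $\xi^1,\ldots,\xi^{k-1}$): $x_{n_0}^k=x_0$; for $t=1,\ldots,T$, every node $n$ of stage $t-1$ and every $m\in C(n)$, $x_m^k$ is an $\varepsilon_t^k$-optimal solution of $\inf\{F_t^{k-1}(y,x_n^k,\xi_m):y\in X_t(x_n^k,\xi_m)\}$. *Backward pass*: select nodes $(n_1^k,\ldots,n_T^k)$, $n_1^k=n_1$, $n_t^k\in C(n_{t-1}^k)$, corresponding to a sample $(\tilde\xi_1^k,\ldots,\tilde\xi_T^k)$ of $(\xi_1,\ldots,\xi_T)$. For $t=T,\ldots,2$, with $n=n_{t-1}^k$,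 for each $m\in C(n)$ compute an $\varepsilon_t^k$-optimal solution $x_m^{Bk}$ of $\inf\{F_t^k(y,x_n^k,\xi_m):y\in X_t(x_n^k,\xi_m)\}$. If $X_t$ is of type S1: $\theta_t^{km}=f_t(x_m^{Bk},x_n^k,\xi_m)+\mathcal{Q}_{t+1}^k(x_m^{Bk})$, $\beta^{km}=\nabla_{x_{t-1}}f_t(x_m^{Bk},x_n^k,\xi_m)$, $$\eta_t^{km}(\varepsilon_t^k)=\max_{x_m\in\mathcal{X}_t}\langle\nabla_{x_t}f_t(x_m^{Bk},x_n^k,\xi_m),x_m^{Bk}-x_m\rangle+\mathcal{Q}_{t+1}^k(x_m^{Bk})-\mathcal{Q}_{t+1}^k(x_m).$$ If $X_t$ is of type S2: let $(\lambda_m^k,\mu_m^k)$ be an $\varepsilon_t^k$-optimal solution of the dual problem of maximizing $\inf_{y\in\mathcal{X}_t}\{F_t^k(y,x_n^k,\xi_m)+\langle\lambda,A_my+B_mx_n^k-b_m\rangle+\langle\mu,g_t(y,x_n^k,\xi_m)\rangle\}$ over $\mu\ge0$ and $\lambda\in\{A_my+B_mx_n^k-b_m:y\in\mathrm{Aff}(\mathcal{X}_t)\}$; set $\theta_t^{km}=f_t(x_m^{Bk},x_n^k,\xi_m)+\mathcal{Q}_{t+1}^k(x_m^{Bk})+\langle\mu_m^k,g_t(x_m^{Bk},x_n^k,\xi_m)\rangle$, $\beta^{km}=\nabla_{x_{t-1}}f_t(x_m^{Bk},x_n^k,\xi_m)+B_m^T\lambda_m^k+\sum_{i=1}^p\mu_m^k(i)\nabla_{x_{t-1}}g_{ti}(x_m^{Bk},x_n^k,\xi_m)$,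 $$\eta_t^{km}(\varepsilon_t^k)=\max_{x_m\in\mathcal{X}_t}\Big\langle\nabla_{x_t}f_t(x_m^{Bk},x_n^k,\xi_m)+A_m^T\lambda_m^k+\sum_{i=1}^p\mu_m^k(i)\nabla_{x_t}g_{ti}(x_m^{Bk},x_n^k,\xi_m),x_m^{Bk}-x_m\Big\rangle+\mathcal{Q}_{t+1}^k(x_m^{Bk})-\mathcal{Q}_{t+1}^k(x_m).$$ Then $\theta_t^k=\sum_{m\in C(n)}p_m\theta_t^{km}$, $\eta_t^k(\varepsilon_t^k)=\sum_{m\in C(n)}p_m\eta_t^{km}(\varepsilon_t^k)$, $\beta_t^k=\sum_{m\in C(n)}p_m\beta^{km}$, the cut is $\mathcal{C}_t^k(x_{t-1})=\theta_t^k-\eta_t^k(\varepsilon_t^k)+\langle\beta_t^k,x_{t-1}-x_{n_{t-1}^k}^k\rangle$, and $\mathcal{Q}_t^k=\max(\mathcal{Q}_t^{k-1},\mathcal{C}_t^k)$. *)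

theory Defs
  imports "HOL-Probability.Probability"
begin

section \<open>Multistage stochastic convex programs\<close>

datatype constraint_type = S1 | S2

text \<open>
  Data of problem (SP). Stages are natural numbers; only stages between 1 and the horizon matter.
  The dimensions of the decisions, of the equality constraints, of \<open>g\<^sub>t\<close> and of \<open>\<xi>\<^sub>t\<close> are the
  cardinalities of \<open>'n\<close>, \<open>'q\<close>, \<open>'p\<close> and \<open>'k\<close>. The matrices \<open>A\<^sub>t\<close>, \<open>B\<^sub>t\<close> and the vector \<open>b\<^sub>t\<close> are
  functions of the value of \<open>\<xi>\<^sub>t\<close>, which is how \<open>\<xi>\<^sub>t\<close> contains their random elements.
  The arguments of \<open>cost t\<close> and \<open>ineq t\<close> are, in this order, \<open>x\<^sub>t\<close>, \<open>x\<^sub>t\<^sub>-\<^sub>1\<close> and \<open>\<xi>\<^sub>t\<close>.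
\<close>

record ('n::finite, 'q::finite, 'p::finite, 'k::finite, 's) msp =
  horizon :: nat
  x_init :: "real^'n"
  Xset :: "nat \<Rightarrow> (real^'n) set"
  ctype :: "nat \<Rightarrow> constraint_type"
  cost :: "nat \<Rightarrow> real^'n \<Rightarrow> real^'n \<Rightarrow> real^'k \<Rightarrow> real"
  ineq :: "nat \<Rightarrow> real^'n \<Rightarrow> real^'n \<Rightarrow> real^'k \<Rightarrow> real^'p"
  matA :: "nat \<Rightarrow> real^'k \<Rightarrow> real^'n^'q"
  matB :: "nat \<Rightarrow> real^'k \<Rightarrow> real^'n^'q"
  vecb :: "nat \<Rightarrow> real^'k \<Rightarrow> real^'q"
  pspace :: "'s measure"
  noise :: "nat \<Rightarrow> 's \<Rightarrow> real^'k"
  xi_one :: "real^'k"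
  Theta :: "nat \<Rightarrow> (real^'k) set"

definition dset :: "('n::finite,'q::finite,'p::finite,'k::finite,'s) msp \<Rightarrow> nat \<Rightarrow> (real^'n) set" where
  "dset P t = (if t = 0 then {x_init P} else Xset P t)"

definition support :: "('n::finite,'q::finite,'p::finite,'k::finite,'s) msp \<Rightarrow> nat \<Rightarrow> (real^'k) set" where
  "support P t = (if t = 1 then {xi_one P} else Theta P t)"

definition eq_res :: "('n::finite,'q::finite,'p::finite,'k::finite,'s) msp \<Rightarrow> nat
    \<Rightarrow> real^'n \<Rightarrow> real^'n \<Rightarrow> real^'k \<Rightarrow> real^'q" where
  "eq_res P t y x \<xi> = matA P t \<xi> *v y + matB P t \<xi> *v x - vecb P t \<xi>"

definition feas :: "('n::finite,'q::finite,'p::finite,'k::finite,'s) msp \<Rightarrow> nat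
    \<Rightarrow> real^'n \<Rightarrow> real^'k \<Rightarrow> (real^'n) set" where
  "feas P t x \<xi> = (case ctype P t of
     S1 \<Rightarrow> dset P t
   | S2 \<Rightarrow> {y \<in> dset P t. (\<forall>i. ineq P t y x \<xi> $ i \<le> 0) \<and> eq_res P t y x \<xi> = 0})"

text \<open>The filtration \<open>\<F>\<^sub>t = \<sigma>(\<xi>\<^sub>j, j \<le> t)\<close>.\<close>

definition filt :: "('n::finite,'q::finite,'p::finite,'k::finite,'s) msp \<Rightarrow> nat \<Rightarrow> 's measure" where
  "filt P t = sigma (space (pspace P))
     (\<Union>j\<in>{1..t}. {noise P j -` B \<inter> space (pspace P) | B. B \<in> sets borel})"

text \<open>
  A policy is a family of random variables \<open>x t :: 's \<Rightarrow> real^'n\<close>; its stage-0 component is the given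
  initial decision. The expectation in the objective is taken with respect to the completed
  probability measure: \<open>cost\<close> is only measurable separately in \<open>\<xi>\<^sub>t\<close>, so on null events (where
  \<open>\<xi>\<^sub>t\<close> may leave its support) the integrand need not be measurable for the original measure, in which
  case the integral over the latter would be the default value 0.
\<close>

definition sp_feasible ::
  "('n::finite,'q::finite,'p::finite,'k::finite,'s) msp \<Rightarrow> (nat \<Rightarrow> 's \<Rightarrow> real^'n) \<Rightarrow> bool" where
  "sp_feasible P x \<longleftrightarrow>
     (\<forall>s\<in>space (pspace P). x 0 s = x_init P) \<and>
     (\<forall>t\<in>{1..horizon P}. x t \<in> borel_measurable (filt P t) \<and>
        (AE s in pspace P. x t s \<in> feas P t (x (t - 1) s) (noise P t s)))"

definition sp_objective ::
  "('n::finite,'q::finite,'p::finite,'k::finite,'s) msp \<Rightarrow> (nat \<Rightarrow> 's \<Rightarrow> real^'n) \<Rightarrow> real" where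
  "sp_objective P x =
     (LINT s|completion (pspace P). (\<Sum>t=1..horizon P. cost P t (x t s) (x (t - 1) s) (noise P t s)))"

definition sp_value :: "('n::finite,'q::finite,'p::finite,'k::finite,'s) msp \<Rightarrow> ereal" where
  "sp_value P = (INF x\<in>{x. sp_feasible P x}. ereal (sp_objective P x))"

definition sp_optimal ::
  "('n::finite,'q::finite,'p::finite,'k::finite,'s) msp \<Rightarrow> (nat \<Rightarrow> 's \<Rightarrow> real^'n) \<Rightarrow> bool" where
  "sp_optimal P x \<longleftrightarrow>
     sp_feasible P x \<and> (\<forall>x'. sp_feasible P x' \<longrightarrow> sp_objective P x \<le> sp_objective P x')"

section \<open>Dynamic programming equations\<close>

text \<open>
  \<open>stage_obj P t V y x \<xi>\<close> is \<open>f\<^sub>t(y,x,\<xi>) + V(y)\<close>. With \<open>V\<close> the true cost-to-go function of stage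
  \<open>t+1\<close> it is \<open>F\<^sub>t\<close>, with \<open>V\<close> the approximation computed at iteration \<open>k\<close> it is \<open>F\<^sub>t\<^sup>k\<close>.
  Its infimum \<open>stage_val\<close> is accordingly the exact or the approximate stage-\<open>t\<close> value function.
  Values are extended reals because the initial approximations are \<open>-\<infinity>\<close>.
\<close>

definition stage_obj :: "('n::finite,'q::finite,'p::finite,'k::finite,'s) msp \<Rightarrow> nat
    \<Rightarrow> (real^'n \<Rightarrow> ereal) \<Rightarrow> real^'n \<Rightarrow> real^'n \<Rightarrow> real^'k \<Rightarrow> ereal" where
  "stage_obj P t V y x \<xi> = ereal (cost P t y x \<xi>) + V y"

definition stage_val :: "('n::finite,'q::finite,'p::finite,'k::finite,'s) msp \<Rightarrow> nat
    \<Rightarrow> (real^'n \<Rightarrow> ereal) \<Rightarrow> real^'n \<Rightarrow> real^'k \<Rightarrow> ereal" where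
  "stage_val P t V x \<xi> = (INF y\<in>feas P t x \<xi>. stage_obj P t V y x \<xi>)"

definition noise_prob :: "('n::finite,'q::finite,'p::finite,'k::finite,'s) msp \<Rightarrow> nat \<Rightarrow> real^'k \<Rightarrow> real" where
  "noise_prob P t \<theta> = measure (pspace P) {s \<in> space (pspace P). noise P t s = \<theta>}"

text \<open>
  The cost-to-go functions for stages \<open>t \<ge> 2\<close>. The law of \<open>\<xi>\<^sub>t\<close> is discrete with finite
  support, so the expectation of the extended-real valued stage value function is a finite sum.
\<close>

function cost_to_go ::
  "('n::finite,'q::finite,'p::finite,'k::finite,'s) msp \<Rightarrow> nat \<Rightarrow> real^'n \<Rightarrow> ereal" where
  "cost_to_go P t =
     (if horizon P < t then (\<lambda>_. 0)
      else (\<lambda>x. \<Sum>\<theta>\<in>support P t. ereal (noise_prob P t \<theta>) * stage_val P t (cost_to_go P (Suc t)) x \<theta>))"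
  by pat_completeness auto
termination
  by (relation "Wellfounded.measure (\<lambda>(P, t). Suc (horizon P) - t)") auto

declare cost_to_go.simps [simp del]

definition first_stage_value :: "('n::finite,'q::finite,'p::finite,'k::finite,'s) msp \<Rightarrow> ereal" where
  "first_stage_value P = stage_val P 1 (cost_to_go P 2) (x_init P) (xi_one P)"

section \<open>Assumptions\<close>

definition gradient :: "('a::real_inner \<Rightarrow> real) \<Rightarrow> 'a \<Rightarrow> 'a" where
  "gradient h z = (THE D. GDERIV h z :> D)"

text \<open>
  Continuous differentiability on a closed, possibly lower-dimensional set: on some open
  neighbourhood of it, so that gradients at its points are determined.
\<close>

definition C1_on :: "'a::real_inner set \<Rightarrow> ('a \<Rightarrow> real) \<Rightarrow> bool" where
  "C1_on S h \<longleftrightarrow>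
     (\<exists>U h'. open U \<and> S \<subseteq> U \<and> continuous_on U h' \<and> (\<forall>z\<in>U. GDERIV h z :> h' z))"

definition enlarge :: "'a::real_normed_vector set \<Rightarrow> real \<Rightarrow> 'a set" where
  "enlarge S \<epsilon> = {x + \<epsilon> *\<^sub>R u | x u. x \<in> S \<and> u \<in> cball 0 1}"

definition StoH0 :: "('n::finite,'q::finite,'p::finite,'k::finite,'s) msp \<Rightarrow> bool" where
  "StoH0 P \<longleftrightarrow>
     prob_space (pspace P) \<and>
     prob_space.indep_vars (pspace P) (\<lambda>_. borel) (noise P) {1..horizon P} \<and>
     (\<forall>s\<in>space (pspace P). noise P 1 s = xi_one P) \<and>
     (\<exists>M. \<forall>t\<in>{2..horizon P}.
        finite (Theta P t) \<and> card (Theta P t) = M \<and>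
        (AE s in pspace P. noise P t s \<in> Theta P t) \<and>
        (\<forall>\<theta>\<in>Theta P t. 0 < noise_prob P t \<theta>))"

definition StoH1 :: "('n::finite,'q::finite,'p::finite,'k::finite,'s) msp \<Rightarrow> bool" where
  "StoH1 P \<longleftrightarrow>
     (\<forall>t\<in>{1..horizon P}.
        dset P t \<noteq> {} \<and> convex (dset P t) \<and> compact (dset P t) \<and>
        (\<forall>y x. cost P t y x \<in> borel_measurable borel) \<and>
        (\<forall>\<theta>\<in>support P t.
           convex_on (dset P t \<times> dset P (t - 1)) (\<lambda>(y, x). cost P t y x \<theta>) \<and>
           C1_on (dset P t \<times> dset P (t - 1)) (\<lambda>(y, x). cost P t y x \<theta>))) \<and>
     (\<exists>\<epsilon>>0. \<forall>t\<in>{1..horizon P}. ctype P t = S2 \<longrightarrow>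
        (\<forall>\<theta>\<in>support P t.
           (\<forall>i. convex_on (dset P t \<times> enlarge (dset P (t - 1)) \<epsilon>) (\<lambda>(y, x). ineq P t y x \<theta> $ i) \<and>
                C1_on (dset P t \<times> dset P (t - 1)) (\<lambda>(y, x). ineq P t y x \<theta> $ i)) \<and>
           (\<forall>x\<in>enlarge (dset P (t - 1)) \<epsilon>. feas P t x \<theta> \<inter> rel_interior (dset P t) \<noteq> {}) \<and>
           (2 \<le> t \<longrightarrow>
              (\<exists>y\<in>rel_interior (dset P t). \<exists>x\<in>dset P (t - 1).
                 (\<forall>i. ineq P t y x \<theta> $ i < 0) \<and> eq_res P t y x \<theta> = 0))))"

definition StoH2 :: "('n::finite,'q::finite,'p::finite,'k::finite,'s) msp \<Rightarrow> bool" where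
  "StoH2 P \<longleftrightarrow>
     (\<forall>t\<in>{2..horizon P}. ctype P t = S2 \<longrightarrow>
        (\<exists>\<kappa>>0. \<exists>r>0. \<forall>x\<in>dset P (t - 1). \<forall>\<theta>\<in>support P t.
           \<exists>y\<in>dset P t. cball y r \<inter> affine hull (dset P t) \<subseteq> dset P t \<and>
             eq_res P t y x \<theta> = 0 \<and> (\<forall>i. ineq P t y x \<theta> $ i \<le> - \<kappa>)))"

section \<open>Scenario tree and sampled scenarios\<close>

text \<open>
  A stage-\<open>t\<close> node is identified with the history of realizations \<open>[\<xi>\<^sub>1, \<dots>, \<xi>\<^sub>t]\<close> leading to it.
  The root is \<open>[]\<close>, its only child is \<open>[\<xi>\<^sub>1]\<close>, and the realization at a node \<open>m \<noteq> []\<close> is \<open>last m\<close>.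
\<close>

definition nodes :: "('n::finite,'q::finite,'p::finite,'k::finite,'s) msp \<Rightarrow> nat \<Rightarrow> (real^'k) list set" where
  "nodes P t = {n. length n = t \<and> (\<forall>j<t. n ! j \<in> support P (Suc j))}"

definition all_nodes :: "('n::finite,'q::finite,'p::finite,'k::finite,'s) msp \<Rightarrow> (real^'k) list set" where
  "all_nodes P = (\<Union>t\<le>horizon P. nodes P t)"

definition children ::
  "('n::finite,'q::finite,'p::finite,'k::finite,'s) msp \<Rightarrow> (real^'k) list \<Rightarrow> (real^'k) list set" where
  "children P n = {n @ [\<theta>] | \<theta>. \<theta> \<in> support P (Suc (length n))}"

text \<open>By interstage independence the transition probability only depends on the last realization.\<close>

definition trans_prob ::
  "('n::finite,'q::finite,'p::finite,'k::finite,'s) msp \<Rightarrow> (real^'k) list \<Rightarrow> real" where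
  "trans_prob P m = noise_prob P (length m) (last m)"

text \<open>
  The law of \<open>(\<xi>\<^sub>2, \<dots>, \<xi>\<^sub>T)\<close> on \<open>\<Theta>\<^sub>2 \<times> \<dots> \<times> \<Theta>\<^sub>T\<close>, and the sample space
  \<open>(\<Theta>\<^sub>2 \<times> \<dots> \<times> \<Theta>\<^sub>T)\<^sup>\<infinity>\<close> of the algorithm with the product measure. A point \<open>\<omega>\<close> of the latter
  gives the scenario \<open>(\<omega> k 2, \<dots>, \<omega> k T)\<close> sampled at iteration \<open>k \<ge> 1\<close>. That these
  scenarios are independent copies of \<open>(\<xi>\<^sub>2, \<dots>, \<xi>\<^sub>T)\<close>, i.e. assumption (Sto-H3), is the choice
  of this product measure.
\<close>

definition scenario_law ::
  "('n::finite,'q::finite,'p::finite,'k::finite,'s) msp \<Rightarrow> (nat \<Rightarrow> real^'k) measure" where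
  "scenario_law P =
     restrict_space
       (distr (pspace P) (\<Pi>\<^sub>M t\<in>{2..horizon P}. borel) (\<lambda>s. \<lambda>t\<in>{2..horizon P}. noise P t s))
       (\<Pi>\<^sub>E t\<in>{2..horizon P}. Theta P t)"

definition sample_space ::
  "('n::finite,'q::finite,'p::finite,'k::finite,'s) msp \<Rightarrow> (nat \<Rightarrow> nat \<Rightarrow> real^'k) measure" where
  "sample_space P = (\<Pi>\<^sub>M k\<in>{1..}. scenario_law P)"

text \<open>The node \<open>n\<^sub>t\<^sup>k\<close> selected at stage \<open>t \<ge> 1\<close> for the sampled scenario \<open>\<xi> = \<omega> k\<close>.\<close>

definition sampled_node ::
  "('n::finite,'q::finite,'p::finite,'k::finite,'s) msp \<Rightarrow> (nat \<Rightarrow> real^'k) \<Rightarrow> nat \<Rightarrow> (real^'k) list" where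
  "sampled_node P \<xi> t = xi_one P # map \<xi> [2..<Suc t]"

section \<open>The ISDDP algorithm\<close>

text \<open>
  The quantities produced by one run: forward decisions \<open>x\<^sub>n\<^sup>k\<close>, backward decisions \<open>x\<^sub>m\<^sup>B\<^sup>k\<close>,
  dual solutions \<open>\<lambda>\<^sub>m\<^sup>k\<close> and \<open>\<mu>\<^sub>m\<^sup>k\<close>, and approximations \<open>Qapp r k t\<close> of the cost-to-go functions.
  The components which the algorithm does not compute are left unconstrained.
\<close>

record ('n::finite, 'q::finite, 'p::finite, 'k::finite) run =
  fwd :: "nat \<Rightarrow> (real^'k) list \<Rightarrow> real^'n"
  bwd :: "nat \<Rightarrow> (real^'k) list \<Rightarrow> real^'n"
  lam :: "nat \<Rightarrow> (real^'k) list \<Rightarrow> real^'q"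
  mu :: "nat \<Rightarrow> (real^'k) list \<Rightarrow> real^'p"
  Qapp :: "nat \<Rightarrow> nat \<Rightarrow> real^'n \<Rightarrow> ereal"

text \<open>For an objective which is identically \<open>-\<infinity>\<close> every feasible point satisfies the inequality.\<close>

definition eps_min :: "real \<Rightarrow> ('a \<Rightarrow> ereal) \<Rightarrow> 'a set \<Rightarrow> 'a \<Rightarrow> bool" where
  "eps_min \<epsilon> h S y \<longleftrightarrow> y \<in> S \<and> h y \<le> (INF z\<in>S. h z) + ereal \<epsilon>"

definition eps_max :: "real \<Rightarrow> ('a \<Rightarrow> ereal) \<Rightarrow> 'a set \<Rightarrow> 'a \<Rightarrow> bool" where
  "eps_max \<epsilon> h S y \<longleftrightarrow> y \<in> S \<and> (SUP z\<in>S. h z) - ereal \<epsilon> \<le> h y"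

definition dual_fun :: "('n::finite,'q::finite,'p::finite,'k::finite,'s) msp \<Rightarrow> nat
    \<Rightarrow> (real^'n \<Rightarrow> ereal) \<Rightarrow> real^'n \<Rightarrow> real^'k \<Rightarrow> (real^'q) \<times> (real^'p) \<Rightarrow> ereal" where
  "dual_fun P t V x \<xi> = (\<lambda>(l, u). INF y\<in>dset P t.
     stage_obj P t V y x \<xi> + ereal (l \<bullet> eq_res P t y x \<xi> + u \<bullet> ineq P t y x \<xi>))"

definition dual_feas :: "('n::finite,'q::finite,'p::finite,'k::finite,'s) msp \<Rightarrow> nat
    \<Rightarrow> real^'n \<Rightarrow> real^'k \<Rightarrow> ((real^'q) \<times> (real^'p)) set" where
  "dual_feas P t x \<xi> = {eq_res P t y x \<xi> | y. y \<in> affine hull (dset P t)} \<times> {u. \<forall>i. 0 \<le> u $ i}"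

text \<open>
  The coefficients of the cut at iteration \<open>k\<close> and stage \<open>t\<close>; \<open>n\<close> is the selected node of stage
  \<open>t-1\<close> and \<open>m\<close> a child of \<open>n\<close>.
\<close>

definition theta_m :: "('n::finite,'q::finite,'p::finite,'k::finite,'s) msp \<Rightarrow> ('n,'q,'p,'k) run
    \<Rightarrow> nat \<Rightarrow> nat \<Rightarrow> (real^'k) list \<Rightarrow> (real^'k) list \<Rightarrow> ereal" where
  "theta_m P r k t n m =
     (let y = bwd r k m; x = fwd r k n; \<xi> = last m; V = Qapp r k (Suc t) in
      case ctype P t of
        S1 \<Rightarrow> ereal (cost P t y x \<xi>) + V y
      | S2 \<Rightarrow> ereal (cost P t y x \<xi>) + V y + ereal (mu r k m \<bullet> ineq P t y x \<xi>))"

definition beta_m :: "('n::finite,'q::finite,'p::finite,'k::finite,'s) msp \<Rightarrow> ('n,'q,'p,'k) run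
    \<Rightarrow> nat \<Rightarrow> nat \<Rightarrow> (real^'k) list \<Rightarrow> (real^'k) list \<Rightarrow> real^'n" where
  "beta_m P r k t n m =
     (let y = bwd r k m; x = fwd r k n; \<xi> = last m in
      case ctype P t of
        S1 \<Rightarrow> gradient (\<lambda>x'. cost P t y x' \<xi>) x
      | S2 \<Rightarrow> gradient (\<lambda>x'. cost P t y x' \<xi>) x
              + transpose (matB P t \<xi>) *v lam r k m
              + (\<Sum>i\<in>UNIV. mu r k m $ i *\<^sub>R gradient (\<lambda>x'. ineq P t y x' \<xi> $ i) x))"

definition eta_m :: "('n::finite,'q::finite,'p::finite,'k::finite,'s) msp \<Rightarrow> ('n,'q,'p,'k) run
    \<Rightarrow> nat \<Rightarrow> nat \<Rightarrow> (real^'k) list \<Rightarrow> (real^'k) list \<Rightarrow> ereal" where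
  "eta_m P r k t n m =
     (let y = bwd r k m; x = fwd r k n; \<xi> = last m; V = Qapp r k (Suc t);
          d = (case ctype P t of
                 S1 \<Rightarrow> gradient (\<lambda>y'. cost P t y' x \<xi>) y
               | S2 \<Rightarrow> gradient (\<lambda>y'. cost P t y' x \<xi>) y
                       + transpose (matA P t \<xi>) *v lam r k m
                       + (\<Sum>i\<in>UNIV. mu r k m $ i *\<^sub>R gradient (\<lambda>y'. ineq P t y' x \<xi> $ i) y))
      in SUP z\<in>dset P t. ereal (d \<bullet> (y - z)) + V y - V z)"

definition cut :: "('n::finite,'q::finite,'p::finite,'k::finite,'s) msp \<Rightarrow> ('n,'q,'p,'k) run
    \<Rightarrow> nat \<Rightarrow> nat \<Rightarrow> (real^'k) list \<Rightarrow> real^'n \<Rightarrow> ereal" where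
  "cut P r k t n x =
     (\<Sum>m\<in>children P n. ereal (trans_prob P m) * theta_m P r k t n m)
     - (\<Sum>m\<in>children P n. ereal (trans_prob P m) * eta_m P r k t n m)
     + ereal ((\<Sum>m\<in>children P n. trans_prob P m *\<^sub>R beta_m P r k t n m) \<bullet> (x - fwd r k n))"

definition forward_pass :: "('n::finite,'q::finite,'p::finite,'k::finite,'s) msp
    \<Rightarrow> (nat \<Rightarrow> nat \<Rightarrow> real) \<Rightarrow> ('n,'q,'p,'k) run \<Rightarrow> nat \<Rightarrow> bool" where
  "forward_pass P eps r k \<longleftrightarrow>
     fwd r k [] = x_init P \<and>
     (\<forall>t\<in>{1..horizon P}. \<forall>n\<in>nodes P (t - 1). \<forall>m\<in>children P n.
        eps_min (eps t k) (\<lambda>y. stage_obj P t (Qapp r (k - 1) (Suc t)) y (fwd r k n) (last m))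
          (feas P t (fwd r k n) (last m)) (fwd r k m))"

definition backward_pass :: "('n::finite,'q::finite,'p::finite,'k::finite,'s) msp
    \<Rightarrow> (nat \<Rightarrow> nat \<Rightarrow> real) \<Rightarrow> (nat \<Rightarrow> real^'k) \<Rightarrow> ('n,'q,'p,'k) run \<Rightarrow> nat \<Rightarrow> bool" where
  "backward_pass P eps \<xi> r k \<longleftrightarrow>
     (\<forall>t\<in>{2..horizon P}. let n = sampled_node P \<xi> (t - 1); x = fwd r k n; V = Qapp r k (Suc t) in
        (\<forall>m\<in>children P n.
           eps_min (eps t k) (\<lambda>y. stage_obj P t V y x (last m)) (feas P t x (last m)) (bwd r k m) \<and>
           (ctype P t = S2 \<longrightarrow>
              eps_max (eps t k) (dual_fun P t V x (last m)) (dual_feas P t x (last m))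
                (lam r k m, mu r k m))) \<and>
        Qapp r k t = (\<lambda>z. max (Qapp r (k - 1) t z) (cut P r k t n z)))"

definition isddp_run :: "('n::finite,'q::finite,'p::finite,'k::finite,'s) msp
    \<Rightarrow> (nat \<Rightarrow> nat \<Rightarrow> real) \<Rightarrow> (nat \<Rightarrow> nat \<Rightarrow> real^'k) \<Rightarrow> ('n,'q,'p,'k) run \<Rightarrow> bool" where
  "isddp_run P eps \<omega> r \<longleftrightarrow>
     (\<forall>t\<in>{2..horizon P}. Qapp r 0 t = (\<lambda>_. - \<infinity>)) \<and>
     (\<forall>k. Qapp r k (Suc (horizon P)) = (\<lambda>_. 0)) \<and>
     (\<forall>k\<ge>1. forward_pass P eps r k \<and> backward_pass P eps (\<omega> k) r k)"

text \<open>
  An execution of the algorithm assigns a run to every sequence of sampled scenarios. The forward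
  pass of iteration \<open>k\<close> takes place before the \<open>k\<close>-th scenario is sampled and the backward pass
  of iteration \<open>k\<close> before the following one is, so \<open>x\<^sub>n\<^sup>k\<close> depends on the first \<open>k-1\<close>
  scenarios only and the approximations of iteration \<open>k\<close> on the first \<open>k\<close> only.
\<close>

definition isddp :: "('n::finite,'q::finite,'p::finite,'k::finite,'s) msp
    \<Rightarrow> (nat \<Rightarrow> nat \<Rightarrow> real) \<Rightarrow> ((nat \<Rightarrow> nat \<Rightarrow> real^'k) \<Rightarrow> ('n,'q,'p,'k) run) \<Rightarrow> bool" where
  "isddp P eps R \<longleftrightarrow>
     (\<forall>\<omega>\<in>space (sample_space P). isddp_run P eps \<omega> (R \<omega>)) \<and>
     (\<forall>\<omega>\<in>space (sample_space P). \<forall>\<omega>'\<in>space (sample_space P). \<forall>k\<ge>1.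
        ((\<forall>j\<in>{1..<k}. \<omega> j = \<omega>' j) \<longrightarrow> (\<forall>n\<in>all_nodes P. fwd (R \<omega>) k n = fwd (R \<omega>') k n)) \<and>
        ((\<forall>j\<in>{1..k}. \<omega> j = \<omega>' j) \<longrightarrow> (\<forall>t\<in>{2..horizon P}. Qapp (R \<omega>) k t = Qapp (R \<omega>') k t)))"

text \<open>
  Accumulation points of the sequence of families \<open>(x\<^sub>n\<^sup>k)\<close> indexed by the finitely many nodes:
  limits, at all nodes simultaneously, along a common subsequence.
\<close>

definition accumulation_point :: "('n::finite,'q::finite,'p::finite,'k::finite,'s) msp
    \<Rightarrow> ('n,'q,'p,'k) run \<Rightarrow> ((real^'k) list \<Rightarrow> real^'n) \<Rightarrow> bool" where
  "accumulation_point P r z \<longleftrightarrow>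
     (\<exists>\<phi>::nat \<Rightarrow> nat. strict_mono \<phi> \<and> (\<forall>n\<in>all_nodes P. (\<lambda>i. fwd r (\<phi> i) n) \<longlonglongrightarrow> z n))"

text \<open>
  The policy induced by a family of decisions at the nodes; the value 0 is only used on the null
  event that the history of the process is not a node.
\<close>

definition tree_policy :: "('n::finite,'q::finite,'p::finite,'k::finite,'s) msp
    \<Rightarrow> ((real^'k) list \<Rightarrow> real^'n) \<Rightarrow> nat \<Rightarrow> 's \<Rightarrow> real^'n" where
  "tree_policy P z t s =
     (let m = map (\<lambda>j. noise P j s) [1..<Suc t] in if m \<in> nodes P t then z m else 0)"

end

theory Submission
  imports Defs
begin

text \<open>
  The argument has a deterministic part, which concerns a single run of the algorithm, a
  probabilistic part about the sampled scenarios, and a comparison of policies with decisions on the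
  scenario tree.

  Every cut lies below the exact cost-to-go function: the tangent inequalities of the convex cost
  and constraint functions at the backward decision, weighted with nonnegative multipliers, bound
  the stage problem from below at every previous decision, and the correction \<open>\<eta>\<close>
  pays for the decision being only nearly optimal (\<open>cut_valid\<close>). The Slater condition
  has three consequences. The feasible set depends Lipschitz continuously on the previous decision,
  so the exact cost-to-go functions are Lipschitz (\<open>feas_set_lipschitz\<close>,
  \<open>ctg_regular\<close>). There is no duality gap, with multipliers of the equality constraints
  in the subspace over which the algorithm maximizes (\<open>strong_duality\<close>). Finally,
  nearly optimal multipliers are bounded (\<open>multipliers_bounded\<close>), hence so are the
  slopes of the cuts: along a run the approximations are increasing and Lipschitz with a constant
  independent of the iteration (\<open>Q_regular\<close>).

  A backward decision minimizes the Lagrangian up to \<open>2 \<epsilon>\<close>. Since the smooth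
  part of the Lagrangian is uniformly differentiable over all bounded multipliers, the linearized
  gain \<open>\<eta>\<close> tends to 0 with \<open>\<epsilon>\<close>
  (\<open>near_minimizer_gap\<close>). So the height of a cut at its own trial point is
  asymptotically at least the approximate stage value there (\<open>cut_properties\<close>).

  For a node \<open>n\<close> consider the gap between the exact function and the approximation of
  the preceding iteration at the decision \<open>x\<^sub>n\<^sup>k\<close>. Going backward over the
  stages, suppose the gaps of the children of \<open>n\<close> vanish. A forward decision is nearly
  optimal for the approximate stage problem, so it shows that the approximate and the exact stage
  values at \<open>x\<^sub>n\<^sup>k\<close> differ by little (\<open>forward_optimal\<close>), and
  whenever \<open>n\<close> is sampled the new cut closes the gap of \<open>n\<close> up to an error
  tending to 0 (\<open>sampled_gap_closes\<close>). By compactness and the common Lipschitz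
  constant, a gap that is closed at infinitely many points \<open>x\<^sub>n\<^sup>k\<close> was
  already small before all but finitely many of these visits (\<open>gap_before_visit\<close>).
  Hence \<open>n\<close> is sampled only finitely often while its gap exceeds a given threshold.
  Since \<open>x\<^sub>n\<^sup>k\<close> and the previous approximation are known before the
  \<open>k\<close>-th scenario is drawn, almost surely a gap that exceeds the threshold infinitely
  often would also be sampled infinitely often while doing so
  (\<open>infinitely_often_drawn\<close>). Therefore all gaps vanish almost surely.

  An adapted policy is almost surely a function of the history, that is, a family of decisions on
  the tree, and its cost is a sum over the nodes (\<open>sp_feasible_obtains_tree\<close>,
  \<open>sp_objective_tree\<close>). By dynamic programming this cost is at least the optimal value
  of the first stage problem, with equality if the decision at every node is optimal for its stage
  problem (\<open>tree_cost_bounds\<close>). When the gaps vanish, limits of forward decisions have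
  this property (\<open>accumulation_point_optimal\<close>).
\<close>

section \<open>Continuously differentiable convex functions on compact sets\<close>

lemma gradient_eqI: "GDERIV h z :> D \<Longrightarrow> gradient h z = D"
proof -
  have "D' = D" if "GDERIV h z :> D" "GDERIV h z :> D'" for D'
  proof -
    have "(\<lambda>w. w \<bullet> D) = (\<lambda>w. w \<bullet> D')"
      using that unfolding gderiv_def by (rule has_derivative_unique)
    then have "(D - D') \<bullet> D = (D - D') \<bullet> D'"
      by (rule fun_cong)
    then have "(D - D') \<bullet> (D - D') = 0"
      by (simp add: inner_diff_right)
    then show ?thesis by simp
  qed
  then show "GDERIV h z :> D \<Longrightarrow> gradient h z = D"
    unfolding gradient_def by blast
qed

lemma C1_on_GDERIV:
  assumes "C1_on S h" "z \<in> S"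
  shows "GDERIV h z :> gradient h z"
proof -
  obtain U h' where U: "S \<subseteq> U" "\<forall>z\<in>U. GDERIV h z :> h' z"
    using assms(1) unfolding C1_on_def by blast
  then have "GDERIV h z :> h' z" using assms(2) by blast
  then show ?thesis using gradient_eqI by force
qed

lemma C1_on_has_derivative:
  assumes "C1_on S h" "z \<in> S"
  shows "(h has_derivative (\<lambda>w. w \<bullet> gradient h z)) (at z within S)"
  using C1_on_GDERIV[OF assms] unfolding gderiv_def by (rule has_derivative_at_withinI)

lemma C1_on_continuous_gradient:
  assumes "C1_on S h"
  shows "continuous_on S (gradient h)"
proof -
  obtain U h' where U: "S \<subseteq> U" "continuous_on U h'" "\<forall>z\<in>U. GDERIV h z :> h' z"
    using assms unfolding C1_on_def by blast
  have "continuous_on S h'"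
    using U continuous_on_subset by blast
  moreover have "gradient h z = h' z" if "z \<in> S" for z
    using U that by (intro gradient_eqI) blast
  ultimately show ?thesis by (simp cong: continuous_on_cong)
qed

lemma C1_on_continuous:
  assumes "C1_on S h"
  shows "continuous_on S h"
  by (rule has_derivative_continuous_on, rule C1_on_has_derivative[OF assms])

lemma C1_on_const: "C1_on S (\<lambda>z. c)"
  unfolding C1_on_def
  by (intro exI[of _ UNIV] exI[of _ "\<lambda>_. 0"] conjI ballI GDERIV_const) auto

lemma C1_on_bounded_gradient:
  assumes "C1_on S h" "compact S"
  shows "\<exists>G\<ge>0. \<forall>z\<in>S. norm (gradient h z) \<le> G"
proof -
  have "bounded (gradient h ` S)"
    by (intro compact_imp_bounded compact_continuous_image C1_on_continuous_gradient assms)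
  then obtain G where "0 < G" "\<forall>z\<in>S. norm (gradient h z) \<le> G"
    unfolding bounded_pos by auto
  then show ?thesis by (intro exI[of _ G]) simp
qed

lemma C1_on_lipschitz:
  fixes h :: "'a::euclidean_space \<Rightarrow> real"
  assumes "C1_on S h" "compact S" "convex S"
  shows "\<exists>L\<ge>0. \<forall>z\<in>S. \<forall>z'\<in>S. \<bar>h z - h z'\<bar> \<le> L * dist z z'"
proof -
  obtain G where G: "0 \<le> G" "\<forall>z\<in>S. norm (gradient h z) \<le> G"
    using C1_on_bounded_gradient[OF assms(1,2)] by blast
  have "norm (h z - h z') \<le> G * norm (z - z')" if "z \<in> S" "z' \<in> S" for z z'
  proof (rule differentiable_bound[OF assms(3) _ _ that])
    show "(h has_derivative (\<lambda>w. w \<bullet> gradient h x)) (at x within S)" if "x \<in> S" for x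
      by (rule C1_on_has_derivative[OF assms(1) that])
    show "onorm (\<lambda>w. w \<bullet> gradient h x) \<le> G" if "x \<in> S" for x
      by (rule onorm_bound[OF G(1)])
         (metis Cauchy_Schwarz_ineq2 bspec[OF G(2) that] mult.commute mult_left_mono norm_ge_zero order_trans real_norm_def)
  qed
  then show ?thesis using G(1) by (intro exI[of _ G]) (simp add: dist_norm)
qed

text \<open>
  Uniform continuity of the gradient on a compact set makes the first-order expansion uniform: the
  error is governed by the oscillation of the gradient along the segment.
\<close>

lemma C1_on_uniform_expansion:
  fixes h :: "'a::euclidean_space \<Rightarrow> real"
  assumes "C1_on S h" "compact S" "convex S" "0 < e"
  shows "\<exists>d>0. \<forall>z\<in>S. \<forall>z'\<in>S. dist z z' < d \<longrightarrow>
       \<bar>h z' - h z - gradient h z \<bullet> (z' - z)\<bar> \<le> e * norm (z' - z)"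
proof -
  have "uniformly_continuous_on S (gradient h)"
    by (intro compact_uniformly_continuous C1_on_continuous_gradient assms)
  then obtain d where d: "0 < d"
    "\<And>z z'. z \<in> S \<Longrightarrow> z' \<in> S \<Longrightarrow> dist z' z < d \<Longrightarrow> dist (gradient h z') (gradient h z) < e"
    using assms(4) unfolding uniformly_continuous_on_def by metis
  have "\<bar>h z' - h z - gradient h z \<bullet> (z' - z)\<bar> \<le> e * norm (z' - z)"
    if z: "z \<in> S" "z' \<in> S" "dist z z' < d" for z z'
  proof -
    let ?C = "closed_segment z z'"
    have C: "?C \<subseteq> S" using assms(3) z by (simp add: closed_segment_subset)
    have near: "dist w z < d" if "w \<in> ?C" for w
      using segment_bound(1)[OF that] z(3) by (simp add: dist_norm norm_minus_commute)
    have "norm (h z' - h z - (z' - z) \<bullet> gradient h z) \<le> norm (z' - z) * e"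
    proof (rule differentiable_bound_linearization[of z z' ?C h "\<lambda>x w. w \<bullet> gradient h x" z e])
      show "z + t *\<^sub>R (z' - z) \<in> ?C" if "t \<in> {0..1}" for t
        using that unfolding closed_segment_def by (auto intro!: exI[of _ t] simp: algebra_simps)
      show "(h has_derivative (\<lambda>w. w \<bullet> gradient h x)) (at x within ?C)" if "x \<in> ?C" for x
        using C1_on_has_derivative[OF assms(1), of x] C that has_derivative_subset by blast
      show "onorm ((\<lambda>w. w \<bullet> gradient h x) - (\<lambda>w. w \<bullet> gradient h z)) \<le> e" if "x \<in> ?C" for x
      proof (rule onorm_bound)
        fix w :: 'a
        have "norm (gradient h x - gradient h z) \<le> e"
          using d(2)[of z x] near[OF that] that C z(1) by (simp add: dist_norm less_imp_le subset_iff)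
        then have "norm w * norm (gradient h x - gradient h z) \<le> norm w * e"
          by (simp add: mult_left_mono)
        moreover have "\<bar>w \<bullet> (gradient h x - gradient h z)\<bar> \<le> norm w * norm (gradient h x - gradient h z)"
          by (rule Cauchy_Schwarz_ineq2)
        ultimately show "norm (((\<lambda>w. w \<bullet> gradient h x) - (\<lambda>w. w \<bullet> gradient h z)) w) \<le> e * norm w"
          by (simp add: inner_diff_right mult.commute)
      qed (use assms(4) in simp)
    qed simp
    then show ?thesis by (simp add: inner_commute mult.commute)
  qed
  then show ?thesis using d(1) by blast
qed

lemma convex_on_tangent:
  assumes cvx: "convex_on S h" and D: "GDERIV h z :> D" and z: "z \<in> S" "z' \<in> S"
  shows "h z + D \<bullet> (z' - z) \<le> h z'"
proof -
  have "((\<lambda>s. h (z + s *\<^sub>R (z' - z))) has_derivative (\<lambda>s. (s *\<^sub>R (z' - z)) \<bullet> D)) (at 0)"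
    by (rule has_derivative_compose[where f="\<lambda>s. z + s *\<^sub>R (z' - z)" and g=h])
       (use D in \<open>auto simp: gderiv_def intro!: derivative_eq_intros\<close>)
  then have "((\<lambda>s. h (z + s *\<^sub>R (z' - z))) has_field_derivative (D \<bullet> (z' - z))) (at 0)"
    by (simp add: has_field_derivative_def inner_commute mult_commute_abs)
  then have "((\<lambda>s. (h (z + s *\<^sub>R (z' - z)) - h z) / s) \<longlongrightarrow> D \<bullet> (z' - z)) (at_right 0)"
    unfolding has_field_derivative_iff
    by (simp add: filterlim_at_split)
  moreover have "eventually (\<lambda>s::real. s \<in> {0<..<1}) (at_right 0)"
    by (rule eventually_at_right_real) simp
  then have "eventually (\<lambda>s. (h (z + s *\<^sub>R (z' - z)) - h z) / s \<le> h z' - h z) (at_right 0)"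
  proof eventually_elim
    case (elim s)
    have "h ((1 - s) *\<^sub>R z + s *\<^sub>R z') \<le> (1 - s) * h z + s * h z'"
      using convex_onD[OF cvx, of s z z'] elim z by auto
    moreover have "(1 - s) *\<^sub>R z + s *\<^sub>R z' = z + s *\<^sub>R (z' - z)"
      by (simp add: algebra_simps)
    ultimately have "h (z + s *\<^sub>R (z' - z)) - h z \<le> s * (h z' - h z)"
      by (simp add: algebra_simps)
    then show ?case using elim by (simp add: divide_le_eq mult.commute)
  qed
  ultimately have "D \<bullet> (z' - z) \<le> h z' - h z"
    by (rule tendsto_upperbound) simp
  then show ?thesis by simp
qed

lemma GDERIV_fst:
  assumes "GDERIV h (y, x) :> D"
  shows "GDERIV (\<lambda>y'. h (y', x)) y :> fst D"
proof -
  have "((\<lambda>y'. h (y', x)) has_derivative (\<lambda>w. (w, 0) \<bullet> D)) (at y)"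
    by (rule has_derivative_compose[where f="\<lambda>y'. (y', x)" and g=h])
       (use assms in \<open>auto simp: gderiv_def intro!: derivative_eq_intros\<close>)
  then show ?thesis by (simp add: gderiv_def inner_prod_def)
qed

lemma GDERIV_snd:
  assumes "GDERIV h (y, x) :> D"
  shows "GDERIV (\<lambda>x'. h (y, x')) x :> snd D"
proof -
  have "((\<lambda>x'. h (y, x')) has_derivative (\<lambda>w. (0, w) \<bullet> D)) (at x)"
    by (rule has_derivative_compose[where f="\<lambda>x'. (y, x')" and g=h])
       (use assms in \<open>auto simp: gderiv_def intro!: derivative_eq_intros\<close>)
  then show ?thesis by (simp add: gderiv_def inner_prod_def)
qed

text \<open>
  This provides corrections which restore an equality constraint, stay in the affine hull of the decision
  set, and are of the order of the violation.
\<close>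

lemma bounded_preimages_in_subspace:
  fixes f :: "'a::euclidean_space \<Rightarrow> 'b::euclidean_space"
  assumes "linear f" "subspace W"
  shows "\<exists>C>0. \<forall>v\<in>f ` W. \<exists>d\<in>W. f d = v \<and> norm d \<le> C * norm v"
proof -
  obtain h where h: "range h \<subseteq> W" "linear h" "\<forall>v\<in>f ` W. f (h v) = v"
    using linear_exists_right_inverse_on[OF assms] by blast
  obtain C where C: "0 < C" "\<And>v. norm (h v) \<le> C * norm v"
    using linear_bounded_pos[OF h(2)] by blast
  have "h v \<in> W" for v using h(1) by blast
  with C have "\<exists>d\<in>W. f d = v \<and> norm d \<le> C * norm v" if "v \<in> f ` W" for v
    using h(3)[rule_format, OF that] by (intro bexI[of _ "h v"] conjI) simp_all
  then show ?thesis using C(1) by blast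
qed

lemma lipschitz_on_max:
  fixes f g :: "'a::metric_space \<Rightarrow> real"
  assumes "L-lipschitz_on S f" "L-lipschitz_on S g"
  shows "L-lipschitz_on S (\<lambda>x. max (f x) (g x))"
proof (rule lipschitz_onI)
  fix x y assume "x \<in> S" "y \<in> S"
  then show "dist (max (f x) (g x)) (max (f y) (g y)) \<le> L * dist x y"
    using lipschitz_onD[OF assms(1)] lipschitz_onD[OF assms(2)] unfolding dist_real_def
    by (smt (verit))
qed (rule lipschitz_on_nonneg[OF assms(1)])

lemma convex_on_max_fun:
  fixes f g :: "'a::real_vector \<Rightarrow> real"
  assumes f: "convex_on S f" and g: "convex_on S g" and S: "convex S"
  shows "convex_on S (\<lambda>x. max (f x) (g x))"
proof (rule convex_onI[OF _ S])
  fix s x y assume *: "(0::real) < s" "s < 1" "x \<in> S" "y \<in> S"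
  have b: "(1 - s) * f x + s * f y \<le> (1 - s) * max (f x) (g x) + s * max (f y) (g y)"
    "(1 - s) * g x + s * g y \<le> (1 - s) * max (f x) (g x) + s * max (f y) (g y)"
    using * by (intro add_mono mult_left_mono; simp)+
  show "max (f ((1 - s) *\<^sub>R x + s *\<^sub>R y)) (g ((1 - s) *\<^sub>R x + s *\<^sub>R y))
      \<le> (1 - s) * max (f x) (g x) + s * max (f y) (g y)"
    using b convex_onD[OF f, of s x y] convex_onD[OF g, of s x y] * by simp
qed

lemma affine_regular:
  fixes b :: "'a::euclidean_space"
  assumes "norm b \<le> G"
  shows "convex_on UNIV (\<lambda>z. a + b \<bullet> (z - c))" "G-lipschitz_on UNIV (\<lambda>z. a + b \<bullet> (z - c))"
proof -
  show "convex_on UNIV (\<lambda>z. a + b \<bullet> (z - c))"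
    by (rule convex_onI) (simp_all add: algebra_simps inner_simps)
  show "G-lipschitz_on UNIV (\<lambda>z. a + b \<bullet> (z - c))"
  proof (rule lipschitz_onI)
    show "0 \<le> G" using assms norm_ge_zero order_trans by blast
    fix x y :: 'a
    have "\<bar>b \<bullet> (x - y)\<bar> \<le> norm b * norm (x - y)" by (rule Cauchy_Schwarz_ineq2)
    also have "\<dots> \<le> G * norm (x - y)" using assms by (simp add: mult_right_mono)
    finally show "dist (a + b \<bullet> (x - c)) (a + b \<bullet> (y - c)) \<le> G * dist x y"
      by (simp add: dist_norm inner_diff_right)
  qed
qed

section \<open>Monotone approximations on a compact set\<close>

text \<open>
  By compactness there are two late visits \<open>k < k'\<close> in \<open>K\<close> at points close to each other. The first
  one has nearly closed the gap at \<open>x k\<close>; by monotonicity and the common Lipschitz constant, the gap at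
  \<open>x k'\<close> is then small before the second visit.
\<close>

lemma gap_before_visit:
  fixes f :: "'a::metric_space \<Rightarrow> real"
  assumes C: "compact C" and K: "infinite K" "\<And>k. k \<in> K \<Longrightarrow> 2 \<le> k"
    and f: "Lf-lipschitz_on C f" and F: "\<And>k. 1 \<le> k \<Longrightarrow> L-lipschitz_on C (F k)"
    and mono: "\<And>k y. 1 \<le> k \<Longrightarrow> y \<in> C \<Longrightarrow> F k y \<le> F (Suc k) y"
    and x: "\<And>k. 1 \<le> k \<Longrightarrow> x k \<in> C" and \<delta>: "0 < \<delta>"
    and closing: "\<forall>\<^sub>F k in sequentially. k \<in> K \<longrightarrow> f (x k) - F k (x k) \<le> \<delta> / 2"
  shows "\<exists>k\<in>K. f (x k) - F (k - 1) (x k) < \<delta>"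
proof -
  define e where "e = enumerate K"
  have eK: "e i \<in> K" for i unfolding e_def using K(1) by (rule enumerate_in_set)
  have e_mono: "strict_mono e" unfolding e_def using K(1) by (rule strict_mono_enumerate)
  have L: "0 \<le> L" using F[of 1] lipschitz_on_nonneg by blast
  have Lf: "0 \<le> Lf" using f by (rule lipschitz_on_nonneg)
  have "1 \<le> e i" for i using K(2)[OF eK[of i]] by simp
  then have "\<forall>i. x (e i) \<in> C" using x by blast
  then obtain l \<phi> where \<phi>: "strict_mono (\<phi> :: nat \<Rightarrow> nat)" "((\<lambda>i. x (e i)) \<circ> \<phi>) \<longlonglongrightarrow> l"
    using C unfolding compact_def by (metis (no_types, lifting))
  define \<eta> where "\<eta> = \<delta> / 2 / (L + Lf + 1)"
  have \<eta>: "0 < \<eta>" using \<delta> L Lf by (simp add: \<eta>_def)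
  have "Cauchy ((\<lambda>i. x (e i)) \<circ> \<phi>)" using \<phi>(2) by (rule LIMSEQ_imp_Cauchy)
  then obtain N where N: "\<And>i j. N \<le> i \<Longrightarrow> N \<le> j \<Longrightarrow> dist (x (e (\<phi> i))) (x (e (\<phi> j))) < \<eta>"
    unfolding Cauchy_def using \<eta> by (metis comp_apply)
  obtain N' where N': "\<And>k. N' \<le> k \<Longrightarrow> k \<in> K \<Longrightarrow> f (x k) - F k (x k) \<le> \<delta> / 2"
    using closing unfolding eventually_sequentially by blast
  define i where "i = max N N'"
  define k where "k = e (\<phi> i)"
  define k' where "k' = e (\<phi> (Suc i))"
  have kK: "k \<in> K" "k' \<in> K" using eK by (auto simp: k_def k'_def)
  have "i \<le> k" unfolding k_def using seq_suble[OF \<phi>(1), of i] seq_suble[OF e_mono, of "\<phi> i"] by linarith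
  then have close: "f (x k) - F k (x k) \<le> \<delta> / 2" using N'[of k] kK(1) by (simp add: i_def)
  have less: "k < k'"
    unfolding k_def k'_def using \<phi>(1) e_mono by (simp add: strict_mono_def)
  have k1: "1 \<le> k" "1 \<le> k'" using K(2) kK by fastforce+
  have d: "dist (x k') (x k) \<le> \<eta>"
    unfolding k_def k'_def by (rule less_imp_le, rule N) (simp_all add: i_def)
  have grow: "F k y \<le> F j y" if "k \<le> j" "y \<in> C" for j y
    using that(1)
  proof (induction j rule: dec_induct)
    case (step j)
    then show ?case using mono[of j y] k1(1) that(2) by simp
  qed simp
  have xC: "x k \<in> C" "x k' \<in> C" using x k1 by auto
  have "F k (x k') \<le> F (k' - 1) (x k')" using less xC(2) by (intro grow) auto
  moreover have "\<bar>F k (x k') - F k (x k)\<bar> \<le> L * dist (x k') (x k)"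
    using lipschitz_onD[OF F[OF k1(1)] xC(2,1)] by (simp add: dist_real_def)
  moreover have "\<bar>f (x k') - f (x k)\<bar> \<le> Lf * dist (x k') (x k)"
    using lipschitz_onD[OF f xC(2,1)] by (simp add: dist_real_def)
  moreover have "(L + Lf) * dist (x k') (x k) < \<delta> / 2"
  proof -
    have "(L + Lf) * dist (x k') (x k) \<le> (L + Lf) * \<eta>" using d L Lf by (simp add: mult_left_mono)
    also have "\<dots> < (L + Lf + 1) * \<eta>" using \<eta> by simp
    also have "\<dots> = \<delta> / 2"
    proof -
      have "c * (\<delta> / 2 / c) = \<delta> / 2" if "c \<noteq> 0" for c using that by simp
      then show ?thesis unfolding \<eta>_def using L Lf by (metis add_nonneg_nonneg add_nonneg_pos less_irrefl zero_less_one)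
    qed
    finally show ?thesis .
  qed
  ultimately have "f (x k') - F (k' - 1) (x k') < \<delta>" using close by (simp add: distrib_right)
  then show ?thesis using kK(2) by blast
qed

section \<open>Repeated sampling\<close>

text \<open>
  A form of the conditional Borel-Cantelli lemma for independent draws. The process that is
  multiplied by \<open>1 + p\<close> whenever \<open>E k\<close> occurs and killed when moreover \<open>a\<close> is drawn is a
  nonnegative supermartingale, because \<open>(1 + p) * (1 - p) \<le> 1\<close>. On the event that \<open>E k\<close> occurs
  infinitely often but is never accompanied by \<open>a\<close> from time \<open>N\<close> on, it tends to infinity, which
  Fatou's lemma allows on a null set only.
\<close>

lemma infinitely_often_drawn:
  fixes M :: "'a measure" and E :: "nat \<Rightarrow> (nat \<Rightarrow> 'a) \<Rightarrow> bool"
  assumes M: "prob_space M" "finite (space M)" "sets M = Pow (space M)"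
    and a: "a \<in> space M" "0 < measure M {a}"
    and adapted: "\<And>k \<omega> \<omega>'. 1 \<le> k \<Longrightarrow> \<omega> \<in> space (\<Pi>\<^sub>M k\<in>{1..}. M) \<Longrightarrow> \<omega>' \<in> space (\<Pi>\<^sub>M k\<in>{1..}. M) \<Longrightarrow>
      (\<And>j. j \<in> {1..<k} \<Longrightarrow> \<omega> j = \<omega>' j) \<Longrightarrow> E k \<omega> = E k \<omega>'"
  shows "AE \<omega> in (\<Pi>\<^sub>M k\<in>{1..}. M). (\<exists>\<^sub>\<infinity>k. E k \<omega>) \<longrightarrow> (\<exists>\<^sub>\<infinity>k. E k \<omega> \<and> \<omega> k = a)"
proof -
  let ?\<Omega> = "\<Pi>\<^sub>M k\<in>{1::nat..}. M"
  interpret M: prob_space M by (rule M(1))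
  interpret O: product_prob_space "\<lambda>_. M" "{1::nat..}" by standard
  define p where "p = measure M {a}"
  have p: "0 < p" "p \<le> 1" using a(2) by (auto simp: p_def)
  have coord: "\<omega> k \<in> space M" if "\<omega> \<in> space ?\<Omega>" "1 \<le> k" for \<omega> k
    using that by (auto simp: space_PiM PiE_def Pi_def)
  define pre where "pre k = (\<Pi>\<^sub>E j\<in>{1..<k}. space M)" for k :: nat
  have fin_pre: "finite (pre k)" for k unfolding pre_def by (intro finite_PiE M(2)) simp
  have Collect_sets: "{\<omega> \<in> space ?\<Omega>. \<forall>i\<in>J. \<omega> i \<in> X i} \<in> sets ?\<Omega>"
    if "J \<subseteq> {1..}" "finite J" "\<And>i. i \<in> J \<Longrightarrow> X i \<in> sets M" for J X
  proof -
    have "{\<omega> \<in> space ?\<Omega>. \<forall>i\<in>J. \<omega> i \<in> X i} = prod_emb {1..} (\<lambda>_. M) J (Pi\<^sub>E J X)"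
      unfolding prod_emb_def using that by (auto simp: space_PiM Pi_iff)
    then show ?thesis using sets_PiM_I[of J "{1..}" X "\<lambda>_. M"] that by simp
  qed
  define cyl where "cyl k v = {\<omega> \<in> space ?\<Omega>. \<forall>j\<in>{1..<k}. \<omega> j \<in> {v j}}" for k :: nat and v
  have v_sing: "{v j} \<in> sets M" if "v \<in> pre k" "j \<in> {1..<k}" for v j k
    using that M(3) by (auto simp: pre_def)
  have cyl_sets: "cyl k v \<in> sets ?\<Omega>" if "v \<in> pre k" for k v
    unfolding cyl_def by (rule Collect_sets) (use v_sing[OF that] in auto)
  have cyl_next: "emeasure ?\<Omega> (cyl k v \<inter> {\<omega> \<in> space ?\<Omega>. \<omega> k \<in> B}) = emeasure ?\<Omega> (cyl k v) * emeasure M B"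
    "cyl k v \<inter> {\<omega> \<in> space ?\<Omega>. \<omega> k \<in> B} \<in> sets ?\<Omega>"
    if "v \<in> pre k" "1 \<le> k" "B \<in> sets M" for k v B
  proof -
    let ?X = "\<lambda>j. if j = k then B else {v j}"
    have J: "{1..k} = insert k {1..<k}" using that(2) by auto
    have eq: "cyl k v \<inter> {\<omega> \<in> space ?\<Omega>. \<omega> k \<in> B} = {\<omega> \<in> space ?\<Omega>. \<forall>j\<in>{1..k}. \<omega> j \<in> ?X j}"
      unfolding J cyl_def by auto
    have X: "?X j \<in> sets M" if "j \<in> {1..k}" for j
      using that v_sing[OF \<open>v \<in> pre k\<close>, of j] \<open>B \<in> sets M\<close> by auto
    show "cyl k v \<inter> {\<omega> \<in> space ?\<Omega>. \<omega> k \<in> B} \<in> sets ?\<Omega>"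
      unfolding eq by (rule Collect_sets) (use X in auto)
    have "emeasure ?\<Omega> (cyl k v \<inter> {\<omega> \<in> space ?\<Omega>. \<omega> k \<in> B}) = (\<Prod>j\<in>{1..k}. emeasure M (?X j))"
      unfolding eq by (rule O.emeasure_PiM_Collect) (use X in auto)
    also have "\<dots> = (\<Prod>j\<in>{1..<k}. emeasure M {v j}) * emeasure M B"
      unfolding J by (subst prod.insert) (auto simp: mult.commute intro!: prod.cong)
    also have "(\<Prod>j\<in>{1..<k}. emeasure M {v j}) = emeasure ?\<Omega> (cyl k v)"
      unfolding cyl_def by (rule O.emeasure_PiM_Collect[symmetric]) (use v_sing[OF that(1)] in auto)
    finally show "emeasure ?\<Omega> (cyl k v \<inter> {\<omega> \<in> space ?\<Omega>. \<omega> k \<in> B}) = emeasure ?\<Omega> (cyl k v) * emeasure M B" .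
  qed
  define past where "past k h \<longleftrightarrow> (\<forall>\<omega>\<in>space ?\<Omega>. \<forall>\<omega>'\<in>space ?\<Omega>. (\<forall>j\<in>{1..<k}. \<omega> j = \<omega>' j) \<longrightarrow> h \<omega> = h \<omega>')"
    for k :: nat and h :: "(nat \<Rightarrow> 'a) \<Rightarrow> ennreal"
  define ext where "ext k v = (\<lambda>j. if j \<in> {1..<k} then v j else if 1 \<le> j then a else undefined)"
    for k :: nat and v
  \<comment> \<open>A function of the past is a combination of the indicators of the finitely many cylinders.\<close>
  have expand: "h \<omega> = (\<Sum>v\<in>pre k. h (ext k v) * indicator (cyl k v) \<omega>)"
    if h: "past k h" and \<omega>: "\<omega> \<in> space ?\<Omega>" for k h \<omega>
  proof -
    define w where "w = restrict \<omega> {1..<k}"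
    have w: "w \<in> pre k" unfolding w_def pre_def using coord[OF \<omega>] by auto
    have in_cyl: "\<omega> \<in> cyl k v \<longleftrightarrow> v = w" if "v \<in> pre k" for v
      using that \<omega> unfolding cyl_def w_def pre_def by (auto simp: PiE_def extensional_def fun_eq_iff)
    have "ext k w \<in> space ?\<Omega>"
      using coord[OF \<omega>] a(1) by (auto simp: ext_def w_def space_PiM PiE_def extensional_def)
    moreover have "\<forall>j\<in>{1..<k}. ext k w j = \<omega> j" by (simp add: ext_def w_def)
    ultimately have "h (ext k w) = h \<omega>"
      using h \<omega> unfolding past_def by blast
    moreover have "(\<Sum>v\<in>pre k. h (ext k v) * indicator (cyl k v) \<omega>) = (\<Sum>v\<in>pre k. if v = w then h (ext k w) else 0)"
      by (intro sum.cong) (auto simp: in_cyl indicator_def)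
    ultimately show ?thesis using w fin_pre by simp
  qed
  have past_meas: "h \<in> borel_measurable ?\<Omega>" if "past k h" for k h
  proof (subst measurable_cong[OF expand[OF that]])
    show "(\<lambda>\<omega>. \<Sum>v\<in>pre k. h (ext k v) * indicator (cyl k v) \<omega>) \<in> borel_measurable ?\<Omega>"
      by (intro borel_measurable_sum borel_measurable_times_ennreal borel_measurable_const
          borel_measurable_indicator cyl_sets)
  qed
  have next_meas: "(\<lambda>\<omega>. indicator B (\<omega> k) :: ennreal) \<in> borel_measurable ?\<Omega>" if "1 \<le> k" "B \<in> sets M" for B k
    by (rule measurable_compose[OF measurable_component_singleton borel_measurable_indicator]) (use that in auto)
  have indep: "(\<integral>\<^sup>+\<omega>. h \<omega> * indicator B (\<omega> k) \<partial>?\<Omega>) = (\<integral>\<^sup>+\<omega>. h \<omega> \<partial>?\<Omega>) * emeasure M B"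
    if h: "past k h" and k: "1 \<le> k" and B: "B \<in> sets M" for k h B
  proof -
    have "(\<integral>\<^sup>+\<omega>. h \<omega> * indicator B (\<omega> k) \<partial>?\<Omega>)
        = (\<integral>\<^sup>+\<omega>. (\<Sum>v\<in>pre k. h (ext k v) * indicator (cyl k v \<inter> {\<omega> \<in> space ?\<Omega>. \<omega> k \<in> B}) \<omega>) \<partial>?\<Omega>)"
    proof (rule nn_integral_cong)
      fix \<omega> assume \<omega>: "\<omega> \<in> space ?\<Omega>"
      show "h \<omega> * indicator B (\<omega> k)
          = (\<Sum>v\<in>pre k. h (ext k v) * indicator (cyl k v \<inter> {\<omega> \<in> space ?\<Omega>. \<omega> k \<in> B}) \<omega>)"
        unfolding expand[OF h \<omega>] sum_distrib_right using \<omega> by (intro sum.cong) (auto simp: indicator_def)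
    qed
    also have "\<dots> = (\<Sum>v\<in>pre k. h (ext k v) * (emeasure ?\<Omega> (cyl k v) * emeasure M B))"
      using cyl_next[OF _ k B] by (subst nn_integral_sum) (auto simp: nn_integral_cmult_indicator intro!: sum.cong)
    also have "\<dots> = (\<Sum>v\<in>pre k. h (ext k v) * emeasure ?\<Omega> (cyl k v)) * emeasure M B"
      by (simp add: sum_distrib_right mult.assoc)
    also have "(\<Sum>v\<in>pre k. h (ext k v) * emeasure ?\<Omega> (cyl k v))
        = (\<integral>\<^sup>+\<omega>. (\<Sum>v\<in>pre k. h (ext k v) * indicator (cyl k v) \<omega>) \<partial>?\<Omega>)"
      using cyl_sets by (subst nn_integral_sum) (auto simp: nn_integral_cmult_indicator intro!: sum.cong)
    also have "\<dots> = (\<integral>\<^sup>+\<omega>. h \<omega> \<partial>?\<Omega>)"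
      by (rule nn_integral_cong) (simp add: expand[OF h])
    finally show ?thesis .
  qed
  define w where "w i \<omega> = (if E i \<omega> then (if \<omega> i = a then 0 else 1 + p) else 1)" for i \<omega>
  define W where "W N k \<omega> = (\<Prod>i\<in>{N..<k}. w i \<omega>)" for N k \<omega>
  have w_nonneg: "0 \<le> w i \<omega>" for i \<omega> using p by (simp add: w_def)
  have W_nonneg: "0 \<le> W N k \<omega>" for N k \<omega> unfolding W_def by (intro prod_nonneg) (simp add: w_nonneg)
  have W_past: "past k (\<lambda>\<omega>. ennreal (W N k \<omega>))" if "1 \<le> N" for N k
    unfolding past_def
  proof (intro ballI impI)
    fix \<omega> \<omega>' assume *: "\<omega> \<in> space ?\<Omega>" "\<omega>' \<in> space ?\<Omega>" "\<forall>j\<in>{1..<k}. \<omega> j = \<omega>' j"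
    have "w i \<omega> = w i \<omega>'" if "i \<in> {N..<k}" for i
    proof -
      have "E i \<omega> = E i \<omega>'" using that \<open>1 \<le> N\<close> * by (intro adapted) auto
      moreover have "\<omega> i = \<omega>' i" using that \<open>1 \<le> N\<close> *(3) by auto
      ultimately show ?thesis by (simp add: w_def)
    qed
    then show "ennreal (W N k \<omega>) = ennreal (W N k \<omega>')" by (simp add: W_def)
  qed
  have W_le: "(\<integral>\<^sup>+\<omega>. ennreal (W N k \<omega>) \<partial>?\<Omega>) \<le> 1" if N: "1 \<le> N" for N k
  proof (induction k)
    case 0
    then show ?case using O.P.emeasure_space_1 by (simp add: W_def del: One_nat_def)
  next
    case (Suc k)
    show ?case
    proof (cases "N \<le> k")
      case False
      then show ?thesis using O.P.emeasure_space_1 by (simp add: W_def del: One_nat_def)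
    next
      case True
      have k: "1 \<le> k" using N True by simp
      let ?W = "\<lambda>\<omega>. ennreal (W N k \<omega>)" and ?B = "space M - {a}"
      have B: "?B \<in> sets M" using M(3) by auto
      have mB: "ennreal (1 + p) * emeasure M ?B \<le> 1"
      proof -
        have "measure M ?B = 1 - p"
          unfolding p_def using M.prob_compl[of "{a}"] a(1) M(3) by simp
        then have "ennreal (1 + p) * emeasure M ?B = ennreal ((1 + p) * (1 - p))"
          using p by (simp add: M.emeasure_eq_measure ennreal_mult)
        also have "\<dots> \<le> 1" using p by (subst ennreal_le_1) (simp add: algebra_simps)
        finally show ?thesis .
      qed
      have E_past: "past k (\<lambda>\<omega>. ?W \<omega> * indicator {\<omega>. E k \<omega>} \<omega>)" "past k (\<lambda>\<omega>. ?W \<omega> * indicator {\<omega>. \<not> E k \<omega>} \<omega>)"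
      proof -
        have agree: "E k \<omega> = E k \<omega>'" "?W \<omega> = ?W \<omega>'"
          if "\<omega> \<in> space ?\<Omega>" "\<omega>' \<in> space ?\<Omega>" "\<forall>j\<in>{1..<k}. \<omega> j = \<omega>' j" for \<omega> \<omega>'
        proof -
          show "E k \<omega> = E k \<omega>'" by (rule adapted[OF k that(1,2)]) (rule bspec[OF that(3)])
          show "?W \<omega> = ?W \<omega>'"
            by (rule W_past[OF N, of k, unfolded past_def, rule_format, OF that(1,2)]) (rule bspec[OF that(3)])
        qed
        show "past k (\<lambda>\<omega>. ?W \<omega> * indicator {\<omega>. E k \<omega>} \<omega>)"
          unfolding past_def indicator_def mem_Collect_eq
          by (intro ballI impI arg_cong2[where f="(*)"] arg_cong[where f=of_bool] agree) blast+
        show "past k (\<lambda>\<omega>. ?W \<omega> * indicator {\<omega>. \<not> E k \<omega>} \<omega>)"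
          unfolding past_def indicator_def mem_Collect_eq
          by (intro ballI impI arg_cong2[where f="(*)"] arg_cong[where f=of_bool] arg_cong[where f=Not] agree) blast+
      qed
      have "W N (Suc k) \<omega> = W N k \<omega> * w k \<omega>" for \<omega>
        using True by (simp add: W_def)
      then have "(\<integral>\<^sup>+\<omega>. ennreal (W N (Suc k) \<omega>) \<partial>?\<Omega>) = (\<integral>\<^sup>+\<omega>. ?W \<omega> * indicator {\<omega>. \<not> E k \<omega>} \<omega>
          + ennreal (1 + p) * ((?W \<omega> * indicator {\<omega>. E k \<omega>} \<omega>) * indicator ?B (\<omega> k)) \<partial>?\<Omega>)"
        using coord[OF _ k] p W_nonneg
        by (intro nn_integral_cong) (auto simp: w_def indicator_def ennreal_mult mult.commute)
      also have "\<dots> = (\<integral>\<^sup>+\<omega>. ?W \<omega> * indicator {\<omega>. \<not> E k \<omega>} \<omega> \<partial>?\<Omega>)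
          + ennreal (1 + p) * (\<integral>\<^sup>+\<omega>. (?W \<omega> * indicator {\<omega>. E k \<omega>} \<omega>) * indicator ?B (\<omega> k) \<partial>?\<Omega>)"
        using past_meas[OF E_past(1)] past_meas[OF E_past(2)] next_meas[OF k B]
        by (subst nn_integral_add) (auto intro!: nn_integral_cmult)
      also have "(\<integral>\<^sup>+\<omega>. (?W \<omega> * indicator {\<omega>. E k \<omega>} \<omega>) * indicator ?B (\<omega> k) \<partial>?\<Omega>)
          = (\<integral>\<^sup>+\<omega>. ?W \<omega> * indicator {\<omega>. E k \<omega>} \<omega> \<partial>?\<Omega>) * emeasure M ?B"
        by (rule indep[OF E_past(1) k B])
      also have "ennreal (1 + p) * ((\<integral>\<^sup>+\<omega>. ?W \<omega> * indicator {\<omega>. E k \<omega>} \<omega> \<partial>?\<Omega>) * emeasure M ?B)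
          \<le> (\<integral>\<^sup>+\<omega>. ?W \<omega> * indicator {\<omega>. E k \<omega>} \<omega> \<partial>?\<Omega>)"
        using mult_left_mono[OF mB, of "\<integral>\<^sup>+\<omega>. ?W \<omega> * indicator {\<omega>. E k \<omega>} \<omega> \<partial>?\<Omega>"] by (simp add: mult_ac)
      also have "(\<integral>\<^sup>+\<omega>. ?W \<omega> * indicator {\<omega>. \<not> E k \<omega>} \<omega> \<partial>?\<Omega>) + (\<integral>\<^sup>+\<omega>. ?W \<omega> * indicator {\<omega>. E k \<omega>} \<omega> \<partial>?\<Omega>)
          = (\<integral>\<^sup>+\<omega>. ?W \<omega> \<partial>?\<Omega>)"
        using past_meas[OF E_past(1)] past_meas[OF E_past(2)]
        by (subst nn_integral_add[symmetric]) (auto intro!: nn_integral_cong simp: indicator_def)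
      also have "\<dots> \<le> 1" by (rule Suc.IH)
      finally show ?thesis by (simp add: add_left_mono)
    qed
  qed
  have fatou: "AE \<omega> in ?\<Omega>. liminf (\<lambda>k. ennreal (W N k \<omega>)) \<noteq> \<infinity>" if N: "1 \<le> N" for N
  proof (rule nn_integral_PInf_AE)
    have meas: "(\<lambda>\<omega>. ennreal (W N k \<omega>)) \<in> borel_measurable ?\<Omega>" for k by (rule past_meas[OF W_past[OF N]])
    then show "(\<lambda>\<omega>. liminf (\<lambda>k. ennreal (W N k \<omega>))) \<in> borel_measurable ?\<Omega>" by measurable
    have "(\<integral>\<^sup>+\<omega>. liminf (\<lambda>k. ennreal (W N k \<omega>)) \<partial>?\<Omega>) \<le> liminf (\<lambda>k. \<integral>\<^sup>+\<omega>. ennreal (W N k \<omega>) \<partial>?\<Omega>)"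
      by (rule nn_integral_liminf) (rule meas)
    also have "\<dots> \<le> liminf (\<lambda>k::nat. 1)"
      by (intro Liminf_mono always_eventually allI W_le N)
    also have "\<dots> = 1" by (rule Liminf_const) simp
    finally show "(\<integral>\<^sup>+\<omega>. liminf (\<lambda>k. ennreal (W N k \<omega>)) \<partial>?\<Omega>) \<noteq> \<infinity>"
      by (metis ennreal_one_neq_top infinity_ennreal_def top.extremum_unique)
  qed
  have diverges: "liminf (\<lambda>k. ennreal (W N k \<omega>)) = \<infinity>"
    if inf: "\<exists>\<^sub>\<infinity>k. E k \<omega>" and no: "\<And>k. N \<le> k \<Longrightarrow> \<not> (E k \<omega> \<and> \<omega> k = a)" for \<omega> N
  proof -
    have big: "\<forall>\<^sub>F k in sequentially. ennreal (of_nat c) \<le> ennreal (W N k \<omega>)" for c :: nat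
    proof -
      obtain c' where c': "of_nat c \<le> (1 + p) ^ c'"
        using real_arch_pow[of "1 + p" "of_nat c"] p by (meson less_add_same_cancel1 less_imp_le)
      have "infinite ({k. E k \<omega>} - {..<N})" using inf by (simp add: frequently_cofinite)
      then obtain S where S: "finite S" "card S = c'" "S \<subseteq> {k. E k \<omega>} - {..<N}"
        by (metis infinite_arbitrarily_large)
      have "\<forall>\<^sub>F k in sequentially. Max (insert 0 S) < k" by (rule eventually_gt_at_top)
      then show ?thesis
      proof eventually_elim
        case (elim k)
        have "S \<subseteq> {N..<k}" using S(1,3) elim by (auto simp: not_less)
        then have split: "W N k \<omega> = (\<Prod>i\<in>S. w i \<omega>) * (\<Prod>i\<in>{N..<k} - S. w i \<omega>)"
          unfolding W_def by (metis finite_atLeastLessThan mult.commute prod.subset_diff)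
        have "w i \<omega> = 1 + p" if "i \<in> S" for i
        proof -
          have "N \<le> i" "E i \<omega>" using S(3) that by (auto simp: not_less)
          then show ?thesis using no[of i] by (simp add: w_def)
        qed
        then have "(\<Prod>i\<in>S. w i \<omega>) = (\<Prod>i\<in>S. 1 + p)" by simp
        then have "(\<Prod>i\<in>S. w i \<omega>) = (1 + p) ^ c'" by (simp add: S(2))
        moreover have "1 \<le> (\<Prod>i\<in>{N..<k} - S. w i \<omega>)"
          using no p by (intro prod_ge_1) (auto simp: w_def)
        ultimately have "(1 + p) ^ c' \<le> W N k \<omega>"
          unfolding split using p mult_left_mono[of 1 "\<Prod>i\<in>{N..<k} - S. w i \<omega>" "(1 + p) ^ c'"] by simp
        then show ?case using c' by (intro ennreal_leI) simp
      qed
    qed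
    have ge: "ennreal (of_nat c) \<le> liminf (\<lambda>k. ennreal (W N k \<omega>))" for c :: nat
      by (rule Liminf_bounded[OF big])
    show ?thesis
    proof (cases "liminf (\<lambda>k. ennreal (W N k \<omega>))" rule: ennreal_cases)
      case (real y)
      obtain c :: nat where "y < of_nat c" using reals_Archimedean2 by blast
      then show ?thesis using ge[of c] real by simp
    qed simp
  qed
  have "AE \<omega> in ?\<Omega>. \<forall>N. liminf (\<lambda>k. ennreal (W (Suc N) k \<omega>)) \<noteq> \<infinity>"
    unfolding AE_all_countable by (intro allI fatou) simp
  then show ?thesis
  proof eventually_elim
    case (elim \<omega>)
    show ?case
    proof (intro impI, rule ccontr)
      assume inf: "\<exists>\<^sub>\<infinity>k. E k \<omega>" and "\<not> (\<exists>\<^sub>\<infinity>k. E k \<omega> \<and> \<omega> k = a)"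
      then have "\<forall>\<^sub>\<infinity>k. \<not> (E k \<omega> \<and> \<omega> k = a)" by (simp add: not_frequently)
      then obtain N where "\<And>k. N \<le> k \<Longrightarrow> \<not> (E k \<omega> \<and> \<omega> k = a)"
        unfolding MOST_nat_le by blast
      then have "liminf (\<lambda>k. ennreal (W (Suc N) k \<omega>)) = \<infinity>" using inf by (intro diverges) auto
      then show False using elim by blast
    qed
  qed
qed

section \<open>One convex stage\<close>

text \<open>
  The problem of one stage for one realization of the noise: the decision \<open>y \<in> X\<close> is chosen after
  the previous decision \<open>x \<in> U\<close>.
\<close>

locale convex_stage =
  fixes X U :: "(real^'n::finite) set"
    and f :: "(real^'n) \<times> (real^'n) \<Rightarrow> real"
    and g :: "'p::finite \<Rightarrow> (real^'n) \<times> (real^'n) \<Rightarrow> real"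
    and A B :: "real^'n^'q::finite" and b :: "real^'q"
  assumes X_convex: "convex X" and X_compact: "compact X"
    and U_convex: "convex U" and U_compact: "compact U"
    and f_convex: "convex_on (X \<times> U) f" and f_C1: "C1_on (X \<times> U) f"
    and g_convex: "\<And>i. convex_on (X \<times> U) (g i)" and g_C1: "\<And>i. C1_on (X \<times> U) (g i)"
    and stage_feasible:
      "\<And>x. x \<in> U \<Longrightarrow> \<exists>y\<in>X. (\<forall>i. g i (y, x) \<le> 0) \<and> A *v y + B *v x - b = 0"
begin

definition res :: "real^'n \<Rightarrow> real^'n \<Rightarrow> real^'q" where
  "res y x = A *v y + B *v x - b"

definition feas_set :: "real^'n \<Rightarrow> (real^'n) set" where
  "feas_set x = {y \<in> X. (\<forall>i. g i (y, x) \<le> 0) \<and> res y x = 0}"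

definition val :: "(real^'n \<Rightarrow> real) \<Rightarrow> real^'n \<Rightarrow> real" where
  "val V x = (INF y\<in>feas_set x. f (y, x) + V y)"

definition lagr :: "(real^'n \<Rightarrow> real) \<Rightarrow> real^'n \<Rightarrow> real^'q \<Rightarrow> real^'p \<Rightarrow> real^'n \<Rightarrow> real" where
  "lagr V x l u z = f (z, x) + V z + l \<bullet> res z x + (\<Sum>i\<in>UNIV. u $ i * g i (z, x))"

text \<open>
  The gradients of the Lagrangian without its cost-to-go term, with respect to the decision and to the
  previous decision. The first one enters the correction \<open>\<eta>\<close> of a cut, the second one is its slope.
\<close>

definition grad_y :: "real^'n \<Rightarrow> real^'n \<Rightarrow> real^'q \<Rightarrow> real^'p \<Rightarrow> real^'n" where
  "grad_y y x l u = gradient (\<lambda>y'. f (y', x)) y + transpose A *v l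
     + (\<Sum>i\<in>UNIV. u $ i *\<^sub>R gradient (\<lambda>y'. g i (y', x)) y)"

definition grad_x :: "real^'n \<Rightarrow> real^'n \<Rightarrow> real^'q \<Rightarrow> real^'p \<Rightarrow> real^'n" where
  "grad_x y x l u = gradient (\<lambda>x'. f (y, x')) x + transpose B *v l
     + (\<Sum>i\<in>UNIV. u $ i *\<^sub>R gradient (\<lambda>x'. g i (y, x')) x)"

lemma XU_compact: "compact (X \<times> U)" and XU_convex: "convex (X \<times> U)"
  by (intro compact_Times X_compact U_compact, intro convex_Times X_convex U_convex)

lemma feas_set_subset: "feas_set x \<subseteq> X"
  by (auto simp: feas_set_def)

lemma feas_set_nonempty: "x \<in> U \<Longrightarrow> feas_set x \<noteq> {}"
  using stage_feasible[of x] by (auto simp: feas_set_def res_def)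

lemma continuous_slice:
  assumes "C1_on (X \<times> U) h" "x \<in> U"
  shows "continuous_on X (\<lambda>y. h (y, x))"
  by (rule continuous_on_compose2[OF C1_on_continuous[OF assms(1)]])
     (use assms(2) in \<open>auto intro!: continuous_intros\<close>)

lemma feas_set_compact:
  assumes "x \<in> U"
  shows "compact (feas_set x)"
proof -
  have "closed {y \<in> X. g i (y, x) \<le> 0}" for i
    by (rule continuous_on_closed_Collect_le[OF continuous_slice[OF g_C1 assms]])
       (auto intro: compact_imp_closed X_compact)
  moreover have "closed {y. res y x = 0}"
    unfolding res_def
    by (intro closed_Collect_eq continuous_intros matrix_vector_mult_linear_continuous_on)
  ultimately have "closed ((\<Inter>i. {y \<in> X. g i (y, x) \<le> 0}) \<inter> {y. res y x = 0})"
    by blast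
  then have "compact (X \<inter> ((\<Inter>i. {y \<in> X. g i (y, x) \<le> 0}) \<inter> {y. res y x = 0}))"
    by (intro compact_Int_closed X_compact)
  also have "X \<inter> ((\<Inter>i. {y \<in> X. g i (y, x) \<le> 0}) \<inter> {y. res y x = 0}) = feas_set x"
    by (auto simp: feas_set_def)
  finally show ?thesis .
qed

lemma val_attained:
  assumes "continuous_on X V" "x \<in> U"
  shows "\<exists>y\<in>feas_set x. val V x = f (y, x) + V y \<and> (\<forall>y'\<in>feas_set x. val V x \<le> f (y', x) + V y')"
proof -
  have "continuous_on (feas_set x) (\<lambda>y. f (y, x) + V y)"
    by (intro continuous_on_add continuous_on_subset[OF continuous_slice[OF f_C1 assms(2)]]
          continuous_on_subset[OF assms(1)] feas_set_subset)
  then obtain y where y: "y \<in> feas_set x"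
      "\<And>y'. y' \<in> feas_set x \<Longrightarrow> f (y, x) + V y \<le> f (y', x) + V y'"
    using continuous_attains_inf[OF feas_set_compact[OF assms(2)] feas_set_nonempty[OF assms(2)],
        of "\<lambda>y. f (y, x) + V y"] by blast
  then have "val V x = f (y, x) + V y"
    unfolding val_def by (intro cInf_eq_minimum) auto
  then show ?thesis using y by (intro bexI[of _ y]) simp_all
qed

lemma val_le:
  assumes "continuous_on X V" "x \<in> U" "y \<in> feas_set x"
  shows "val V x \<le> f (y, x) + V y"
  using val_attained[OF assms(1,2)] assms(3) by blast

lemma gradient_bound:
  shows "\<exists>G\<ge>0. (\<forall>z\<in>X \<times> U. norm (gradient f z) \<le> G)
    \<and> (\<forall>i. \<forall>z\<in>X \<times> U. norm (gradient (g i) z) \<le> G)"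
proof -
  obtain Gf where Gf: "0 \<le> Gf" "\<forall>z\<in>X \<times> U. norm (gradient f z) \<le> Gf"
    using C1_on_bounded_gradient[OF f_C1 XU_compact] by blast
  have "\<forall>i. \<exists>G\<ge>0. \<forall>z\<in>X \<times> U. norm (gradient (g i) z) \<le> G"
    using C1_on_bounded_gradient[OF g_C1 XU_compact] by meson
  then obtain Gg where Gg: "\<And>i. 0 \<le> Gg i" "\<And>i. \<forall>z\<in>X \<times> U. norm (gradient (g i) z) \<le> Gg i"
    by metis
  have le: "Gg i \<le> (\<Sum>i\<in>UNIV. Gg i)" for i
    by (rule member_le_sum) (auto intro: Gg)
  show ?thesis
  proof (intro exI[of _ "Gf + (\<Sum>i\<in>UNIV. Gg i)"] conjI)
    show "0 \<le> Gf + (\<Sum>i\<in>UNIV. Gg i)" using Gf(1) Gg(1) by (simp add: sum_nonneg)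
    show "\<forall>z\<in>X \<times> U. norm (gradient f z) \<le> Gf + (\<Sum>i\<in>UNIV. Gg i)"
      using Gf(2) sum_nonneg[of UNIV Gg] Gg(1) by force
    show "\<forall>i. \<forall>z\<in>X \<times> U. norm (gradient (g i) z) \<le> Gf + (\<Sum>i\<in>UNIV. Gg i)"
    proof (intro allI ballI)
      fix i z assume "z \<in> X \<times> U"
      then show "norm (gradient (g i) z) \<le> Gf + (\<Sum>i\<in>UNIV. Gg i)"
        using bspec[OF Gg(2)[of i]] le[of i] Gf(1) by fastforce
    qed
  qed
qed

lemma lipschitz_data:
  shows "\<exists>L\<ge>0. (\<forall>z\<in>X \<times> U. \<forall>z'\<in>X \<times> U. \<bar>f z - f z'\<bar> \<le> L * dist z z')
    \<and> (\<forall>i. \<forall>z\<in>X \<times> U. \<forall>z'\<in>X \<times> U. \<bar>g i z - g i z'\<bar> \<le> L * dist z z')"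
proof -
  obtain Lf where Lf: "0 \<le> Lf" "\<forall>z\<in>X \<times> U. \<forall>z'\<in>X \<times> U. \<bar>f z - f z'\<bar> \<le> Lf * dist z z'"
    using C1_on_lipschitz[OF f_C1 XU_compact XU_convex] by blast
  have "\<forall>i. \<exists>L\<ge>0. \<forall>z\<in>X \<times> U. \<forall>z'\<in>X \<times> U. \<bar>g i z - g i z'\<bar> \<le> L * dist z z'"
    using C1_on_lipschitz[OF g_C1 XU_compact XU_convex] by meson
  then obtain Lg where Lg: "\<And>i. 0 \<le> Lg i"
      "\<And>i. \<forall>z\<in>X \<times> U. \<forall>z'\<in>X \<times> U. \<bar>g i z - g i z'\<bar> \<le> Lg i * dist z z'"
    by metis
  let ?L = "Lf + (\<Sum>i\<in>UNIV. Lg i)"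
  have le: "Lg i \<le> ?L" for i
    using member_le_sum[of i UNIV Lg] Lg(1) Lf(1) by fastforce
  have lef: "Lf \<le> ?L" using Lg(1) by (simp add: sum_nonneg)
  have weaken: "a \<le> ?L * dist z z'" if "a \<le> c * dist z z'" "c \<le> ?L"
    for a c and z z' :: "(real^'n) \<times> (real^'n)"
    using that(1) mult_right_mono[OF that(2) zero_le_dist] by (rule order_trans)
  show ?thesis
  proof (intro exI[of _ ?L] conjI)
    show "0 \<le> ?L" using Lf(1) lef by simp
    show "\<forall>z\<in>X \<times> U. \<forall>z'\<in>X \<times> U. \<bar>f z - f z'\<bar> \<le> ?L * dist z z'"
      by (intro ballI weaken[OF _ lef] Lf(2)[rule_format])
    show "\<forall>i. \<forall>z\<in>X \<times> U. \<forall>z'\<in>X \<times> U. \<bar>g i z - g i z'\<bar> \<le> ?L * dist z z'"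
      by (intro allI ballI, rule weaken[OF _ le], rule Lg(2)[rule_format])
  qed
qed

lemma bounded_data:
  shows "\<exists>M\<ge>0. (\<forall>z\<in>X \<times> U. \<bar>f z\<bar> \<le> M) \<and> (\<forall>i. \<forall>z\<in>X \<times> U. \<bar>g i z\<bar> \<le> M)
    \<and> (\<forall>y\<in>X. \<forall>y'\<in>X. norm (y - y') \<le> M)"
proof -
  have bd: "\<exists>M. \<forall>z\<in>X \<times> U. \<bar>h z\<bar> \<le> M" if "C1_on (X \<times> U) h" for h
  proof -
    have "bounded (h ` (X \<times> U))"
      by (intro compact_imp_bounded compact_continuous_image C1_on_continuous that XU_compact)
    then show ?thesis unfolding bounded_iff by auto
  qed
  obtain Mf where Mf: "\<forall>z\<in>X \<times> U. \<bar>f z\<bar> \<le> Mf" using bd[OF f_C1] by blast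
  obtain Mg where Mg: "\<And>i. \<forall>z\<in>X \<times> U. \<bar>g i z\<bar> \<le> Mg i" using bd[OF g_C1] by metis
  have dX: "norm (y - y') \<le> diameter X" if "y \<in> X" "y' \<in> X" for y y'
    using diameter_bounded_bound[OF compact_imp_bounded[OF X_compact] that] by (simp add: dist_norm)
  let ?M = "\<bar>Mf\<bar> + (\<Sum>i\<in>UNIV. \<bar>Mg i\<bar>) + \<bar>diameter X\<bar>"
  have s: "0 \<le> (\<Sum>i\<in>UNIV. \<bar>Mg i\<bar>)" by (simp add: sum_nonneg)
  have le: "\<bar>Mg i\<bar> \<le> (\<Sum>i\<in>UNIV. \<bar>Mg i\<bar>)" for i by (rule member_le_sum) auto
  show ?thesis
  proof (intro exI[of _ ?M] conjI)
    show "0 \<le> ?M" using s by linarith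
    show "\<forall>z\<in>X \<times> U. \<bar>f z\<bar> \<le> ?M"
    proof
      fix z assume "z \<in> X \<times> U"
      then have "\<bar>f z\<bar> \<le> Mf" using Mf by blast
      then show "\<bar>f z\<bar> \<le> ?M" using s by linarith
    qed
    show "\<forall>i. \<forall>z\<in>X \<times> U. \<bar>g i z\<bar> \<le> ?M"
    proof (intro allI ballI)
      fix i z assume "z \<in> X \<times> U"
      then have "\<bar>g i z\<bar> \<le> Mg i" using Mg[of i] by blast
      then show "\<bar>g i z\<bar> \<le> ?M" using le[of i] by linarith
    qed
    show "\<forall>y\<in>X. \<forall>y'\<in>X. norm (y - y') \<le> ?M"
    proof (intro ballI)
      fix y y' assume "y \<in> X" "y' \<in> X"
      from dX[OF this] show "norm (y - y') \<le> ?M" using s by linarith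
    qed
  qed
qed

lemma gradient_slices:
  assumes "C1_on (X \<times> U) h" "y \<in> X" "x \<in> U"
  shows "gradient (\<lambda>y'. h (y', x)) y = fst (gradient h (y, x))"
    and "gradient (\<lambda>x'. h (y, x')) x = snd (gradient h (y, x))"
proof -
  have "GDERIV h (y, x) :> gradient h (y, x)"
    by (rule C1_on_GDERIV[OF assms(1)]) (use assms in simp)
  then show "gradient (\<lambda>y'. h (y', x)) y = fst (gradient h (y, x))"
    and "gradient (\<lambda>x'. h (y, x')) x = snd (gradient h (y, x))"
    using GDERIV_fst GDERIV_snd gradient_eqI by blast+
qed

lemma inner_grad_y:
  assumes "y \<in> X" "x \<in> U"
  shows "grad_y y x l u \<bullet> w = fst (gradient f (y, x)) \<bullet> w + l \<bullet> (A *v w)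
     + (\<Sum>i\<in>UNIV. u $ i * (fst (gradient (g i) (y, x)) \<bullet> w))"
  unfolding grad_y_def gradient_slices(1)[OF f_C1 assms] gradient_slices(1)[OF g_C1 assms]
  by (simp add: inner_add_left inner_sum_left dot_lmul_matrix)

lemma inner_grad_x:
  assumes "y \<in> X" "x \<in> U"
  shows "grad_x y x l u \<bullet> w = snd (gradient f (y, x)) \<bullet> w + l \<bullet> (B *v w)
     + (\<Sum>i\<in>UNIV. u $ i * (snd (gradient (g i) (y, x)) \<bullet> w))"
  unfolding grad_x_def gradient_slices(2)[OF f_C1 assms] gradient_slices(2)[OF g_C1 assms]
  by (simp add: inner_add_left inner_sum_left dot_lmul_matrix)

text \<open>
  The tangent inequalities of \<open>f\<close> and of the \<open>g i\<close> at \<open>(y\<^sub>0, x\<^sub>0)\<close>, weighted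
  with the multipliers, bound the objective at any point feasible for \<open>x\<close>; the terms in the direction
  \<open>z - y\<^sub>0\<close> that inexactness leaves over are exactly those which \<open>\<eta>\<close> dominates.
\<close>

lemma cut_valid:
  assumes y0: "y0 \<in> feas_set x0" "x0 \<in> U" and u: "\<And>i. 0 \<le> u $ i"
    and eta: "\<And>z. z \<in> X \<Longrightarrow> grad_y y0 x0 l u \<bullet> (y0 - z) + V y0 - V z \<le> \<eta>"
    and z: "z \<in> feas_set x" "x \<in> U"
  shows "f (y0, x0) + V y0 + (\<Sum>i\<in>UNIV. u $ i * g i (y0, x0)) - \<eta> + grad_x y0 x0 l u \<bullet> (x - x0)
    \<le> f (z, x) + V z"
proof -
  have y0X: "y0 \<in> X" and zX: "z \<in> X" using y0 z by (auto simp: feas_set_def)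
  have tangent: "h (y0, x0) + fst (gradient h (y0, x0)) \<bullet> (z - y0) + snd (gradient h (y0, x0)) \<bullet> (x - x0)
      \<le> h (z, x)" if "convex_on (X \<times> U) h" "C1_on (X \<times> U) h" for h
    using convex_on_tangent[OF that(1) C1_on_GDERIV[OF that(2)], of "(y0, x0)" "(z, x)"] y0X zX y0 z
    by (simp add: inner_prod_def)
  have "(\<Sum>i\<in>UNIV. u $ i * (g i (y0, x0) + fst (gradient (g i) (y0, x0)) \<bullet> (z - y0)
      + snd (gradient (g i) (y0, x0)) \<bullet> (x - x0))) \<le> (\<Sum>i\<in>UNIV. u $ i * g i (z, x))"
    by (intro sum_mono mult_left_mono tangent g_convex g_C1 u)
  also have "\<dots> \<le> 0"
    using z u by (intro sum_nonpos mult_nonneg_nonpos) (auto simp: feas_set_def)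
  finally have G: "(\<Sum>i\<in>UNIV. u $ i * g i (y0, x0))
      + (\<Sum>i\<in>UNIV. u $ i * (fst (gradient (g i) (y0, x0)) \<bullet> (z - y0)))
      + (\<Sum>i\<in>UNIV. u $ i * (snd (gradient (g i) (y0, x0)) \<bullet> (x - x0))) \<le> 0"
    by (simp add: distrib_left sum.distrib)
  have "A *v (z - y0) + B *v (x - x0) = res z x - res y0 x0"
    by (simp add: res_def matrix_vector_mult_diff_distrib)
  then have "l \<bullet> (A *v (z - y0)) + l \<bullet> (B *v (x - x0)) = 0"
    using y0 z by (simp add: feas_set_def flip: inner_add_right)
  moreover have "grad_y y0 x0 l u \<bullet> (y0 - z) = - (grad_y y0 x0 l u \<bullet> (z - y0))"
    by (simp add: inner_diff_right)
  ultimately show ?thesis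
    using tangent[OF f_convex f_C1] G eta[OF zX]
    unfolding inner_grad_x[OF y0X y0(2)] inner_grad_y[OF y0X y0(2)]
    by linarith
qed

text \<open>
  This is why \<open>\<eta>\<close> vanishes. Moving from the near-minimizer \<open>y\<close> of the Lagrangian by a fraction \<open>s\<close> towards
  \<open>z\<close> gains at most \<open>\<delta>\<close>, so by convexity of \<open>V\<close> the linearized gain is at most the
  linearization error over \<open>s\<close> plus \<open>\<delta> / s\<close>. The first term is small for small \<open>s\<close>, uniformly in all
  data, and the second one is small when \<open>\<delta>\<close> is small compared with \<open>s\<close>.
\<close>

lemma near_minimizer_gap:
  assumes "0 \<le> K" "0 < e"
  shows "\<exists>\<delta>0>0. \<forall>V x y l u \<delta> z. convex_on X V \<longrightarrow> x \<in> U \<longrightarrow> y \<in> X \<longrightarrow> (\<forall>i. 0 \<le> u $ i) \<longrightarrow>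
       (\<Sum>i\<in>UNIV. u $ i) \<le> K \<longrightarrow> \<delta> \<le> \<delta>0 \<longrightarrow> (\<forall>z\<in>X. lagr V x l u y \<le> lagr V x l u z + \<delta>) \<longrightarrow>
       z \<in> X \<longrightarrow> grad_y y x l u \<bullet> (y - z) + V y - V z \<le> e"
proof -
  obtain D where D: "0 \<le> D" "\<forall>y\<in>X. \<forall>y'\<in>X. norm (y - y') \<le> D"
    using bounded_data by blast
  \<comment> \<open>\<open>f\<close> and the weighted \<open>g i\<close> contribute at most \<open>(1 + K) * e1 * D\<close>, which is at most \<open>e / 2\<close>.\<close>
  define e1 where "e1 = e / (2 * (D + 1) * (1 + K))"
  have e1: "0 < e1" using assms D(1) by (simp add: e1_def)
  have expn: "\<exists>d>0. \<forall>z\<in>X \<times> U. \<forall>z'\<in>X \<times> U. dist z z' < d \<longrightarrow>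
     \<bar>h z' - h z - gradient h z \<bullet> (z' - z)\<bar> \<le> e1 * norm (z' - z)" if "C1_on (X \<times> U) h" for h
    using C1_on_uniform_expansion[OF that XU_compact XU_convex e1] by blast
  obtain df where df: "0 < df" "\<forall>z\<in>X \<times> U. \<forall>z'\<in>X \<times> U. dist z z' < df \<longrightarrow>
     \<bar>f z' - f z - gradient f z \<bullet> (z' - z)\<bar> \<le> e1 * norm (z' - z)"
    using expn[OF f_C1] by blast
  obtain dg where dg: "\<And>i. 0 < dg i" "\<And>i. \<forall>z\<in>X \<times> U. \<forall>z'\<in>X \<times> U. dist z z' < dg i \<longrightarrow>
     \<bar>g i z' - g i z - gradient (g i) z \<bullet> (z' - z)\<bar> \<le> e1 * norm (z' - z)"
    using expn[OF g_C1] by metis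
  define d where "d = Min (insert df (range dg))"
  have d: "0 < d" "d \<le> df" "d \<le> dg i" for i
  proof -
    show "0 < d" unfolding d_def using df(1) dg(1) by auto
    show "d \<le> df" "d \<le> dg i" unfolding d_def by (rule Min_le; simp)+
  qed
  define s where "s = min 1 (d / (2 * (D + 1)))"
  have s: "0 < s" "s \<le> 1" using d(1) D(1) by (auto simp: s_def)
  have sD: "s * D < d"
  proof -
    have "s * D \<le> d / (2 * (D + 1)) * D" using D(1) by (intro mult_right_mono) (auto simp: s_def)
    also have "\<dots> < d" using d(1) D(1) by (auto simp: field_simps intro!: add_nonneg_pos)
    finally show ?thesis .
  qed
  \<comment> \<open>The near-optimality error is divided by \<open>s\<close>; this leaves the other half of \<open>e\<close>.\<close>
  define \<delta>0 where "\<delta>0 = s * e / 2"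
  have \<delta>0: "0 < \<delta>0" using s assms by (simp add: \<delta>0_def)
  show ?thesis
  proof (intro exI[of _ \<delta>0] conjI allI impI)
    show "0 < \<delta>0" by (rule \<delta>0)
  next
    fix V x y l u \<delta> z
    assume V: "convex_on X V" and x: "x \<in> U" and y: "y \<in> X" and u': "\<forall>i. 0 \<le> u $ i"
      and uK: "(\<Sum>i\<in>UNIV. u $ i) \<le> K" and \<delta>: "\<delta> \<le> \<delta>0"
      and near: "\<forall>z\<in>X. lagr V x l u y \<le> lagr V x l u z + \<delta>" and z: "z \<in> X"
    from u' have u: "0 \<le> u $ i" for i by simp
    define w where "w = z - y"
    define zs where "zs = y + s *\<^sub>R w"
    have zs_eq: "zs = (1 - s) *\<^sub>R y + s *\<^sub>R z" by (simp add: zs_def w_def algebra_simps)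
    have zsX: "zs \<in> X" unfolding zs_eq using X_convex y z s by (simp add: convex_alt)
    have nw: "norm w \<le> D" using D(2)[rule_format, OF z y] by (simp add: w_def)
    have diff: "(zs, x) - (y, x) = (s *\<^sub>R w, 0)" by (simp add: zs_def)
    have nd: "norm ((zs, x) - (y, x)) = s * norm w" unfolding diff using s by (simp add: norm_Pair)
    have "s * norm w \<le> s * D" using nw s by simp
    then have dist: "dist (y, x) (zs, x) < d"
      using sD nd by (simp add: dist_norm norm_minus_commute)
    have V_le: "V zs \<le> (1 - s) * V y + s * V z"
      unfolding zs_eq using convex_onD[OF V, of s y z] s y z by simp
    have ip: "gradient h (y, x) \<bullet> ((zs, x) - (y, x)) = s * (fst (gradient h (y, x)) \<bullet> w)" for h
      unfolding diff by (simp add: inner_prod_def)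
    have F: "f (zs, x) \<le> f (y, x) + s * (fst (gradient f (y, x)) \<bullet> w) + e1 * (s * D)"
      and G: "g i (zs, x) \<le> g i (y, x) + s * (fst (gradient (g i) (y, x)) \<bullet> w) + e1 * (s * D)" for i
    proof -
      have "e1 * norm ((zs, x) - (y, x)) \<le> e1 * (s * D)"
        unfolding nd using e1 s nw by (simp add: mult_left_mono)
      then show "f (zs, x) \<le> f (y, x) + s * (fst (gradient f (y, x)) \<bullet> w) + e1 * (s * D)"
        and "g i (zs, x) \<le> g i (y, x) + s * (fst (gradient (g i) (y, x)) \<bullet> w) + e1 * (s * D)" for i
        using df(2)[rule_format, of "(y, x)" "(zs, x)"] dg(2)[rule_format, of "(y, x)" "(zs, x)" i] dist d(2) d(3)[of i] x y zsX
        unfolding ip by auto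
    qed
    have "(\<Sum>i\<in>UNIV. u $ i * g i (zs, x))
       \<le> (\<Sum>i\<in>UNIV. u $ i * (g i (y, x) + s * (fst (gradient (g i) (y, x)) \<bullet> w) + e1 * (s * D)))"
      by (intro sum_mono mult_left_mono G u)
    also have "\<dots> = (\<Sum>i\<in>UNIV. u $ i * g i (y, x)) + s * (\<Sum>i\<in>UNIV. u $ i * (fst (gradient (g i) (y, x)) \<bullet> w))
        + (\<Sum>i\<in>UNIV. u $ i) * (e1 * (s * D))"
      by (simp add: distrib_left sum.distrib sum_distrib_left sum_distrib_right mult_ac)
    also have "(\<Sum>i\<in>UNIV. u $ i) * (e1 * (s * D)) \<le> K * (e1 * (s * D))"
      using e1 s D(1) uK by (intro mult_right_mono) auto
    finally have G': "(\<Sum>i\<in>UNIV. u $ i * g i (zs, x)) \<le> (\<Sum>i\<in>UNIV. u $ i * g i (y, x))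
        + s * (\<Sum>i\<in>UNIV. u $ i * (fst (gradient (g i) (y, x)) \<bullet> w)) + K * (e1 * (s * D))" by simp
    have R: "l \<bullet> res zs x = l \<bullet> res y x + s * (l \<bullet> (A *v w))"
      unfolding res_def zs_def
      by (simp add: matrix_vector_right_distrib matrix_vector_mult_scaleR inner_add_right inner_diff_right)
    have "lagr V x l u y \<le> lagr V x l u zs + \<delta>" by (rule bspec[OF near zsX])
    then have "0 \<le> s * (fst (gradient f (y, x)) \<bullet> w) + s * (l \<bullet> (A *v w))
        + s * (\<Sum>i\<in>UNIV. u $ i * (fst (gradient (g i) (y, x)) \<bullet> w))
        + s * V z - s * V y + (1 + K) * (e1 * (s * D)) + \<delta>"
      using F G' R V_le unfolding lagr_def by (simp add: algebra_simps)
    also have "\<dots> = s * (grad_y y x l u \<bullet> w + V z - V y + (1 + K) * e1 * D) + \<delta>"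
      unfolding inner_grad_y[OF y x] by (simp add: algebra_simps)
    also have "\<dots> \<le> s * (grad_y y x l u \<bullet> w + V z - V y + (1 + K) * e1 * D + e / 2)"
      using \<delta> by (simp add: \<delta>0_def algebra_simps)
    finally have "0 \<le> grad_y y x l u \<bullet> w + V z - V y + (1 + K) * e1 * D + e / 2"
      using s(1) by (simp add: zero_le_mult_iff)
    moreover have "(1 + K) * e1 * D \<le> e / 2"
    proof -
      have "(1 + K) * e1 = e / (2 * (D + 1))"
        using assms(1) by (simp add: e1_def)
      moreover have "e / (2 * (D + 1)) * D \<le> e / 2"
        using assms(2) D(1) by (simp add: field_simps)
      ultimately show ?thesis by simp
    qed
    moreover have "grad_y y x l u \<bullet> (y - z) = - (grad_y y x l u \<bullet> w)"
      by (simp add: w_def inner_diff_right)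
    ultimately show "grad_y y x l u \<bullet> (y - z) + V y - V z \<le> e" by linarith
  qed
qed

end

section \<open>Consequences of the Slater condition\<close>

locale slater_stage = convex_stage X U f g A B b
  for X U :: "(real^'n::finite) set"
    and f :: "(real^'n) \<times> (real^'n) \<Rightarrow> real"
    and g :: "'p::finite \<Rightarrow> (real^'n) \<times> (real^'n) \<Rightarrow> real"
    and A B :: "real^'n^'q::finite" and b :: "real^'q" +
  fixes r \<kappa> :: real
  assumes r_pos: "0 < r" and \<kappa>_pos: "0 < \<kappa>"
    and slater: "\<And>x. x \<in> U \<Longrightarrow> \<exists>y\<in>X. cball y r \<inter> affine hull X \<subseteq> X \<and>
      A *v y + B *v x - b = 0 \<and> (\<forall>i. g i (y, x) \<le> - \<kappa>)"
begin

text \<open>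
  The directions of the affine hull of \<open>X\<close>, and the values of the equality constraint on that hull,
  which are the admissible multipliers of the dual problem.
\<close>

definition dirs :: "(real^'n) set" where
  "dirs = {u - w | u w. u \<in> affine hull X \<and> w \<in> affine hull X}"

definition res_range :: "real^'n \<Rightarrow> (real^'q) set" where
  "res_range x = {res y x | y. y \<in> affine hull X}"

lemma subspace_dirs:
  assumes "X \<noteq> {}"
  shows "subspace dirs"
proof -
  obtain a where a: "a \<in> affine hull X" using assms hull_inc by fast
  have "dirs = (\<lambda>u. u - a) ` (affine hull X)"
  proof
    show "dirs \<subseteq> (\<lambda>u. u - a) ` (affine hull X)"
    proof
      fix v assume "v \<in> dirs"
      then obtain u w where "v = u - w" "u \<in> affine hull X" "w \<in> affine hull X"
        by (auto simp: dirs_def)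
      then have "v = (a + 1 *\<^sub>R (u - w)) - a" "a + 1 *\<^sub>R (u - w) \<in> affine hull X"
        using a mem_affine_3_minus[OF affine_affine_hull, of a X u w 1] by auto
      then show "v \<in> (\<lambda>u. u - a) ` (affine hull X)" by (rule image_eqI)
    qed
    show "(\<lambda>u. u - a) ` (affine hull X) \<subseteq> dirs" using a by (auto simp: dirs_def)
  qed
  then show ?thesis
    using affine_diffs_subspace_subtract[OF affine_affine_hull a] by simp
qed

lemma add_dirs: "y \<in> affine hull X \<Longrightarrow> d \<in> dirs \<Longrightarrow> y + d \<in> affine hull X"
  using mem_affine_3_minus[OF affine_affine_hull, of y X _ _ 1] by (auto simp: dirs_def)

lemma diff_in_dirs: "y \<in> X \<Longrightarrow> y' \<in> X \<Longrightarrow> y - y' \<in> dirs"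
  using hull_subset[of X affine] by (auto simp: dirs_def)

lemma bounded_preimages:
  assumes "X \<noteq> {}"
  shows "\<exists>C>0. \<forall>v\<in>(*v) A ` dirs. \<exists>d\<in>dirs. A *v d = v \<and> norm d \<le> C * norm v"
  by (rule bounded_preimages_in_subspace[OF matrix_vector_mul_linear subspace_dirs[OF assms]])

lemma slater_shift:
  assumes "y \<in> X" "cball y r \<inter> affine hull X \<subseteq> X" "d \<in> dirs" "norm d \<le> r"
  shows "y + d \<in> X"
proof -
  have "y \<in> affine hull X" using assms(1) by (rule hull_inc)
  then have "y + d \<in> affine hull X" using assms(3) by (rule add_dirs)
  moreover have "y + d \<in> cball y r" using assms(4) by (simp add: dist_norm)
  ultimately show ?thesis using assms(2) by blast
qed

text \<open>
  A point \<open>y\<close> feasible for \<open>x\<close> is moved a fraction \<open>s\<close>, proportional to the distance of \<open>x\<close> and \<open>x'\<close>, towards a Slater point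
  for \<open>x'\<close>, and a correction of the same order restores the equality constraint. For \<open>s\<close> a large
  enough multiple of the distance, the slack of the Slater point absorbs the correction and the change
  of the inequality constraints.
\<close>

lemma feas_set_lipschitz:
  "\<exists>K\<ge>0. \<forall>x\<in>U. \<forall>x'\<in>U. \<forall>y\<in>feas_set x. \<exists>y'\<in>feas_set x'. norm (y - y') \<le> K * norm (x - x')"
proof (cases "X = {}")
  case True
  then have "feas_set x = {}" for x using feas_set_subset[of x] by blast
  then show ?thesis by (intro exI[of _ 0]) simp
next
  case False
  obtain C where C: "0 < C" "\<forall>v\<in>(*v) A ` dirs. \<exists>d\<in>dirs. A *v d = v \<and> norm d \<le> C * norm v"
    using bounded_preimages[OF False] by blast
  obtain L where L: "0 \<le> L"
      "\<forall>i. \<forall>z\<in>X \<times> U. \<forall>z'\<in>X \<times> U. \<bar>g i z - g i z'\<bar> \<le> L * dist z z'"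
    using lipschitz_data by blast
  obtain D where D: "0 \<le> D" "\<forall>y\<in>X. \<forall>y'\<in>X. norm (y - y') \<le> D"
    using bounded_data by blast
  obtain KB where KB: "0 < KB" "\<And>v. norm (B *v v) \<le> KB * norm v"
    using linear_bounded_pos[OF matrix_vector_mul_linear, of B] by blast
  define c where "c = C * KB"
  have c: "0 < c" using C KB by (simp add: c_def)
  \<comment> \<open>With \<open>s = M * norm (x - x')\<close>, the summands of \<open>M\<close> ensure in turn that \<open>1 \<le> M\<close>, that the
    correction \<open>e\<close> of the Slater point has norm at most \<open>r\<close>, that it uses at most half of the slack
    \<open>\<kappa>\<close>, and that the other half outweighs the change of the constraints at \<open>y\<close>.\<close>
  define M where "M = 1 + c / r + 2 * L * c / \<kappa> + 2 * L / \<kappa>"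
  have nn: "0 \<le> c / r" "0 \<le> 2 * L * c / \<kappa>" "0 \<le> 2 * L / \<kappa>"
    using c r_pos \<kappa>_pos L(1) by auto
  have M: "1 \<le> M" "c / r \<le> M" "2 * L * c / \<kappa> \<le> M" "2 * L / \<kappa> \<le> M"
    using nn unfolding M_def by linarith+
  have main: "\<exists>y'\<in>feas_set x'. norm (y - y') \<le> (M * D + c) * norm (x - x')"
    if x: "x \<in> U" "x' \<in> U" and y: "y \<in> feas_set x" for x x' y
  proof -
    define \<delta> where "\<delta> = norm (x - x')"
    obtain y0 where y0: "y0 \<in> X" "cball y0 r \<inter> affine hull X \<subseteq> X" "res y0 x' = 0"
        "\<And>i. g i (y0, x') \<le> - \<kappa>"
      using slater[OF x(2)] unfolding res_def by blast
    have yX: "y \<in> X" and yres: "res y x = 0" and yg: "g i (y, x) \<le> 0" for i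
      using y by (auto simp: feas_set_def)
    consider "\<delta> = 0" | "1 < M * \<delta>" | "0 < \<delta>" "M * \<delta> \<le> 1"
      unfolding \<delta>_def by (metis linorder_not_less norm_ge_zero order_le_less)
    then show ?thesis
    proof cases
      case 1
      then have "x' = x" by (simp add: \<delta>_def)
      then show ?thesis using y by (intro bexI[of _ y]) (auto simp: c_def)
    next
      case 2
      have "y0 \<in> feas_set x'"
        using y0 \<kappa>_pos by (auto simp: feas_set_def intro: order_trans[of _ "- \<kappa>"])
      moreover have "norm (y - y0) \<le> (M * D + c) * \<delta>"
      proof -
        have "norm (y - y0) \<le> D" using D(2) yX y0(1) by blast
        also have "\<dots> \<le> (M * \<delta>) * D" using mult_right_mono[of 1 "M * \<delta>" D] 2 D(1) by simp
        also have "\<dots> \<le> (M * D + c) * \<delta>" using c by (simp add: algebra_simps \<delta>_def)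
        finally show ?thesis .
      qed
      ultimately show ?thesis unfolding \<delta>_def by blast
    next
      case 3
      define s where "s = M * \<delta>"
      have s: "0 < s" "s \<le> 1" using 3 M(1) by (auto simp: s_def)
      have Av: "A *v (y0 - y) = B *v (x - x')"
        using yres y0(3) unfolding res_def by (simp add: matrix_vector_mult_diff_distrib algebra_simps)
      have "B *v (x - x') \<in> (*v) A ` dirs"
        using Av diff_in_dirs[OF y0(1) yX] by (metis image_eqI)
      then obtain d0 where d0: "d0 \<in> dirs" "A *v d0 = B *v (x - x')"
          "norm d0 \<le> C * norm (B *v (x - x'))"
        using C(2) by blast
      have nd0: "norm d0 \<le> c * \<delta>"
      proof -
        have "C * norm (B *v (x - x')) \<le> C * (KB * norm (x - x'))"
          using KB(2) C(1) by (simp add: mult_left_mono)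
        then show ?thesis using d0(3) by (simp add: c_def \<delta>_def)
      qed
      define d where "d = (1 - s) *\<^sub>R d0"
      have nd: "norm d \<le> c * \<delta>"
        unfolding d_def using nd0 s mult_right_mono[of "1 - s" 1 "norm d0"] by simp
      define e where "e = (1 / s) *\<^sub>R d"
      have ne: "norm e \<le> c / M"
        using nd s M(1) 3 unfolding e_def s_def by (simp add: field_simps)
      have "e \<in> dirs"
        unfolding e_def d_def using subspace_dirs[OF False] d0(1) by (simp add: subspace_scale)
      moreover have "norm e \<le> r"
      proof -
        have "c / M \<le> r" using M(1,2) r_pos by (simp add: field_simps)
        with ne show ?thesis by linarith
      qed
      ultimately have y1X: "y0 + e \<in> X" using slater_shift[OF y0(1,2)] by blast
      define y' where "y' = (1 - s) *\<^sub>R y + s *\<^sub>R (y0 + e)"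
      have se: "s *\<^sub>R e = d" using s by (simp add: e_def)
      have y'X: "y' \<in> X" unfolding y'_def using X_convex yX y1X s by (simp add: convex_alt)
      have "res y' x' = (1 - s) *\<^sub>R (A *v y) + s *\<^sub>R (A *v y0) + (1 - s) *\<^sub>R (B *v (x - x')) + B *v x' - b"
        unfolding res_def y'_def scaleR_add_right se
        by (simp add: matrix_vector_right_distrib matrix_vector_mult_scaleR d_def d0(2))
      also have "\<dots> = (1 - s) *\<^sub>R res y x + s *\<^sub>R res y0 x'"
        unfolding res_def by (simp add: matrix_vector_mult_diff_distrib algebra_simps)
      finally have res': "res y' x' = 0" using yres y0(3) by simp
      have g': "g i (y', x') \<le> 0" for i
      proof -
        have "(y', x') = (1 - s) *\<^sub>R (y, x') + s *\<^sub>R (y0 + e, x')"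
          by (simp add: y'_def algebra_simps)
        then have "g i (y', x') \<le> (1 - s) * g i (y, x') + s * g i (y0 + e, x')"
          using convex_onD[OF g_convex[of i], of s "(y, x')" "(y0 + e, x')"] s x yX y1X by simp
        moreover have "g i (y, x') \<le> L * \<delta>"
        proof -
          have "\<bar>g i (y, x') - g i (y, x)\<bar> \<le> L * dist (y, x') (y, x)"
            using L(2) x yX by blast
          also have "dist (y, x') (y, x) = \<delta>" by (simp add: \<delta>_def dist_Pair_Pair dist_norm norm_minus_commute)
          finally show ?thesis using yg[of i] by linarith
        qed
        moreover have "g i (y0 + e, x') \<le> - \<kappa> / 2"
        proof -
          have "\<bar>g i (y0 + e, x') - g i (y0, x')\<bar> \<le> L * dist (y0 + e, x') (y0, x')"
            using L(2) x y1X y0(1) by blast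
          also have "dist (y0 + e, x') (y0, x') = norm e" by (simp add: dist_Pair_Pair dist_norm)
          also have "L * norm e \<le> L * (c / M)" by (rule mult_left_mono[OF ne L(1)])
          also have "\<dots> \<le> \<kappa> / 2" using M(1,3) \<kappa>_pos by (simp add: field_simps)
          finally show ?thesis using y0(4)[of i] by linarith
        qed
        ultimately have "g i (y', x') \<le> (1 - s) * (L * \<delta>) + s * (- \<kappa> / 2)"
          using s by (smt (verit) mult_left_mono)
        also have "(1 - s) * (L * \<delta>) \<le> L * \<delta>"
          using mult_right_mono[of "1 - s" 1 "L * \<delta>"] s L(1) 3 by simp
        also have "L * \<delta> \<le> s * (\<kappa> / 2)"
        proof -
          have "2 * L \<le> M * \<kappa>" using M(4) \<kappa>_pos by (simp add: field_simps)
          then have "2 * L * \<delta> \<le> M * \<kappa> * \<delta>" using 3 by (simp add: mult_right_mono)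
          then show ?thesis by (simp add: s_def algebra_simps)
        qed
        finally show ?thesis by simp
      qed
      have "norm (y - y') \<le> (M * D + c) * \<delta>"
      proof -
        have "y - y' = s *\<^sub>R (y - y0) - d"
          unfolding y'_def scaleR_add_right se by (simp add: algebra_simps)
        then have "norm (y - y') \<le> s * norm (y - y0) + norm d"
          using norm_triangle_ineq4[of "s *\<^sub>R (y - y0)" d] s by simp
        moreover have "s * norm (y - y0) \<le> s * D"
          using D(2) yX y0(1) s by (simp add: mult_left_mono)
        ultimately show ?thesis using nd by (simp add: s_def algebra_simps)
      qed
      moreover have "y' \<in> feas_set x'" using y'X res' g' by (simp add: feas_set_def)
      ultimately show ?thesis unfolding \<delta>_def by blast
    qed
  qed
  have "0 \<le> M * D + c" using M(1) D(1) c by simp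
  then show ?thesis using main by blast
qed

text \<open>
  A minimizer for \<open>x\<close> has a nearby point that is feasible for \<open>x'\<close>, and the objective is Lipschitz.
\<close>

lemma val_lipschitz:
  assumes V: "LV-lipschitz_on X V"
  shows "\<exists>K. K-lipschitz_on U (val V)"
proof -
  obtain K where K: "0 \<le> K" "\<forall>x\<in>U. \<forall>x'\<in>U. \<forall>y\<in>feas_set x. \<exists>y'\<in>feas_set x'. norm (y - y') \<le> K * norm (x - x')"
    using feas_set_lipschitz by blast
  obtain L where L: "0 \<le> L" "\<forall>z\<in>X \<times> U. \<forall>z'\<in>X \<times> U. \<bar>f z - f z'\<bar> \<le> L * dist z z'"
    using lipschitz_data by blast
  have cV: "continuous_on X V" using lipschitz_on_continuous_on[OF V] .
  have LV: "0 \<le> LV" using lipschitz_on_nonneg[OF V] .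
  let ?K = "L * (K + 1) + LV * K"
  have one: "val V x' \<le> val V x + ?K * norm (x - x')" if x: "x \<in> U" "x' \<in> U" for x x'
  proof -
    obtain y where y: "y \<in> feas_set x" "val V x = f (y, x) + V y"
      using val_attained[OF cV x(1)] by blast
    obtain y' where y': "y' \<in> feas_set x'" "norm (y - y') \<le> K * norm (x - x')"
      using K(2) x y(1) by blast
    have X: "y \<in> X" "y' \<in> X" using y y' feas_set_subset by blast+
    have "val V x' \<le> f (y', x') + V y'" by (rule val_le[OF cV x(2) y'(1)])
    also have "f (y', x') \<le> f (y, x) + L * dist (y', x') (y, x)"
      using L(2)[rule_format, of "(y', x')" "(y, x)"] X x by auto
    also have "L * dist (y', x') (y, x) \<le> L * ((K + 1) * norm (x - x'))"
    proof (rule mult_left_mono[OF _ L(1)])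
      have "norm ((y', x') - (y, x)) \<le> norm (y' - y) + norm (x' - x)"
        by (simp add: norm_Pair_le)
      then show "dist (y', x') (y, x) \<le> (K + 1) * norm (x - x')"
        using y'(2) by (simp add: dist_norm norm_minus_commute algebra_simps)
    qed
    also have "V y' \<le> V y + LV * norm (y - y')"
      using lipschitz_onD[OF V X(2,1)] by (simp add: dist_real_def dist_norm norm_minus_commute)
    also have "LV * norm (y - y') \<le> LV * (K * norm (x - x'))" using y'(2) LV by (rule mult_left_mono)
    finally show ?thesis using y(2) by (simp add: algebra_simps)
  qed
  have "?K-lipschitz_on U (val V)"
  proof (rule lipschitz_onI)
    show "0 \<le> ?K" using L K LV by simp
    fix x x' assume "x \<in> U" "x' \<in> U"
    then show "dist (val V x) (val V x') \<le> ?K * dist x x'"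
      using one[of x x'] one[of x' x] by (simp add: dist_norm norm_minus_commute abs_le_iff)
  qed
  then show ?thesis by blast
qed

text \<open>
  Because the equality constraint is solvable, its range on the affine hull contains 0 and is
  therefore a linear subspace, the image of the directions.
\<close>

lemma res_range_subspace:
  assumes "x \<in> U"
  shows "subspace (res_range x)" and "res_range x = (*v) A ` dirs"
proof -
  obtain y0 where y0: "y0 \<in> X" "res y0 x = 0" using slater[OF assms] unfolding res_def by blast
  have y0a: "y0 \<in> affine hull X" using y0(1) by (rule hull_inc)
  have eq: "res y x = A *v (y - y0)" for y
  proof -
    have "res y x = res y x - res y0 x" using y0(2) by simp
    then show ?thesis unfolding res_def by (simp add: matrix_vector_mult_diff_distrib)
  qed
  show *: "res_range x = (*v) A ` dirs"
  proof
    show "res_range x \<subseteq> (*v) A ` dirs"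
      using y0a eq unfolding res_range_def dirs_def by blast
    show "(*v) A ` dirs \<subseteq> res_range x"
    proof
      fix v assume "v \<in> (*v) A ` dirs"
      then obtain d where d: "d \<in> dirs" "v = A *v d" by blast
      then have "res (y0 + d) x = v" by (simp add: eq)
      then show "v \<in> res_range x" using add_dirs[OF y0a d(1)] by (auto simp: res_range_def)
    qed
  qed
  have "X \<noteq> {}" using y0(1) by blast
  then show "subspace (res_range x)"
    unfolding * by (intro linear_subspace_image matrix_vector_mul_linear subspace_dirs)
qed

text \<open>
  The separating functional is sought in the span of the separated set, whose first component stays in
  the range of the equality constraint; this puts the multiplier \<open>l\<close> into that range. The Slater point excludes a vertical hyperplane.
\<close>

lemma strong_duality:
  assumes V: "convex_on X V" "continuous_on X V" and x: "x \<in> U"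
  shows "\<exists>l\<in>res_range x. \<exists>u. (\<forall>i. 0 \<le> u $ i) \<and> (\<forall>z\<in>X. val V x \<le> lagr V x l u z)"
proof -
  define p where "p = val V x"
  define \<phi> where "\<phi> y = f (y, x) + V y" for y
  define S where "S = {(e :: real^'q, w :: real^'p, t :: real). \<exists>y\<in>X. e = res y x \<and>
      (\<forall>i. g i (y, x) \<le> w $ i) \<and> \<phi> y - p < t}"
  have SI: "(res y x, w, t) \<in> S" if "y \<in> X" "\<And>i. g i (y, x) \<le> w $ i" "\<phi> y - p < t" for y w t
    unfolding S_def using that by blast
  have slice: "convex_on X (\<lambda>y. h (y, x))" if "convex_on (X \<times> U) h" for h
  proof (rule convex_onI[OF _ X_convex])
    fix s y y' assume *: "(0::real) < s" "s < 1" "y \<in> X" "y' \<in> X"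
    have "(1 - s) *\<^sub>R (y, x) + s *\<^sub>R (y', x) = ((1 - s) *\<^sub>R y + s *\<^sub>R y', x)"
      by (simp add: algebra_simps)
    then show "h ((1 - s) *\<^sub>R y + s *\<^sub>R y', x) \<le> (1 - s) * h (y, x) + s * h (y', x)"
      using convex_onD[OF that, of s "(y, x)" "(y', x)"] * x by simp
  qed
  have \<phi>: "convex_on X \<phi>"
    unfolding \<phi>_def by (intro convex_on_add slice f_convex V)
  obtain y0 where y0: "y0 \<in> X" "cball y0 r \<inter> affine hull X \<subseteq> X" "res y0 x = 0"
      "\<And>i. g i (y0, x) \<le> - \<kappa>"
    using slater[OF x] unfolding res_def by blast
  have "convex S"
    unfolding convex_alt
  proof (intro ballI allI impI)
    fix a c :: "(real^'q) \<times> (real^'p) \<times> real" and s :: real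
    assume "a \<in> S" "c \<in> S" and s: "0 \<le> s \<and> s \<le> 1"
    obtain e1 w1 t1 e2 w2 t2 where ac: "a = (e1, w1, t1)" "c = (e2, w2, t2)" by (metis prod.exhaust)
    obtain y1 y2 where y1: "y1 \<in> X" "e1 = res y1 x" "\<And>i. g i (y1, x) \<le> w1 $ i" "\<phi> y1 - p < t1"
      and y2: "y2 \<in> X" "e2 = res y2 x" "\<And>i. g i (y2, x) \<le> w2 $ i" "\<phi> y2 - p < t2"
      using \<open>a \<in> S\<close> \<open>c \<in> S\<close> unfolding ac S_def by auto
    define y where "y = (1 - s) *\<^sub>R y1 + s *\<^sub>R y2"
    have "y \<in> X" unfolding y_def using X_convex y1 y2 s by (simp add: convex_alt)
    moreover have "(1 - s) *\<^sub>R e1 + s *\<^sub>R e2 = res y x"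
      unfolding y1 y2 y_def res_def
      by (simp add: matrix_vector_right_distrib matrix_vector_mult_scaleR algebra_simps)
    moreover have "g i (y, x) \<le> ((1 - s) *\<^sub>R w1 + s *\<^sub>R w2) $ i" for i
    proof -
      have "g i (y, x) \<le> (1 - s) * g i (y1, x) + s * g i (y2, x)"
        unfolding y_def using convex_onD[OF slice[OF g_convex[of i]]] s y1(1) y2(1) by blast
      also have "\<dots> \<le> (1 - s) * w1 $ i + s * w2 $ i"
        using s y1(3) y2(3) by (intro add_mono mult_left_mono) auto
      finally show ?thesis by simp
    qed
    moreover have "\<phi> y - p < (1 - s) * t1 + s * t2"
    proof -
      have "\<phi> y \<le> (1 - s) * \<phi> y1 + s * \<phi> y2"
        unfolding y_def using convex_onD[OF \<phi>] s y1(1) y2(1) by blast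
      then have "\<phi> y - p \<le> (1 - s) * (\<phi> y1 - p) + s * (\<phi> y2 - p)" by (simp add: algebra_simps)
      also have "\<dots> < (1 - s) * t1 + s * t2"
      proof (cases "s = 1")
        case False
        then show ?thesis using s y1(4) y2(4)
          by (intro add_less_le_mono mult_strict_left_mono mult_left_mono) auto
      qed (use y2(4) in simp)
      finally show ?thesis .
    qed
    ultimately show "(1 - s) *\<^sub>R a + s *\<^sub>R c \<in> S"
      unfolding ac using SI[of y "(1 - s) *\<^sub>R w1 + s *\<^sub>R w2" "(1 - s) * t1 + s * t2"] by simp
  qed
  moreover have "S \<noteq> {}"
    using SI[of y0 "\<chi> i. g i (y0, x)" "\<phi> y0 - p + 1"] y0(1) by auto
  moreover have "0 \<notin> S"
  proof
    assume "0 \<in> S"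
    then obtain y where "y \<in> X" "res y x = 0" "\<forall>i. g i (y, x) \<le> 0" "\<phi> y < p"
      by (auto simp: S_def zero_prod_def)
    then show False using val_le[OF V(2) x, of y] by (auto simp: feas_set_def p_def \<phi>_def)
  qed
  ultimately obtain a where a: "a \<in> span S" "a \<noteq> 0" "\<And>s. s \<in> S \<Longrightarrow> 0 \<le> a \<bullet> s"
    using separating_hyperplane_set_0_inspan by blast
  obtain l u \<nu> where a_eq: "a = (l, u, \<nu>)" by (metis prod.exhaust)
  have "span S \<subseteq> res_range x \<times> UNIV \<times> UNIV"
  proof (rule span_minimal)
    show "S \<subseteq> res_range x \<times> UNIV \<times> UNIV"
      using hull_subset[of X affine] unfolding S_def res_range_def by auto
    show "subspace (res_range x \<times> (UNIV :: (real^'p) set) \<times> (UNIV :: real set))"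
      by (intro subspace_Times res_range_subspace x subspace_UNIV)
  qed
  then have l: "l \<in> res_range x" using a(1) a_eq by auto
  have sep: "0 \<le> l \<bullet> res y x + (\<Sum>i\<in>UNIV. u $ i * w $ i) + \<nu> * t"
    if "y \<in> X" "\<And>i. g i (y, x) \<le> w $ i" "\<phi> y - p < t" for y w t
    using a(3)[OF SI[OF that]] unfolding a_eq by (simp add: inner_vec_def)
  \<comment> \<open>The second and third components of the separated set are unbounded above, so the
    coefficients of the functional there are nonnegative.\<close>
  have slope: "0 \<le> c" if "\<And>n::real. 0 \<le> n \<Longrightarrow> 0 \<le> d + n * c" for c d :: real
  proof (rule ccontr)
    assume "\<not> 0 \<le> c"
    then have "c < 0" by simp
    have "0 \<le> d + ((\<bar>d\<bar> + 1) / (- c)) * c" by (intro that divide_nonneg_pos) (use \<open>c < 0\<close> in auto)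
    also have "((\<bar>d\<bar> + 1) / (- c)) * c = - (\<bar>d\<bar> + 1)" using \<open>c < 0\<close> by simp
    finally show False by simp
  qed
  have u: "0 \<le> u $ j" for j
  proof (rule slope)
    fix n :: real assume "0 \<le> n"
    let ?w = "(\<chi> i. g i (y0, x) + (if i = j then n else 0)) :: real^'p"
    have "(\<Sum>i\<in>UNIV. u $ i * ?w $ i)
        = (\<Sum>i\<in>UNIV. u $ i * g i (y0, x)) + (\<Sum>i\<in>UNIV. if i = j then u $ i * n else 0)"
      by (subst sum.distrib[symmetric], rule sum.cong) (auto simp: algebra_simps)
    also have "(\<Sum>i\<in>UNIV. if i = j then u $ i * n else 0) = u $ j * n" by simp
    finally have w: "(\<Sum>i\<in>UNIV. u $ i * ?w $ i) = (\<Sum>i\<in>UNIV. u $ i * g i (y0, x)) + u $ j * n" .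
    have "0 \<le> l \<bullet> res y0 x + (\<Sum>i\<in>UNIV. u $ i * ?w $ i) + \<nu> * (\<phi> y0 - p + 1)"
      by (rule sep) (use y0(1) \<open>0 \<le> n\<close> in auto)
    then show "0 \<le> (l \<bullet> res y0 x + (\<Sum>i\<in>UNIV. u $ i * g i (y0, x)) + \<nu> * (\<phi> y0 - p + 1)) + n * (u $ j)"
      unfolding w by (simp add: algebra_simps)
  qed
  have \<nu>: "0 \<le> \<nu>"
  proof (rule slope)
    fix n :: real assume "0 \<le> n"
    have "0 \<le> l \<bullet> res y0 x + (\<Sum>i\<in>UNIV. u $ i * (\<chi> i. g i (y0, x)) $ i) + \<nu> * (\<phi> y0 - p + 1 + n)"
      by (rule sep) (use y0(1) \<open>0 \<le> n\<close> in auto)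
    then show "0 \<le> (l \<bullet> res y0 x + (\<Sum>i\<in>UNIV. u $ i * g i (y0, x)) + \<nu> * (\<phi> y0 - p + 1)) + n * \<nu>"
      by (simp add: algebra_simps)
  qed
  have sep0: "0 \<le> l \<bullet> res y x + (\<Sum>i\<in>UNIV. u $ i * g i (y, x)) + \<nu> * (\<phi> y - p)" if "y \<in> X" for y
  proof (rule field_le_epsilon)
    fix e :: real assume "0 < e"
    define h where "h = e / (\<nu> + 1)"
    have h: "0 < h" "\<nu> * h \<le> e" using \<open>0 < e\<close> \<nu> by (auto simp: h_def field_simps)
    have "0 \<le> l \<bullet> res y x + (\<Sum>i\<in>UNIV. u $ i * (\<chi> i. g i (y, x)) $ i) + \<nu> * (\<phi> y - p + h)"
      by (rule sep) (use that h in auto)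
    then show "0 \<le> l \<bullet> res y x + (\<Sum>i\<in>UNIV. u $ i * g i (y, x)) + \<nu> * (\<phi> y - p) + e"
      using h(2) by (simp add: algebra_simps)
  qed
  have "\<nu> \<noteq> 0"
  proof
    assume "\<nu> = 0"
    have "0 \<le> (\<Sum>i\<in>UNIV. u $ i * g i (y0, x))" using sep0[OF y0(1)] y0(3) \<open>\<nu> = 0\<close> by simp
    also have "\<dots> \<le> (\<Sum>i\<in>UNIV. u $ i * (- \<kappa>))" by (intro sum_mono mult_left_mono y0(4) u)
    also have "\<dots> = - (\<kappa> * (\<Sum>i\<in>UNIV. u $ i))" by (simp add: sum_distrib_left sum_negf mult.commute)
    finally have "(\<Sum>i\<in>UNIV. u $ i) \<le> 0" using \<kappa>_pos by (simp add: mult_le_0_iff)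
    then have "u $ i = 0" for i
      using u sum_nonneg_eq_0_iff[of UNIV "\<lambda>i. u $ i"] sum_nonneg[of UNIV "\<lambda>i. u $ i"] by force
    then have u0: "u = 0" by (simp add: vec_eq_iff)
    have "l \<in> (*v) A ` dirs" using l res_range_subspace(2)[OF x] by simp
    then obtain d where d: "d \<in> dirs" "l = A *v d" by blast
    define s where "s = r / (norm d + 1)"
    have s: "0 < s" "s * norm d \<le> r"
    proof -
      have n: "0 < norm d + 1" by (simp add: add_nonneg_pos)
      then show "0 < s" using r_pos by (simp add: s_def)
      have "r * norm d \<le> r * (norm d + 1)" using r_pos by simp
      then show "s * norm d \<le> r" using n by (simp add: s_def pos_divide_le_eq)
    qed
    have "X \<noteq> {}" using y0(1) by blast
    have "(- s) *\<^sub>R d \<in> dirs" using subspace_dirs[OF \<open>X \<noteq> {}\<close>] d(1) by (rule subspace_scale)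
    then have "y0 + (- s) *\<^sub>R d \<in> X" by (intro slater_shift[OF y0(1,2)]) (use s in simp_all)
    from sep0[OF this] have "0 \<le> l \<bullet> res (y0 + (- s) *\<^sub>R d) x" using u0 \<open>\<nu> = 0\<close> by simp
    also have "res (y0 + (- s) *\<^sub>R d) x = res y0 x - s *\<^sub>R l"
      unfolding res_def d(2)
      by (simp add: matrix_vector_mult_diff_distrib matrix_vector_mult_scaleR)
    finally have "s * (l \<bullet> l) \<le> 0" using y0(3) by simp
    then have "l \<bullet> l \<le> 0" using s(1) by (simp add: mult_le_0_iff)
    then have "l \<bullet> l = 0" using inner_ge_zero[of l] by linarith
    then have "l = 0" by simp
    then show False using a(2) a_eq u0 \<open>\<nu> = 0\<close> by (simp add: zero_prod_def)
  qed
  then have \<nu>0: "0 < \<nu>" using \<nu> by simp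
  show ?thesis
  proof (intro bexI exI conjI allI ballI)
    show "(1 / \<nu>) *\<^sub>R l \<in> res_range x"
      by (intro subspace_scale res_range_subspace x l)
    show "0 \<le> ((1 / \<nu>) *\<^sub>R u) $ i" for i using u \<nu>0 by simp
    show "val V x \<le> lagr V x ((1 / \<nu>) *\<^sub>R l) ((1 / \<nu>) *\<^sub>R u) z" if "z \<in> X" for z
    proof -
      have "0 \<le> (1 / \<nu>) * (l \<bullet> res z x + (\<Sum>i\<in>UNIV. u $ i * g i (z, x)) + \<nu> * (\<phi> z - p))"
        using sep0[OF that] \<nu>0 by simp
      also have "\<dots> = lagr V x ((1 / \<nu>) *\<^sub>R l) ((1 / \<nu>) *\<^sub>R u) z - val V x"
        using \<nu>0 unfolding lagr_def \<phi>_def p_def by (simp add: algebra_simps sum_distrib_left)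
      finally show ?thesis by simp
    qed
  qed
qed

text \<open>
  Evaluating the Lagrangian at a Slater point bounds
  the multipliers of the inequalities; evaluating it at a Slater point displaced against \<open>l\<close>,
  which is possible because \<open>l\<close> lies in the range of the equality constraint, bounds \<open>l\<close>.
\<close>

lemma multipliers_bounded:
  assumes "0 \<le> M"
  shows "\<exists>G\<ge>0. \<forall>V x l u. (\<forall>y\<in>X. \<bar>V y\<bar> \<le> M) \<longrightarrow> x \<in> U \<longrightarrow> l \<in> res_range x \<longrightarrow> (\<forall>i. 0 \<le> u $ i) \<longrightarrow>
     (\<forall>z\<in>X. - M \<le> lagr V x l u z) \<longrightarrow> norm l \<le> G \<and> (\<Sum>i\<in>UNIV. u $ i) \<le> G"
proof (cases "X = {}")
  case True
  then have "U = {}" using slater by blast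
  then show ?thesis by (intro exI[of _ 0]) simp
next
  case False
  obtain C where C: "0 < C" "\<forall>v\<in>(*v) A ` dirs. \<exists>d\<in>dirs. A *v d = v \<and> norm d \<le> C * norm v"
    using bounded_preimages[OF False] by blast
  obtain D where D: "0 \<le> D" "\<forall>z\<in>X \<times> U. \<bar>f z\<bar> \<le> D" "\<forall>i. \<forall>z\<in>X \<times> U. \<bar>g i z\<bar> \<le> D"
    using bounded_data by blast
  \<comment> \<open>At both test points the Lagrangian without multipliers is at most \<open>M + D\<close>. At the second one,
    a displacement of norm at most \<open>r\<close> changes \<open>l \<bullet> res\<close> by \<open>- (r / C) * norm l\<close>.\<close>
  define Gu where "Gu = (2 * M + D) / \<kappa>"
  define Gl where "Gl = (2 * M + D + Gu * D) / (r / C)"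
  have Gu: "0 \<le> Gu" using assms D(1) \<kappa>_pos by (simp add: Gu_def)
  have Gl: "0 \<le> Gl" using assms D(1) Gu r_pos C(1) by (simp add: Gl_def)
  have "norm l \<le> Gl + Gu \<and> (\<Sum>i\<in>UNIV. u $ i) \<le> Gl + Gu"
    if V: "\<forall>y\<in>X. \<bar>V y\<bar> \<le> M" and x: "x \<in> U" and l: "l \<in> res_range x" and u: "\<forall>i. 0 \<le> u $ i"
      and low: "\<forall>z\<in>X. - M \<le> lagr V x l u z" for V x l u
  proof -
    obtain y0 where y0: "y0 \<in> X" "cball y0 r \<inter> affine hull X \<subseteq> X" "res y0 x = 0"
        "\<And>i. g i (y0, x) \<le> - \<kappa>"
      using slater[OF x] unfolding res_def by blast
    have Vle: "V y \<le> M" "f (y, x) \<le> D" "g i (y, x) \<le> D" if "y \<in> X" for y i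
    proof -
      have "\<bar>V y\<bar> \<le> M" "\<bar>f (y, x)\<bar> \<le> D" "\<bar>g i (y, x)\<bar> \<le> D" using V D that x by auto
      then show "V y \<le> M" "f (y, x) \<le> D" "g i (y, x) \<le> D" by auto
    qed
    have "(\<Sum>i\<in>UNIV. u $ i * g i (y0, x)) \<le> (\<Sum>i\<in>UNIV. u $ i * (- \<kappa>))"
      using u y0(4) by (intro sum_mono mult_left_mono) auto
    also have "\<dots> = - (\<kappa> * (\<Sum>i\<in>UNIV. u $ i))" by (simp add: sum_distrib_left sum_negf mult.commute)
    finally have "\<kappa> * (\<Sum>i\<in>UNIV. u $ i) \<le> 2 * M + D"
      using bspec[OF low y0(1)] Vle[OF y0(1)] y0(3) unfolding lagr_def by simp
    then have su: "(\<Sum>i\<in>UNIV. u $ i) \<le> Gu" using \<kappa>_pos by (simp add: Gu_def field_simps)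
    have "norm l \<le> Gl"
    proof (cases "l = 0")
      case True
      then show ?thesis using Gl by simp
    next
      case l0: False
      have "l \<in> (*v) A ` dirs" using l res_range_subspace(2)[OF x] by simp
      then obtain d where d: "d \<in> dirs" "A *v d = l" "norm d \<le> C * norm l" using C(2) by blast
      define s where "s = r / C / norm l"
      have s: "0 < s" "s * norm d \<le> r"
      proof -
        show "0 < s" using l0 r_pos C(1) by (simp add: s_def)
        then have "s * norm d \<le> s * (C * norm l)" using d(3) by (intro mult_left_mono) auto
        also have "\<dots> = r" using l0 C(1) by (simp add: s_def)
        finally show "s * norm d \<le> r" .
      qed
      define y where "y = y0 + (- s) *\<^sub>R d"
      have "(- s) *\<^sub>R d \<in> dirs" using subspace_dirs[OF False] d(1) by (rule subspace_scale)
      then have yX: "y \<in> X" unfolding y_def by (intro slater_shift[OF y0(1,2)]) (use s in simp_all)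
      have "res y x = res y0 x - s *\<^sub>R l"
        unfolding res_def y_def d(2)[symmetric]
        by (simp add: matrix_vector_mult_diff_distrib matrix_vector_mult_scaleR)
      then have "l \<bullet> res y x = - (s * (norm l)\<^sup>2)" using y0(3) by (simp add: power2_norm_eq_inner)
      also have "s * (norm l)\<^sup>2 = r / C * norm l" using l0 by (simp add: s_def power2_eq_square)
      finally have lr: "l \<bullet> res y x = - (r / C * norm l)" .
      have "(\<Sum>i\<in>UNIV. u $ i * g i (y, x)) \<le> (\<Sum>i\<in>UNIV. u $ i * D)"
        using u Vle(3)[OF yX] by (intro sum_mono mult_left_mono) auto
      also have "\<dots> \<le> Gu * D" using su D(1) by (simp add: mult_right_mono flip: sum_distrib_right)
      finally have "r / C * norm l \<le> 2 * M + D + Gu * D"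
        using bspec[OF low yX] Vle(1,2)[OF yX] lr unfolding lagr_def by simp
      moreover have "0 < r / C" using r_pos C(1) by simp
      ultimately show ?thesis unfolding Gl_def by (subst pos_le_divide_eq) (simp_all add: mult.commute)
    qed
    then show ?thesis using su Gu Gl by simp
  qed
  then show ?thesis using Gu Gl by (intro exI[of _ "Gl + Gu"]) simp
qed

lemma grad_x_bounded:
  assumes "0 \<le> G"
  shows "\<exists>K\<ge>0. \<forall>y x l u. y \<in> X \<longrightarrow> x \<in> U \<longrightarrow> (\<forall>i. 0 \<le> u $ i) \<longrightarrow> norm l \<le> G \<longrightarrow>
     (\<Sum>i\<in>UNIV. u $ i) \<le> G \<longrightarrow> norm (grad_x y x l u) \<le> K"
proof -
  obtain H where H: "0 \<le> H" "\<forall>z\<in>X \<times> U. norm (gradient f z) \<le> H"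
      "\<forall>i. \<forall>z\<in>X \<times> U. norm (gradient (g i) z) \<le> H"
    using gradient_bound by blast
  obtain KB where KB: "0 < KB" "\<And>v. norm (transpose B *v v) \<le> KB * norm v"
    using linear_bounded_pos[OF matrix_vector_mul_linear, of "transpose B"] by blast
  have "norm (grad_x y x l u) \<le> H + KB * G + G * H"
    if y: "y \<in> X" and x: "x \<in> U" and u: "\<forall>i. 0 \<le> u $ i" and l: "norm l \<le> G"
      and su: "(\<Sum>i\<in>UNIV. u $ i) \<le> G" for y x l u
  proof -
    have snd_le: "norm (snd w) \<le> c" if "norm w \<le> c" for w :: "(real^'n) \<times> (real^'n)" and c
      using that norm_snd_le[of "snd w" "fst w"] by simp
    have 1: "norm (gradient (\<lambda>x'. f (y, x')) x) \<le> H"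
      unfolding gradient_slices(2)[OF f_C1 y x] using H(2) y x by (intro snd_le) auto
    have 2: "norm (transpose B *v l) \<le> KB * G"
      using KB(2)[of l] mult_left_mono[OF l, of KB] KB(1) by linarith
    have "norm (\<Sum>i\<in>UNIV. u $ i *\<^sub>R gradient (\<lambda>x'. g i (y, x')) x) \<le> (\<Sum>i\<in>UNIV. u $ i * H)"
    proof (rule sum_norm_le)
      fix i
      have "norm (gradient (\<lambda>x'. g i (y, x')) x) \<le> H"
        unfolding gradient_slices(2)[OF g_C1 y x] using H(3) y x by (intro snd_le) auto
      then show "norm (u $ i *\<^sub>R gradient (\<lambda>x'. g i (y, x')) x) \<le> u $ i * H"
        using u by (simp add: mult_left_mono)
    qed
    also have "\<dots> \<le> G * H" using su H(1) by (simp add: mult_right_mono flip: sum_distrib_right)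
    finally have 3: "norm (\<Sum>i\<in>UNIV. u $ i *\<^sub>R gradient (\<lambda>x'. g i (y, x')) x) \<le> G * H" .
    show ?thesis
      unfolding grad_x_def using 1 2 3
      by (intro order_trans[OF norm_triangle_ineq] add_mono)
  qed
  moreover have "0 \<le> H + KB * G + G * H" using H(1) KB(1) assms by simp
  ultimately show ?thesis by (intro exI[of _ "H + KB * G + G * H"]) blast
qed

end

section \<open>The stages of a regular program\<close>

locale regular_msp =
  fixes P :: "('n::finite, 'q::finite, 'p::finite, 'k::finite, 's) msp"
  assumes horizon_pos: "1 \<le> horizon P"
    and H0: "StoH0 P" and H1: "StoH1 P" and H2: "StoH2 P"
begin

abbreviation T :: nat where "T \<equiv> horizon P"
abbreviation D :: "nat \<Rightarrow> (real^'n) set" where "D \<equiv> dset P"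

definition cost_fn :: "nat \<Rightarrow> real^'k \<Rightarrow> (real^'n) \<times> (real^'n) \<Rightarrow> real" where
  "cost_fn t \<theta> = (\<lambda>(y, x). cost P t y x \<theta>)"

text \<open>
  A stage of type S1 is treated as one of type S2 whose constraints are trivial: the equality
  reads \<open>0 = 0\<close> and the inequality constraints are the constant \<open>-1\<close>, which leaves slack for the
  Slater condition.
\<close>

definition ineq_fn :: "nat \<Rightarrow> real^'k \<Rightarrow> 'p \<Rightarrow> (real^'n) \<times> (real^'n) \<Rightarrow> real" where
  "ineq_fn t \<theta> i = (if ctype P t = S2 then (\<lambda>(y, x). ineq P t y x \<theta> $ i) else (\<lambda>_. -1))"

definition A_mat :: "nat \<Rightarrow> real^'k \<Rightarrow> real^'n^'q" where
  "A_mat t \<theta> = (if ctype P t = S2 then matA P t \<theta> else 0)"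

definition B_mat :: "nat \<Rightarrow> real^'k \<Rightarrow> real^'n^'q" where
  "B_mat t \<theta> = (if ctype P t = S2 then matB P t \<theta> else 0)"

definition b_vec :: "nat \<Rightarrow> real^'k \<Rightarrow> real^'q" where
  "b_vec t \<theta> = (if ctype P t = S2 then vecb P t \<theta> else 0)"

text \<open>
  On the decision sets the cost-to-go functions and, from iteration 1 on, the approximations are
  finite. This is the stage value function for such a real-valued function.
\<close>

definition sval :: "nat \<Rightarrow> real^'k \<Rightarrow> (real^'n \<Rightarrow> real) \<Rightarrow> real^'n \<Rightarrow> real" where
  "sval t \<theta> V x = (INF y\<in>feas P t x \<theta>. cost P t y x \<theta> + V y)"

lemma stage_data:
  assumes "t \<in> {1..T}"
  shows "D t \<noteq> {}" "convex (D t)" "compact (D t)"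
    and "\<theta> \<in> support P t \<Longrightarrow> convex_on (D t \<times> D (t - 1)) (cost_fn t \<theta>)"
    and "\<theta> \<in> support P t \<Longrightarrow> C1_on (D t \<times> D (t - 1)) (cost_fn t \<theta>)"
  using H1 assms unfolding StoH1_def cost_fn_def by blast+

lemma D_0: "D 0 = {x_init P}"
  by (simp add: dset_def)

lemma prev_stage_data:
  assumes "t \<in> {1..T + 1}"
  shows "D (t - 1) \<noteq> {}" "convex (D (t - 1))" "compact (D (t - 1))"
proof -
  consider "t = 1" | "t - 1 \<in> {1..T}" using assms by fastforce
  then have "D (t - 1) \<noteq> {} \<and> convex (D (t - 1)) \<and> compact (D (t - 1))"
  proof cases
    case 1
    then show ?thesis by (simp add: D_0)
  next
    case 2
    then show ?thesis using stage_data by blast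
  qed
  then show "D (t - 1) \<noteq> {}" "convex (D (t - 1))" "compact (D (t - 1))" by auto
qed

lemma subset_enlarge: "0 < \<epsilon> \<Longrightarrow> S \<subseteq> enlarge S \<epsilon>"
  for S :: "(real^'n) set"
  unfolding enlarge_def by (force intro: exI[of _ 0])

lemma stage_convex:
  assumes t: "t \<in> {1..T}" and \<theta>: "\<theta> \<in> support P t"
  shows "convex_stage (D t) (D (t - 1)) (cost_fn t \<theta>) (ineq_fn t \<theta>) (A_mat t \<theta>) (B_mat t \<theta>) (b_vec t \<theta>)"
proof -
  have pt: "t \<in> {1..T + 1}" using t by auto
  have cvx: "convex (D t \<times> D (t - 1))"
    using stage_data(2)[OF t] prev_stage_data(2)[OF pt] by (rule convex_Times)
  have "\<exists>\<epsilon>>0. \<forall>t\<in>{1..horizon P}. ctype P t = S2 \<longrightarrow> (\<forall>\<theta>\<in>support P t.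
           (\<forall>i. convex_on (dset P t \<times> enlarge (dset P (t - 1)) \<epsilon>) (\<lambda>(y, x). ineq P t y x \<theta> $ i) \<and>
                C1_on (dset P t \<times> dset P (t - 1)) (\<lambda>(y, x). ineq P t y x \<theta> $ i)) \<and>
           (\<forall>x\<in>enlarge (dset P (t - 1)) \<epsilon>. feas P t x \<theta> \<inter> rel_interior (dset P t) \<noteq> {}))"
    using H1 unfolding StoH1_def by blast
  then obtain \<epsilon> where \<epsilon>: "0 < \<epsilon>" and
    S2: "\<And>i. ctype P t = S2 \<Longrightarrow> convex_on (D t \<times> enlarge (D (t - 1)) \<epsilon>) (\<lambda>(y, x). ineq P t y x \<theta> $ i)"
      "\<And>i. ctype P t = S2 \<Longrightarrow> C1_on (D t \<times> D (t - 1)) (\<lambda>(y, x). ineq P t y x \<theta> $ i)"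
      "\<And>x. ctype P t = S2 \<Longrightarrow> x \<in> enlarge (D (t - 1)) \<epsilon> \<Longrightarrow> feas P t x \<theta> \<inter> rel_interior (D t) \<noteq> {}"
    using t \<theta> by blast
  note sub = subset_enlarge[OF \<epsilon>, of "D (t - 1)"]
  show ?thesis
  proof
    show "convex (D t)" "compact (D t)" "convex (D (t - 1))" "compact (D (t - 1))"
      using stage_data[OF t] prev_stage_data[OF pt] by auto
    show "convex_on (D t \<times> D (t - 1)) (cost_fn t \<theta>)" "C1_on (D t \<times> D (t - 1)) (cost_fn t \<theta>)"
      using stage_data[OF t] \<theta> by auto
    show "convex_on (D t \<times> D (t - 1)) (ineq_fn t \<theta> i)" for i
    proof (cases "ctype P t = S2")
      case True
      have "D t \<times> D (t - 1) \<subseteq> D t \<times> enlarge (D (t - 1)) \<epsilon>" using sub by blast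
      then show ?thesis
        unfolding ineq_fn_def using True convex_on_subset[OF S2(1)[OF True]] cvx by simp
    next
      case False
      then show ?thesis unfolding ineq_fn_def using cvx by (simp add: convex_on_const)
    qed
    show "C1_on (D t \<times> D (t - 1)) (ineq_fn t \<theta> i)" for i
      unfolding ineq_fn_def using S2(2) C1_on_const by auto
    show "\<exists>y\<in>D t. (\<forall>i. ineq_fn t \<theta> i (y, x) \<le> 0) \<and> A_mat t \<theta> *v y + B_mat t \<theta> *v x - b_vec t \<theta> = 0"
      if x: "x \<in> D (t - 1)" for x
    proof (cases "ctype P t = S2")
      case True
      then obtain y where "y \<in> feas P t x \<theta>" using S2(3)[OF True, of x] x sub by blast
      then show ?thesis
        using True by (auto simp: feas_def ineq_fn_def A_mat_def B_mat_def b_vec_def eq_res_def)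
    next
      case False
      then show ?thesis
        using stage_data(1)[OF t] by (auto simp: ineq_fn_def A_mat_def B_mat_def b_vec_def)
    qed
  qed
qed

lemma stage_slater:
  assumes t: "t \<in> {2..T}"
  shows "\<exists>r \<kappa>. \<forall>\<theta>\<in>support P t. slater_stage (D t) (D (t - 1)) (cost_fn t \<theta>) (ineq_fn t \<theta>)
    (A_mat t \<theta>) (B_mat t \<theta>) (b_vec t \<theta>) r \<kappa>"
proof -
  have t1: "t \<in> {1..T}" using t by auto
  have "\<exists>\<kappa>>0. \<exists>r>0. \<forall>x\<in>D (t - 1). \<forall>\<theta>\<in>support P t. \<exists>y\<in>D t. cball y r \<inter> affine hull (D t) \<subseteq> D t \<and>
    A_mat t \<theta> *v y + B_mat t \<theta> *v x - b_vec t \<theta> = 0 \<and> (\<forall>i. ineq_fn t \<theta> i (y, x) \<le> - \<kappa>)"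
  proof (cases "ctype P t = S2")
    case True
    then show ?thesis
      using H2 t unfolding StoH2_def
      by (simp add: ineq_fn_def A_mat_def B_mat_def b_vec_def eq_res_def)
  next
    case False
    have "rel_interior (D t) \<noteq> {}"
      using stage_data[OF t1] rel_interior_eq_empty by blast
    then obtain y r where y: "y \<in> D t" "0 < r" "cball y r \<inter> affine hull (D t) \<subseteq> D t"
      unfolding rel_interior_cball by blast
    then show ?thesis
      using False
      by (intro exI[of _ 1] exI[of _ r] conjI ballI bexI[of _ y])
         (auto simp: ineq_fn_def A_mat_def B_mat_def b_vec_def)
  qed
  then obtain \<kappa> r where *: "0 < \<kappa>" "0 < r" "\<forall>x\<in>D (t - 1). \<forall>\<theta>\<in>support P t. \<exists>y\<in>D t.
    cball y r \<inter> affine hull (D t) \<subseteq> D t \<and>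
    A_mat t \<theta> *v y + B_mat t \<theta> *v x - b_vec t \<theta> = 0 \<and> (\<forall>i. ineq_fn t \<theta> i (y, x) \<le> - \<kappa>)"
    by blast
  show ?thesis
    using * stage_convex[OF t1]
    by (intro exI[of _ r] exI[of _ \<kappa>] ballI slater_stage.intro slater_stage_axioms.intro) auto
qed

lemma feas_eq:
  assumes "t \<in> {1..T}" "\<theta> \<in> support P t"
  shows "feas P t x \<theta>
    = convex_stage.feas_set (D t) (ineq_fn t \<theta>) (A_mat t \<theta>) (B_mat t \<theta>) (b_vec t \<theta>) x"
proof -
  interpret st: convex_stage "D t" "D (t - 1)" "cost_fn t \<theta>" "ineq_fn t \<theta>" "A_mat t \<theta>" "B_mat t \<theta>" "b_vec t \<theta>"
    by (rule stage_convex[OF assms])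
  show ?thesis
    unfolding st.feas_set_def st.res_def
    by (cases "ctype P t")
       (auto simp: feas_def ineq_fn_def A_mat_def B_mat_def b_vec_def eq_res_def)
qed

lemma sval_eq:
  assumes "t \<in> {1..T}" "\<theta> \<in> support P t"
  shows "sval t \<theta> V x
    = convex_stage.val (D t) (cost_fn t \<theta>) (ineq_fn t \<theta>) (A_mat t \<theta>) (B_mat t \<theta>) (b_vec t \<theta>) V x"
proof -
  interpret st: convex_stage "D t" "D (t - 1)" "cost_fn t \<theta>" "ineq_fn t \<theta>" "A_mat t \<theta>" "B_mat t \<theta>" "b_vec t \<theta>"
    by (rule stage_convex[OF assms])
  show ?thesis
    unfolding sval_def st.val_def feas_eq[OF assms] by (simp add: cost_fn_def)
qed

lemma feas_subset: "feas P t x \<theta> \<subseteq> D t"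
  by (cases "ctype P t") (auto simp: feas_def)

lemma sval_attained:
  assumes "t \<in> {1..T}" "\<theta> \<in> support P t" "continuous_on (D t) V" "x \<in> D (t - 1)"
  shows "\<exists>y\<in>feas P t x \<theta>. sval t \<theta> V x = cost P t y x \<theta> + V y
    \<and> (\<forall>y'\<in>feas P t x \<theta>. sval t \<theta> V x \<le> cost P t y' x \<theta> + V y')"
  using convex_stage.val_attained[OF stage_convex[OF assms(1,2)] assms(3,4)]
  unfolding sval_eq[OF assms(1,2)] feas_eq[OF assms(1,2)] by (simp add: cost_fn_def)

lemma sval_le:
  assumes "t \<in> {1..T}" "\<theta> \<in> support P t" "continuous_on (D t) V" "x \<in> D (t - 1)" "y \<in> feas P t x \<theta>"
  shows "sval t \<theta> V x \<le> cost P t y x \<theta> + V y"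
  using sval_attained[OF assms(1-4)] assms(5) by blast

lemma sval_mono:
  assumes "t \<in> {1..T}" "\<theta> \<in> support P t" "continuous_on (D t) V" "continuous_on (D t) W" "x \<in> D (t - 1)"
    and "\<And>y. y \<in> D t \<Longrightarrow> V y \<le> W y"
  shows "sval t \<theta> V x \<le> sval t \<theta> W x"
proof -
  obtain y where y: "y \<in> feas P t x \<theta>" "sval t \<theta> W x = cost P t y x \<theta> + W y"
    using sval_attained[OF assms(1,2,4,5)] by blast
  then have "sval t \<theta> V x \<le> cost P t y x \<theta> + V y" using sval_le[OF assms(1,2,3,5)] by blast
  also have "V y \<le> W y" using assms(6) y(1) feas_subset by blast
  finally show ?thesis using y(2) by simp
qed

lemma stage_val_eq:
  assumes "t \<in> {1..T}" "\<theta> \<in> support P t" "continuous_on (D t) V" "x \<in> D (t - 1)"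
    and "\<And>y. y \<in> D t \<Longrightarrow> W y = ereal (V y)"
  shows "stage_val P t W x \<theta> = ereal (sval t \<theta> V x)"
proof -
  obtain y where y: "y \<in> feas P t x \<theta>" "sval t \<theta> V x = cost P t y x \<theta> + V y"
      "\<forall>y'\<in>feas P t x \<theta>. sval t \<theta> V x \<le> cost P t y' x \<theta> + V y'"
    using sval_attained[OF assms(1-4)] by blast
  have obj: "stage_obj P t W y' x \<theta> = ereal (cost P t y' x \<theta> + V y')" if "y' \<in> feas P t x \<theta>" for y'
    unfolding stage_obj_def using assms(5) that feas_subset by (simp add: subset_iff)
  show ?thesis
    unfolding stage_val_def
  proof (rule antisym)
    show "(INF y\<in>feas P t x \<theta>. stage_obj P t W y x \<theta>) \<le> ereal (sval t \<theta> V x)"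
      by (rule INF_lower2[OF y(1)]) (simp add: obj[OF y(1)] y(2))
    show "ereal (sval t \<theta> V x) \<le> (INF y\<in>feas P t x \<theta>. stage_obj P t W y x \<theta>)"
      using y(3) obj by (intro INF_greatest) simp
  qed
qed

lemma sval_lipschitz:
  assumes "t \<in> {1..T}" "\<theta> \<in> support P t" "LV-lipschitz_on (D t) V"
  shows "\<exists>K. K-lipschitz_on (D (t - 1)) (sval t \<theta> V)"
proof (cases "t = 1")
  case True
  then show ?thesis by (intro exI[of _ 0]) (simp add: D_0 lipschitz_on_def)
next
  case False
  then have "t \<in> {2..T}" using assms(1) by auto
  then obtain r \<kappa> where "slater_stage (D t) (D (t - 1)) (cost_fn t \<theta>) (ineq_fn t \<theta>)
      (A_mat t \<theta>) (B_mat t \<theta>) (b_vec t \<theta>) r \<kappa>"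
    using stage_slater assms(2) by blast
  from slater_stage.val_lipschitz[OF this assms(3)] show ?thesis
    unfolding sval_eq[OF assms(1,2), abs_def] by (simp add: sval_eq[OF assms(1,2)])
qed

lemma cost_continuous:
  assumes "t \<in> {1..T}" "\<theta> \<in> support P t"
    and "\<And>i::nat. (y i, x i) \<in> D t \<times> D (t - 1)" "y \<longlonglongrightarrow> y'" "x \<longlonglongrightarrow> x'" "(y', x') \<in> D t \<times> D (t - 1)"
  shows "(\<lambda>i. cost P t (y i) (x i) \<theta>) \<longlonglongrightarrow> cost P t y' x' \<theta>"
proof -
  have "continuous_on (D t \<times> D (t - 1)) (cost_fn t \<theta>)"
    by (rule C1_on_continuous[OF stage_data(5)[OF assms(1,2)]])
  moreover have "(\<lambda>i. (y i, x i)) \<longlonglongrightarrow> (y', x')" by (intro tendsto_Pair assms)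
  ultimately have "(\<lambda>i. cost_fn t \<theta> (y i, x i)) \<longlonglongrightarrow> cost_fn t \<theta> (y', x')"
    by (rule continuous_on_tendsto_compose) (use assms(3,6) in auto)
  then show ?thesis by (simp add: cost_fn_def)
qed

lemma feas_closed:
  assumes t: "t \<in> {1..T}" "\<theta> \<in> support P t"
    and x: "\<And>i::nat. x i \<in> D (t - 1)" and y: "\<And>i. y i \<in> feas P t (x i) \<theta>" and lim: "y \<longlonglongrightarrow> y'" "x \<longlonglongrightarrow> x'"
  shows "x' \<in> D (t - 1)" "y' \<in> feas P t x' \<theta>"
proof -
  interpret st: convex_stage "D t" "D (t - 1)" "cost_fn t \<theta>" "ineq_fn t \<theta>" "A_mat t \<theta>" "B_mat t \<theta>" "b_vec t \<theta>"
    by (rule stage_convex[OF t])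
  show x': "x' \<in> D (t - 1)"
    using closed_sequentially[OF compact_imp_closed[OF st.U_compact]] x lim(2) by blast
  have yD: "y i \<in> D t" for i using y feas_subset by blast
  have y': "y' \<in> D t"
    using closed_sequentially[OF compact_imp_closed[OF st.X_compact]] yD lim(1) by blast
  have y_st: "y i \<in> st.feas_set (x i)" for i using y[of i] by (simp add: feas_eq[OF t])
  have "ineq_fn t \<theta> j (y', x') \<le> 0" for j
  proof (rule LIMSEQ_le_const2)
    show "(\<lambda>i. ineq_fn t \<theta> j (y i, x i)) \<longlonglongrightarrow> ineq_fn t \<theta> j (y', x')"
      by (rule continuous_on_tendsto_compose[OF C1_on_continuous[OF st.g_C1[of j]] tendsto_Pair[OF lim]])
         (use x yD x' y' in auto)
    show "\<exists>N. \<forall>n\<ge>N. ineq_fn t \<theta> j (y n, x n) \<le> 0" using y_st by (auto simp: st.feas_set_def)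
  qed
  moreover have "st.res y' x' = 0"
  proof (rule LIMSEQ_unique)
    show "(\<lambda>i. st.res (y i) (x i)) \<longlonglongrightarrow> st.res y' x'"
      unfolding st.res_def
      by (intro tendsto_intros lim bounded_linear.tendsto[OF matrix_vector_mul_bounded_linear])
    show "(\<lambda>i. st.res (y i) (x i)) \<longlonglongrightarrow> 0" using y_st by (simp add: st.feas_set_def)
  qed
  ultimately show "y' \<in> feas P t x' \<theta>"
    unfolding feas_eq[OF t] using y' by (simp add: st.feas_set_def)
qed

section \<open>The law of the noise and the cost-to-go functions\<close>

lemma prob_pspace: "prob_space (pspace P)"
  using H0 by (simp add: StoH0_def)

sublocale pr: prob_space "pspace P" by (rule prob_pspace)

lemma indep_noise: "pr.indep_vars (\<lambda>_. borel) (noise P) {1..T}"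
  using H0 by (simp add: StoH0_def)

lemma noise_measurable: "t \<in> {1..T} \<Longrightarrow> noise P t \<in> borel_measurable (pspace P)"
  using indep_noise unfolding pr.indep_vars_def by auto

lemma noise_one: "s \<in> space (pspace P) \<Longrightarrow> noise P 1 s = xi_one P"
  using H0 unfolding StoH0_def by blast

lemma support_one: "support P 1 = {xi_one P}"
  by (simp add: support_def)

lemma support_facts:
  assumes "t \<in> {1..T}"
  shows "finite (support P t)" "AE s in pspace P. noise P t s \<in> support P t"
    "\<theta> \<in> support P t \<Longrightarrow> 0 < noise_prob P t \<theta>"
proof -
  have "finite (support P t) \<and> (AE s in pspace P. noise P t s \<in> support P t) \<and>
      (\<forall>\<theta>\<in>support P t. 0 < noise_prob P t \<theta>)"
  proof (cases "t = 1")
    case True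
    have "{s \<in> space (pspace P). noise P 1 s = xi_one P} = space (pspace P)"
      using noise_one by blast
    then show ?thesis
      unfolding True support_one noise_prob_def using noise_one by (simp add: pr.prob_space)
  next
    case False
    then have "t \<in> {2..T}" "support P t = Theta P t" using assms by (auto simp: support_def)
    then show ?thesis using H0 unfolding StoH0_def by auto
  qed
  then show "finite (support P t)" "AE s in pspace P. noise P t s \<in> support P t"
    "\<theta> \<in> support P t \<Longrightarrow> 0 < noise_prob P t \<theta>" by auto
qed

lemma noise_prob_nonneg: "0 \<le> noise_prob P t \<theta>"
  by (simp add: noise_prob_def)

lemma noise_event: "t \<in> {1..T} \<Longrightarrow> {s \<in> space (pspace P). noise P t s = \<theta>} \<in> sets (pspace P)"
  using measurable_sets[OF noise_measurable, of t "{\<theta>}"] by (simp add: vimage_def Int_def conj_commute)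

lemma sum_noise_prob:
  assumes "t \<in> {1..T}"
  shows "(\<Sum>\<theta>\<in>support P t. noise_prob P t \<theta>) = 1"
proof -
  let ?A = "\<lambda>\<theta>. {s \<in> space (pspace P). noise P t s = \<theta>}"
  have "(\<Sum>\<theta>\<in>support P t. noise_prob P t \<theta>) = pr.prob (\<Union>\<theta>\<in>support P t. ?A \<theta>)"
    unfolding noise_prob_def
    by (rule pr.finite_measure_finite_Union[symmetric])
       (auto simp: support_facts[OF assms] noise_event[OF assms] disjoint_family_on_def)
  also have "\<dots> = 1"
  proof (rule pr.prob_eq_1[THEN iffD2])
    show "(\<Union>\<theta>\<in>support P t. ?A \<theta>) \<in> sets (pspace P)"
      by (intro sets.finite_UN support_facts[OF assms] noise_event[OF assms])
    show "AE s in pspace P. s \<in> (\<Union>\<theta>\<in>support P t. ?A \<theta>)"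
      using support_facts(2)[OF assms] AE_space by eventually_elim auto
  qed
  finally show ?thesis .
qed

definition q :: "nat \<Rightarrow> real^'n \<Rightarrow> real" where
  "q t x = real_of_ereal (cost_to_go P t x)"

lemma q_end: "cost_to_go P (Suc T) x = 0" "q (Suc T) x = 0"
  by (simp_all add: cost_to_go.simps[of P "Suc T"] q_def)

text \<open>
  Backward induction over the stages. Lipschitz continuity is the property that passes from one
  stage to the next; it makes the infima attained, hence finite.
\<close>

lemma ctg_regular:
  assumes "1 \<le> t" "t \<le> Suc T"
  shows "(\<forall>x\<in>D (t - 1). cost_to_go P t x = ereal (q t x)) \<and> (\<exists>L. L-lipschitz_on (D (t - 1)) (q t)) \<and>
    (t \<le> T \<longrightarrow> (\<forall>x\<in>D (t - 1). q t x = (\<Sum>\<theta>\<in>support P t. noise_prob P t \<theta> * sval t \<theta> (q (Suc t)) x)))"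
  using assms(2)
proof (induction t rule: inc_induct)
  case base
  have "0-lipschitz_on (D (Suc T - 1)) (q (Suc T))" by (simp add: lipschitz_on_def q_end)
  then show ?case using q_end by (auto simp: zero_ereal_def)
next
  case (step n)
  then have n: "n \<in> {1..T}" using assms(1) by auto
  let ?p = "noise_prob P n" and ?s = "\<lambda>\<theta>. sval n \<theta> (q (Suc n))"
  obtain L where L: "L-lipschitz_on (D n) (q (Suc n))" using step.IH by auto
  note cont = lipschitz_on_continuous_on[OF L]
  have sv: "stage_val P n (cost_to_go P (Suc n)) x \<theta> = ereal (?s \<theta> x)"
    if "x \<in> D (n - 1)" "\<theta> \<in> support P n" for x \<theta>
    using stage_val_eq[OF n that(2) cont that(1)] step.IH by simp
  have ctg: "cost_to_go P n x = ereal (\<Sum>\<theta>\<in>support P n. ?p \<theta> * ?s \<theta> x)" if x: "x \<in> D (n - 1)" for x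
  proof -
    have "cost_to_go P n x
        = (\<Sum>\<theta>\<in>support P n. ereal (?p \<theta>) * stage_val P n (cost_to_go P (Suc n)) x \<theta>)"
      using n by (subst cost_to_go.simps) simp
    also have "\<dots> = (\<Sum>\<theta>\<in>support P n. ereal (?p \<theta> * ?s \<theta> x))"
      by (rule sum.cong) (simp_all add: sv[OF x])
    finally show ?thesis by simp
  qed
  then have qn: "q n x = (\<Sum>\<theta>\<in>support P n. ?p \<theta> * ?s \<theta> x)" if "x \<in> D (n - 1)" for x
    using that by (simp add: q_def)
  have "\<forall>\<theta>\<in>support P n. \<exists>K. K-lipschitz_on (D (n - 1)) (?s \<theta>)"
    using sval_lipschitz[OF n _ L] by blast
  then obtain K where K: "\<And>\<theta>. \<theta> \<in> support P n \<Longrightarrow> (K \<theta>)-lipschitz_on (D (n - 1)) (?s \<theta>)" by metis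
  have "(\<Sum>\<theta>\<in>support P n. ?p \<theta> * K \<theta>)-lipschitz_on (D (n - 1)) (q n)"
  proof (rule lipschitz_onI)
    show "0 \<le> (\<Sum>\<theta>\<in>support P n. ?p \<theta> * K \<theta>)"
      using K by (intro sum_nonneg mult_nonneg_nonneg noise_prob_nonneg) (blast dest: lipschitz_on_nonneg)
    fix x x' assume x: "x \<in> D (n - 1)" "x' \<in> D (n - 1)"
    have "\<bar>q n x - q n x'\<bar> = \<bar>\<Sum>\<theta>\<in>support P n. ?p \<theta> * (?s \<theta> x - ?s \<theta> x')\<bar>"
      unfolding qn[OF x(1)] qn[OF x(2)] by (simp add: sum_subtractf right_diff_distrib)
    also have "\<dots> \<le> (\<Sum>\<theta>\<in>support P n. \<bar>?p \<theta> * (?s \<theta> x - ?s \<theta> x')\<bar>)" by (rule sum_abs)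
    also have "\<dots> \<le> (\<Sum>\<theta>\<in>support P n. ?p \<theta> * (K \<theta> * dist x x'))"
    proof (rule sum_mono)
      fix \<theta> assume "\<theta> \<in> support P n"
      then have "\<bar>?s \<theta> x - ?s \<theta> x'\<bar> \<le> K \<theta> * dist x x'"
        using lipschitz_onD[OF K x] by (simp add: dist_real_def)
      then show "\<bar>?p \<theta> * (?s \<theta> x - ?s \<theta> x')\<bar> \<le> ?p \<theta> * (K \<theta> * dist x x')"
        using noise_prob_nonneg[of n \<theta>] by (simp add: abs_mult mult_left_mono)
    qed
    finally show "dist (q n x) (q n x') \<le> (\<Sum>\<theta>\<in>support P n. ?p \<theta> * K \<theta>) * dist x x'"
      by (simp add: dist_real_def sum_distrib_right mult.assoc)
  qed
  then show ?case using ctg qn by auto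
qed

lemma ctg_eq: "1 \<le> t \<Longrightarrow> t \<le> Suc T \<Longrightarrow> x \<in> D (t - 1) \<Longrightarrow> cost_to_go P t x = ereal (q t x)"
  using ctg_regular by blast

lemma q_lipschitz: "1 \<le> t \<Longrightarrow> t \<le> Suc T \<Longrightarrow> \<exists>L. L-lipschitz_on (D (t - 1)) (q t)"
  using ctg_regular by blast

lemma q_continuous: "t \<le> T \<Longrightarrow> continuous_on (D t) (q (Suc t))"
  using q_lipschitz[of "Suc t"] lipschitz_on_continuous_on by auto

lemma q_eq:
  "t \<in> {1..T} \<Longrightarrow> x \<in> D (t - 1) \<Longrightarrow>
    q t x = (\<Sum>\<theta>\<in>support P t. noise_prob P t \<theta> * sval t \<theta> (q (Suc t)) x)"
  using ctg_regular[of t] by auto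

text \<open>
  The first stage fits the recursion of the later ones: its noise is deterministic, so the
  expectation is over a single realization of probability 1.
\<close>

lemma first_stage_value_eq:
  "first_stage_value P = ereal (q 1 (x_init P))"
  "q 1 (x_init P) = sval 1 (xi_one P) (q 2) (x_init P)"
proof -
  have one: "1 \<in> {1..T}" using horizon_pos by simp
  have x0: "x_init P \<in> D (1 - 1)" by (simp add: D_0)
  have c: "continuous_on (D 1) (q 2)" using q_continuous[OF horizon_pos] by (simp add: numeral_2_eq_2)
  have "first_stage_value P = ereal (sval 1 (xi_one P) (q 2) (x_init P))"
    unfolding first_stage_value_def
  proof (rule stage_val_eq[OF one _ c x0])
    show "cost_to_go P 2 y = ereal (q 2 y)" if "y \<in> D 1" for y
      using ctg_eq[of 2 y] that horizon_pos by simp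
  qed (use support_one in simp)
  moreover have "noise_prob P 1 (xi_one P) = 1"
    using sum_noise_prob[OF one] unfolding support_one by simp
  then show "q 1 (x_init P) = sval 1 (xi_one P) (q 2) (x_init P)"
    using q_eq[OF one x0] unfolding support_one by (simp add: numeral_2_eq_2)
  ultimately show "first_stage_value P = ereal (q 1 (x_init P))" by simp
qed

section \<open>Nodes of the scenario tree\<close>

lemma nodes_0: "nodes P 0 = {[]}"
  by (auto simp: nodes_def)

lemma length_node: "n \<in> nodes P t \<Longrightarrow> length n = t"
  by (simp add: nodes_def)

lemma nodes_Suc: "nodes P (Suc t) = {n @ [\<theta>] | n \<theta>. n \<in> nodes P t \<and> \<theta> \<in> support P (Suc t)}"
proof
  show "nodes P (Suc t) \<subseteq> {n @ [\<theta>] | n \<theta>. n \<in> nodes P t \<and> \<theta> \<in> support P (Suc t)}"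
  proof
    fix m assume m: "m \<in> nodes P (Suc t)"
    then have len: "length m = Suc t" and sup: "\<And>j. j < Suc t \<Longrightarrow> m ! j \<in> support P (Suc j)"
      by (auto simp: nodes_def)
    then have "m = butlast m @ [m ! t]"
      by (metis append_butlast_last_id diff_Suc_1 last_conv_nth length_0_conv nat.distinct(1))
    moreover have "butlast m \<in> nodes P t"
      using len sup by (auto simp: nodes_def nth_butlast)
    ultimately show "m \<in> {n @ [\<theta>] | n \<theta>. n \<in> nodes P t \<and> \<theta> \<in> support P (Suc t)}"
      using sup[of t] by blast
  qed
  show "{n @ [\<theta>] | n \<theta>. n \<in> nodes P t \<and> \<theta> \<in> support P (Suc t)} \<subseteq> nodes P (Suc t)"
    by (auto simp: nodes_def nth_append less_Suc_eq)
qed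

lemma child_node: "n \<in> nodes P t \<Longrightarrow> \<theta> \<in> support P (Suc t) \<Longrightarrow> n @ [\<theta>] \<in> nodes P (Suc t)"
  by (auto simp: nodes_Suc)

lemma finite_nodes: "t \<le> T \<Longrightarrow> finite (nodes P t)"
proof (induction t)
  case (Suc t)
  have "nodes P (Suc t) = (\<lambda>(n, \<theta>). n @ [\<theta>]) ` (nodes P t \<times> support P (Suc t))"
    by (auto simp: nodes_Suc)
  then show ?case using Suc support_facts(1)[of "Suc t"] by simp
qed (simp add: nodes_0)

lemma children_eq: "n \<in> nodes P t \<Longrightarrow> children P n = (\<lambda>\<theta>. n @ [\<theta>]) ` support P (Suc t)"
  by (auto simp: children_def length_node)

lemma sum_children:
  "n \<in> nodes P t \<Longrightarrow> (\<Sum>m\<in>children P n. h m) = (\<Sum>\<theta>\<in>support P (Suc t). h (n @ [\<theta>]))"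
  by (simp add: children_eq sum.reindex inj_on_def)

lemma trans_prob_child: "n \<in> nodes P t \<Longrightarrow> trans_prob P (n @ [\<theta>]) = noise_prob P (Suc t) \<theta>"
  by (simp add: trans_prob_def length_node)

lemma node_in_all: "n \<in> nodes P t \<Longrightarrow> t \<le> T \<Longrightarrow> n \<in> all_nodes P"
  by (auto simp: all_nodes_def)

lemma node_1: "[xi_one P] \<in> nodes P 1"
  using support_one by (simp add: nodes_def)

section \<open>The sampled scenarios\<close>

lemma joint_noise_prob:
  assumes "J \<subseteq> {1..T}"
  shows "{s \<in> space (pspace P). \<forall>t\<in>J. noise P t s = \<xi> t} \<in> sets (pspace P)" (is "?A \<in> _")
    and "pr.prob {s \<in> space (pspace P). \<forall>t\<in>J. noise P t s = \<xi> t} = (\<Prod>t\<in>J. noise_prob P t (\<xi> t))"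
proof -
  have fin: "finite J" using assms finite_subset by blast
  have "?A \<in> sets (pspace P) \<and> pr.prob ?A = (\<Prod>t\<in>J. noise_prob P t (\<xi> t))"
  proof (cases "J = {}")
    case True
    then show ?thesis by (simp add: pr.prob_space)
  next
    case False
    have eq: "?A = (\<Inter>t\<in>J. noise P t -` {\<xi> t} \<inter> space (pspace P))" using False by auto
    have "?A \<in> sets (pspace P)"
      unfolding eq using assms noise_measurable fin False
      by (intro sets.finite_INT measurable_sets[of _ _ borel]) auto
    moreover have "pr.prob ?A = (\<Prod>t\<in>J. pr.prob (noise P t -` {\<xi> t} \<inter> space (pspace P)))"
      unfolding eq by (rule pr.indep_varsD[OF indep_noise False fin assms]) simp
    moreover have "noise P t -` {\<xi> t} \<inter> space (pspace P) = {s \<in> space (pspace P). noise P t s = \<xi> t}" for t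
      by auto
    ultimately show ?thesis by (simp add: noise_prob_def)
  qed
  then show "?A \<in> sets (pspace P)" "pr.prob ?A = (\<Prod>t\<in>J. noise_prob P t (\<xi> t))" by auto
qed

abbreviation scenarios :: "(nat \<Rightarrow> real^'k) set" where
  "scenarios \<equiv> \<Pi>\<^sub>E t\<in>{2..T}. Theta P t"

lemma support_Theta: "2 \<le> t \<Longrightarrow> support P t = Theta P t"
  by (simp add: support_def)

lemma Theta_facts:
  assumes "t \<in> {2..T}"
  shows "finite (Theta P t)" "AE s in pspace P. noise P t s \<in> Theta P t"
    "\<theta> \<in> Theta P t \<Longrightarrow> 0 < noise_prob P t \<theta>"
proof -
  have t: "t \<in> {1..T}" and eq: "support P t = Theta P t" using assms support_Theta by auto
  from support_facts[OF t, unfolded eq] show "finite (Theta P t)"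
    "AE s in pspace P. noise P t s \<in> Theta P t" "\<theta> \<in> Theta P t \<Longrightarrow> 0 < noise_prob P t \<theta>"
    by blast+
qed

lemma finite_scenarios: "finite scenarios"
  by (intro finite_PiE Theta_facts(1)) auto

text \<open>
  The positivity follows from interstage independence and the positive probabilities of the
  realizations at each stage.
\<close>

lemma scenario_law_facts:
  "prob_space (scenario_law P)" "space (scenario_law P) = scenarios"
  "sets (scenario_law P) = Pow scenarios"
  "\<xi> \<in> scenarios \<Longrightarrow> 0 < measure (scenario_law P) {\<xi>}"
proof -
  let ?B = "\<Pi>\<^sub>M t\<in>{2..T}. (borel :: (real^'k) measure)"
  let ?X = "\<lambda>s. \<lambda>t\<in>{2..T}. noise P t s"
  have X: "?X \<in> measurable (pspace P) ?B"
    using noise_measurable by (intro measurable_restrict) auto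
  have sing: "{\<xi>} \<in> sets ?B" if "\<xi> \<in> scenarios" for \<xi>
  proof -
    have "(\<Pi>\<^sub>E t\<in>{2..T}. {\<xi> t}) \<in> sets ?B" by (intro sets_PiM_I_finite) auto
    moreover have "(\<Pi>\<^sub>E t\<in>{2..T}. {\<xi> t}) = {\<xi>}"
      using that by (intro PiE_singleton) (auto simp: PiE_def)
    ultimately show ?thesis by simp
  qed
  have sub: "C \<in> sets ?B" if "C \<subseteq> scenarios" for C
  proof -
    have "(\<Union>\<xi>\<in>C. {\<xi>}) \<in> sets ?B"
      using that finite_subset[OF that finite_scenarios] sing by (intro sets.finite_UN) auto
    then show ?thesis by simp
  qed
  let ?D = "distr (pspace P) ?B ?X"
  have law: "scenario_law P = restrict_space ?D scenarios" by (simp add: scenario_law_def)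
  have sD: "scenarios \<in> sets ?D" using sub by simp
  have "emeasure ?D scenarios = 1"
  proof -
    interpret D: prob_space ?D by (rule pr.prob_space_distr[OF X])
    have "AE s in pspace P. \<forall>t\<in>{2..T}. noise P t s \<in> Theta P t"
      by (intro AE_finite_allI Theta_facts(2)) auto
    then have "AE s in pspace P. ?X s \<in> scenarios" by eventually_elim auto
    moreover have "{x \<in> space ?B. x \<in> scenarios} = scenarios"
      using sets.sets_into_space[OF sub[OF order_refl]] by blast
    then have "{x \<in> space ?B. x \<in> scenarios} \<in> sets ?B" using sub[OF order_refl] by simp
    ultimately have "AE x in ?D. x \<in> scenarios" by (subst AE_distr_iff[OF X])
    then have "D.prob scenarios = 1" using sD by (simp add: D.prob_eq_1)
    then show ?thesis by (simp add: D.emeasure_eq_measure)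
  qed
  then show "prob_space (scenario_law P)" unfolding law by (intro prob_space_restrict_space sD)
  have "scenarios \<subseteq> space ?D" using sets.sets_into_space[OF sD] .
  then show space: "space (scenario_law P) = scenarios"
    unfolding law by (simp add: space_restrict_space Int_absorb2)
  show "sets (scenario_law P) = Pow scenarios"
  proof
    show "sets (scenario_law P) \<subseteq> Pow scenarios"
      using sets.sets_into_space[of _ "scenario_law P"] space by blast
    show "Pow scenarios \<subseteq> sets (scenario_law P)"
      unfolding law sets_restrict_space using sub by auto
  qed
  show "0 < measure (scenario_law P) {\<xi>}" if \<xi>: "\<xi> \<in> scenarios"
  proof -
    have "measure (scenario_law P) {\<xi>} = measure ?D {\<xi>}"
      unfolding law using sD \<xi> by (intro measure_restrict_space) auto
    also have "\<dots> = pr.prob (?X -` {\<xi>} \<inter> space (pspace P))"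
      using X sing[OF \<xi>] by (rule measure_distr)
    also have "?X -` {\<xi>} \<inter> space (pspace P) = {s \<in> space (pspace P). \<forall>t\<in>{2..T}. noise P t s = \<xi> t}"
      using \<xi> by (auto simp: fun_eq_iff PiE_def extensional_def)
    also have "pr.prob \<dots> = (\<Prod>t\<in>{2..T}. noise_prob P t (\<xi> t))"
      by (rule joint_noise_prob(2)) auto
    also have "0 < \<dots>"
      using \<xi> by (intro prod_pos Theta_facts(3)) auto
    finally show ?thesis .
  qed
qed

lemma sample_space_coord:
  assumes "\<omega> \<in> space (sample_space P)" "1 \<le> k"
  shows "\<omega> k \<in> scenarios"
  using assms unfolding sample_space_def by (auto simp: space_PiM PiE_def Pi_def scenario_law_facts(2))

text \<open>
  With the positivity of the scenarios this gives every node a positive probability of being selected.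
  Beyond the stage of the node any realization will do.
\<close>

lemma scenario_through_node:
  assumes "n \<in> nodes P t" "1 \<le> t" "t \<le> T"
  shows "\<exists>\<xi>\<in>scenarios. sampled_node P \<xi> t = n"
proof -
  have ne: "Theta P j \<noteq> {}" if "j \<in> {2..T}" for j
    using sum_noise_prob[of j] support_Theta[of j] that by auto
  define \<xi> where "\<xi> = (\<lambda>j\<in>{2..T}. if j \<le> t then n ! (j - 1) else (SOME \<theta>. \<theta> \<in> Theta P j))"
  have len: "length n = t" and nth: "\<And>j. j < t \<Longrightarrow> n ! j \<in> support P (Suc j)"
    using assms(1) by (auto simp: nodes_def)
  have "\<xi> \<in> scenarios"
  proof (rule PiE_I)
    fix j assume j: "j \<in> {2..T}"
    show "\<xi> j \<in> Theta P j"
    proof (cases "j \<le> t")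
      case True
      then have "n ! (j - 1) \<in> support P (Suc (j - 1))" using j by (intro nth) auto
      then show ?thesis using True j by (simp add: \<xi>_def support_Theta)
    next
      case False
      then show ?thesis using j ne[OF j] by (simp add: \<xi>_def some_in_eq)
    qed
  qed (auto simp: \<xi>_def)
  moreover have "sampled_node P \<xi> t = n"
  proof (rule nth_equalityI)
    show l: "length (sampled_node P \<xi> t) = length n"
      using len assms(2) by (simp add: sampled_node_def del: upt_Suc)
    fix i assume "i < length (sampled_node P \<xi> t)"
    then have i: "i < t" using l len by simp
    show "sampled_node P \<xi> t ! i = n ! i"
    proof (cases i)
      case 0
      then show ?thesis using nth[of 0] assms(2) support_one by (simp add: sampled_node_def)
    next
      case (Suc i')
      then show ?thesis using i assms(3) by (simp add: sampled_node_def \<xi>_def del: upt_Suc)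
    qed
  qed
  ultimately show ?thesis by blast
qed

section \<open>Policies on the scenario tree\<close>

definition hist :: "nat \<Rightarrow> 's \<Rightarrow> (real^'k) list" where
  "hist t s = map (\<lambda>j. noise P j s) [1..<Suc t]"

text \<open>The probability that the history of the process is \<open>m\<close>, by interstage independence.\<close>

definition node_prob :: "(real^'k) list \<Rightarrow> real" where
  "node_prob m = (\<Prod>j\<in>{1..length m}. noise_prob P j (m ! (j - 1)))"

lemma hist_simps: "hist 0 s = []" "hist (Suc t) s = hist t s @ [noise P (Suc t) s]"
  by (simp_all add: hist_def)

lemma length_hist: "length (hist t s) = t"
  by (simp add: hist_def)

lemma nth_hist: "j < t \<Longrightarrow> hist t s ! j = noise P (Suc j) s"
  by (simp add: hist_def del: upt_Suc)

lemma hist_eq_iff: "length m = t \<Longrightarrow> hist t s = m \<longleftrightarrow> (\<forall>j\<in>{1..t}. noise P j s = m ! (j - 1))"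
proof
  assume "hist t s = m"
  then show "\<forall>j\<in>{1..t}. noise P j s = m ! (j - 1)" using nth_hist[of _ t s] by fastforce
next
  assume "length m = t" and *: "\<forall>j\<in>{1..t}. noise P j s = m ! (j - 1)"
  then show "hist t s = m"
    by (intro nth_equalityI) (auto simp: length_hist nth_hist)
qed

lemma node_prob_simps:
  "node_prob [] = 1" "node_prob (n @ [\<theta>]) = node_prob n * noise_prob P (Suc (length n)) \<theta>"
proof -
  show "node_prob [] = 1" by (simp add: node_prob_def)
  have "(\<Prod>j\<in>{1..length n}. noise_prob P j ((n @ [\<theta>]) ! (j - 1))) = node_prob n"
    unfolding node_prob_def by (intro prod.cong) (auto simp: nth_append)
  then show "node_prob (n @ [\<theta>]) = node_prob n * noise_prob P (Suc (length n)) \<theta>"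
    unfolding node_prob_def[of "n @ [\<theta>]"] by (simp add: mult.commute)
qed

lemma node_prob_pos:
  assumes "m \<in> nodes P t" "t \<le> T"
  shows "0 < node_prob m"
  unfolding node_prob_def
proof (intro prod_pos)
  fix j assume j: "j \<in> {1..length m}"
  have len: "length m = t" using assms(1) by (rule length_node)
  have "j - 1 < t" "Suc (j - 1) = j" using j len by auto
  then have "m ! (j - 1) \<in> support P j" using assms(1) unfolding nodes_def by fastforce
  then show "0 < noise_prob P j (m ! (j - 1))"
    using j len assms(2) by (intro support_facts(3)) auto
qed

lemma hist_event:
  assumes "length m = t" "t \<le> T"
  shows "{s \<in> space (pspace P). hist t s = m} \<in> sets (pspace P)"
    and "pr.prob {s \<in> space (pspace P). hist t s = m} = node_prob m"
proof -
  have J: "{1..t} \<subseteq> {1..T}" using assms(2) by auto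
  show "{s \<in> space (pspace P). hist t s = m} \<in> sets (pspace P)"
    "pr.prob {s \<in> space (pspace P). hist t s = m} = node_prob m"
    using joint_noise_prob[OF J, of "\<lambda>j. m ! (j - 1)"] unfolding hist_eq_iff[OF assms(1)] node_prob_def assms(1)
    by auto
qed

lemma AE_hist: "t \<le> T \<Longrightarrow> AE s in pspace P. hist t s \<in> nodes P t"
proof (induction t)
  case 0
  then show ?case by (simp add: hist_simps nodes_0)
next
  case (Suc t)
  then have "AE s in pspace P. hist t s \<in> nodes P t" "AE s in pspace P. noise P (Suc t) s \<in> support P (Suc t)"
    using support_facts(2)[of "Suc t"] by auto
  then show ?case
  proof eventually_elim
    case (elim s)
    then show ?case unfolding hist_simps by (intro child_node)
  qed
qed

lemma hist_filt_event:
  assumes "length m = t" "1 \<le> t"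
  shows "{s \<in> space (pspace P). hist t s = m} \<in> sets (filt P t)"
proof -
  have sub: "(\<Union>j\<in>{1..t}. {noise P j -` B \<inter> space (pspace P) | B. B \<in> sets borel}) \<subseteq> Pow (space (pspace P))"
    by auto
  have "{s \<in> space (pspace P). hist t s = m} = (\<Inter>j\<in>{1..t}. noise P j -` {m ! (j - 1)} \<inter> space (pspace P))"
    unfolding hist_eq_iff[OF assms(1)] using assms(2) by auto
  also have "\<dots> \<in> sets (filt P t)"
  proof (rule sets.finite_INT)
    fix j assume "j \<in> {1..t}"
    then have "noise P j -` {m ! (j - 1)} \<inter> space (pspace P)
        \<in> (\<Union>j\<in>{1..t}. {noise P j -` B \<inter> space (pspace P) | B. B \<in> sets borel})"
      by (intro UN_I[of j]) auto
    then show "noise P j -` {m ! (j - 1)} \<inter> space (pspace P) \<in> sets (filt P t)"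
      unfolding filt_def sets_measure_of[OF sub] by (rule sigma_sets.Basic)
  qed (use assms(2) in auto)
  finally show ?thesis .
qed

text \<open>
  Every set of the generated sigma-algebra contains either both or none of two points with equal histories.
\<close>

lemma filt_measurable_hist:
  fixes x :: "'s \<Rightarrow> real^'n"
  assumes x: "x \<in> borel_measurable (filt P t)"
    and s: "s \<in> space (pspace P)" "s' \<in> space (pspace P)" "hist t s = hist t s'"
  shows "x s = x s'"
proof -
  let ?G = "\<Union>j\<in>{1..t}. {noise P j -` B \<inter> space (pspace P) | B. B \<in> sets borel}"
  have sub: "?G \<subseteq> Pow (space (pspace P))" by auto
  have noise: "noise P j s = noise P j s'" if "j \<in> {1..t}" for j
  proof -
    define i where "i = j - 1"
    have i: "j = Suc i" "i < t" using that by (auto simp: i_def)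
    have "hist t s ! i = hist t s' ! i" using s(3) by simp
    then show ?thesis using i by (simp add: nth_hist)
  qed
  have inv: "s \<in> C \<longleftrightarrow> s' \<in> C" if "C \<in> sigma_sets (space (pspace P)) ?G" for C
    using that
  proof (induction C rule: sigma_sets.induct)
    case (Basic C)
    then show ?case using noise s by auto
  qed (use s in auto)
  have "x -` {x s} \<inter> space (filt P t) \<in> sets (filt P t)" by (rule measurable_sets[OF x]) simp
  moreover have "space (filt P t) = space (pspace P)" by (simp add: filt_def space_measure_of_conv)
  moreover have "sets (filt P t) = sigma_sets (space (pspace P)) ?G"
    unfolding filt_def by (rule sets_measure_of[OF sub])
  ultimately have "x -` {x s} \<inter> space (pspace P) \<in> sigma_sets (space (pspace P)) ?G"
    by (simp only:)
  from inv[OF this] show ?thesis using s by auto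
qed

text \<open>
  A tree is a decision for every node. In an optimal tree every decision is optimal for its
  stage problem with the exact cost-to-go function, given the decision at the parent.
\<close>

definition feasible_tree :: "((real^'k) list \<Rightarrow> real^'n) \<Rightarrow> bool" where
  "feasible_tree z \<longleftrightarrow> z [] = x_init P \<and>
     (\<forall>t<T. \<forall>n\<in>nodes P t. \<forall>\<theta>\<in>support P (Suc t). z (n @ [\<theta>]) \<in> feas P (Suc t) (z n) \<theta>)"

definition optimal_tree :: "((real^'k) list \<Rightarrow> real^'n) \<Rightarrow> bool" where
  "optimal_tree z \<longleftrightarrow> feasible_tree z \<and> (\<forall>t<T. \<forall>n\<in>nodes P t. \<forall>\<theta>\<in>support P (Suc t).
     cost P (Suc t) (z (n @ [\<theta>])) (z n) \<theta> + q (Suc (Suc t)) (z (n @ [\<theta>]))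
       \<le> sval (Suc t) \<theta> (q (Suc (Suc t))) (z n))"

definition tree_cost :: "((real^'k) list \<Rightarrow> real^'n) \<Rightarrow> real" where
  "tree_cost z = (\<Sum>t=1..T. \<Sum>m\<in>nodes P t. cost P t (z m) (z (butlast m)) (last m) * node_prob m)"

lemma feasible_tree_in_D:
  assumes "feasible_tree z" "t \<le> T" "n \<in> nodes P t"
  shows "z n \<in> D t"
proof (cases t)
  case 0
  then show ?thesis using assms by (simp add: nodes_0 D_0 feasible_tree_def)
next
  case (Suc i)
  then obtain n' \<theta> where "n = n' @ [\<theta>]" "n' \<in> nodes P i" "\<theta> \<in> support P (Suc i)"
    using assms(3) by (auto simp: nodes_Suc)
  then have "z n \<in> feas P t (z n') \<theta>" using assms(1,2) Suc unfolding feasible_tree_def by simp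
  then show ?thesis using feas_subset by blast
qed

lemma sum_nodes_Suc:
  "(\<Sum>m\<in>nodes P (Suc t). h m) = (\<Sum>n\<in>nodes P t. \<Sum>\<theta>\<in>support P (Suc t). h (n @ [\<theta>]))"
proof -
  have eq: "nodes P (Suc t) = (\<lambda>(n, \<theta>). n @ [\<theta>]) ` (nodes P t \<times> support P (Suc t))"
    by (auto simp: nodes_Suc)
  have "inj_on (\<lambda>(n, \<theta>). n @ [\<theta>]) (nodes P t \<times> support P (Suc t))" by (auto simp: inj_on_def)
  then have "(\<Sum>m\<in>nodes P (Suc t). h m) = (\<Sum>(n, \<theta>)\<in>nodes P t \<times> support P (Suc t). h (n @ [\<theta>]))"
    unfolding eq by (subst sum.reindex) (auto simp: case_prod_unfold intro!: sum.cong)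
  then show ?thesis by (simp add: sum.cartesian_product)
qed

text \<open>
  The dynamic programming principle on the tree: the cost of the first \<open>s\<close> stages together with
  the expected cost-to-go is nondecreasing in \<open>s\<close>, and constant if every decision is optimal.
\<close>

lemma tree_cost_bounds:
  assumes z: "feasible_tree z"
  shows "q 1 (x_init P) \<le> tree_cost z"
    and "optimal_tree z \<Longrightarrow> tree_cost z = q 1 (x_init P)"
proof -
  define c where "c t = (\<Sum>m\<in>nodes P t. cost P t (z m) (z (butlast m)) (last m) * node_prob m)" for t
  define e where "e t = (\<Sum>m\<in>nodes P t. q (Suc t) (z m) * node_prob m)" for t
  have ce: "c (Suc t) + e (Suc t) = (\<Sum>n\<in>nodes P t. (\<Sum>\<theta>\<in>support P (Suc t). noise_prob P (Suc t) \<theta> *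
      (cost P (Suc t) (z (n @ [\<theta>])) (z n) \<theta> + q (Suc (Suc t)) (z (n @ [\<theta>])))) * node_prob n)" for t
    unfolding c_def e_def sum_nodes_Suc sum.distrib[symmetric] sum_distrib_right
    by (intro sum.cong refl) (simp add: node_prob_simps length_node algebra_simps)
  have q: "q (Suc t) (z n) = (\<Sum>\<theta>\<in>support P (Suc t). noise_prob P (Suc t) \<theta> * sval (Suc t) \<theta> (q (Suc (Suc t))) (z n))"
    if "t < T" "n \<in> nodes P t" for t n
    using q_eq[of "Suc t" "z n"] feasible_tree_in_D[OF z _ that(2)] that(1) by simp
  have step: "e t \<le> c (Suc t) + e (Suc t)" if t: "t < T" for t
    unfolding ce unfolding e_def
  proof (intro sum_mono mult_right_mono)
    fix n assume n: "n \<in> nodes P t"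
    show "0 \<le> node_prob n" using node_prob_pos[OF n] t by simp
    have zn: "z n \<in> D (Suc t - 1)" using feasible_tree_in_D[OF z _ n] t by simp
    have cont: "continuous_on (D (Suc t)) (q (Suc (Suc t)))" using q_continuous t by simp
    show "q (Suc t) (z n) \<le> (\<Sum>\<theta>\<in>support P (Suc t). noise_prob P (Suc t) \<theta> *
      (cost P (Suc t) (z (n @ [\<theta>])) (z n) \<theta> + q (Suc (Suc t)) (z (n @ [\<theta>]))))"
      unfolding q[OF t n]
    proof (intro sum_mono mult_left_mono noise_prob_nonneg)
      fix \<theta> assume \<theta>: "\<theta> \<in> support P (Suc t)"
      have "z (n @ [\<theta>]) \<in> feas P (Suc t) (z n) \<theta>" using z t n \<theta> by (simp add: feasible_tree_def)
      then show "sval (Suc t) \<theta> (q (Suc (Suc t))) (z n)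
          \<le> cost P (Suc t) (z (n @ [\<theta>])) (z n) \<theta> + q (Suc (Suc t)) (z (n @ [\<theta>]))"
        using sval_le[OF _ \<theta> cont zn] t by simp
    qed
  qed
  have eq_step: "c (Suc t) + e (Suc t) \<le> e t" if opt: "optimal_tree z" and t: "t < T" for t
    unfolding ce unfolding e_def
  proof (intro sum_mono mult_right_mono)
    fix n assume n: "n \<in> nodes P t"
    show "0 \<le> node_prob n" using node_prob_pos[OF n] t by simp
    show "(\<Sum>\<theta>\<in>support P (Suc t). noise_prob P (Suc t) \<theta> *
      (cost P (Suc t) (z (n @ [\<theta>])) (z n) \<theta> + q (Suc (Suc t)) (z (n @ [\<theta>])))) \<le> q (Suc t) (z n)"
      unfolding q[OF t n] using opt t n unfolding optimal_tree_def
      by (intro sum_mono mult_left_mono noise_prob_nonneg) blast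
  qed
  have e0: "e 0 = q 1 (x_init P)"
    using z by (simp add: e_def nodes_0 node_prob_simps feasible_tree_def)
  have eT: "e T = 0" by (simp add: e_def q_end)
  have tc: "tree_cost z = (\<Sum>t=1..T. c t)" by (simp add: tree_cost_def c_def)
  have ge: "e 0 \<le> (\<Sum>t=1..s. c t) + e s" if "s \<le> T" for s
    using that
  proof (induction s)
    case (Suc s)
    then show ?case using step[of s] by simp
  qed simp
  have le: "(\<Sum>t=1..s. c t) + e s \<le> e 0" if "optimal_tree z" "s \<le> T" for s
    using that(2)
  proof (induction s)
    case (Suc s)
    then show ?case using eq_step[OF that(1), of s] by simp
  qed simp
  show "q 1 (x_init P) \<le> tree_cost z" using ge[of T] e0 eT tc by simp
  show "tree_cost z = q 1 (x_init P)" if "optimal_tree z"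
    using ge[of T] le[OF that, of T] e0 eT tc by simp
qed

text \<open>Choose a minimizer of the stage problem successively along every path from the root.\<close>

lemma optimal_tree_exists: "\<exists>z. optimal_tree z"
proof -
  have "\<exists>y. y \<in> feas P t x \<theta> \<and> cost P t y x \<theta> + q (Suc t) y \<le> sval t \<theta> (q (Suc t)) x"
    if "t \<in> {1..T}" "x \<in> D (t - 1)" "\<theta> \<in> support P t" for t x \<theta>
    using sval_attained[OF that(1,3) _ that(2), of "q (Suc t)"] q_continuous[of t] that(1) by fastforce
  then obtain sel where sel: "\<And>t x \<theta>. t \<in> {1..T} \<Longrightarrow> x \<in> D (t - 1) \<Longrightarrow> \<theta> \<in> support P t \<Longrightarrow>
      sel t x \<theta> \<in> feas P t x \<theta> \<and> cost P t (sel t x \<theta>) x \<theta> + q (Suc t) (sel t x \<theta>) \<le> sval t \<theta> (q (Suc t)) x"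
    by metis
  define w where "w = rec_list (x_init P) (\<lambda>\<theta> ts x. sel (Suc (length ts)) x \<theta>)"
  define z where "z n = w (rev n)" for n
  have z: "z [] = x_init P" "z (n @ [\<theta>]) = sel (Suc (length n)) (z n) \<theta>" for n \<theta>
    by (simp_all add: z_def w_def)
  have D: "z n \<in> D t" if "t \<le> T" "n \<in> nodes P t" for t n
    using that
  proof (induction t arbitrary: n)
    case 0
    then show ?case by (simp add: nodes_0 z D_0)
  next
    case (Suc t)
    then obtain n' \<theta> where n: "n = n' @ [\<theta>]" "n' \<in> nodes P t" "\<theta> \<in> support P (Suc t)"
      by (auto simp: nodes_Suc)
    then have "z n \<in> feas P (Suc t) (z n') \<theta>"
      using sel[of "Suc t" "z n'" \<theta>] Suc by (simp add: z length_node)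
    then show ?case using feas_subset by blast
  qed
  have "z (n @ [\<theta>]) \<in> feas P (Suc t) (z n) \<theta> \<and>
     cost P (Suc t) (z (n @ [\<theta>])) (z n) \<theta> + q (Suc (Suc t)) (z (n @ [\<theta>]))
       \<le> sval (Suc t) \<theta> (q (Suc (Suc t))) (z n)"
    if "t < T" "n \<in> nodes P t" "\<theta> \<in> support P (Suc t)" for t n \<theta>
    using sel[of "Suc t" "z n" \<theta>] D[of t n] that by (simp add: z length_node)
  then have "optimal_tree z" by (simp add: optimal_tree_def feasible_tree_def z)
  then show ?thesis by blast
qed

text \<open>
  Almost surely the integrand is a combination of the indicators of the events that the history is a
  given node.
\<close>

lemma sp_objective_tree:
  assumes x: "\<And>t. t \<le> T \<Longrightarrow> AE s in pspace P. x t s = z (hist t s)"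
  shows "sp_objective P x = tree_cost z"
proof -
  let ?M = "pspace P"
  define f where "f s = (\<Sum>t=1..T. cost P t (x t s) (x (t - 1) s) (noise P t s))" for s
  define ev where "ev t m = {s \<in> space ?M. hist t s = m}" for t m
  define c where "c t m = cost P t (z m) (z (butlast m)) (last m)" for t m
  define g where "g s = (\<Sum>t=1..T. \<Sum>m\<in>nodes P t. c t m * indicator (ev t m) s)" for s :: 's
  have ev: "ev t m \<in> sets ?M" "pr.prob (ev t m) = node_prob m" if "t \<in> {1..T}" "m \<in> nodes P t" for t m
    using hist_event[of m t] that by (auto simp: ev_def length_node)
  have int: "integrable ?M (\<lambda>s. c t m * indicator (ev t m) s)" if "t \<in> {1..T}" "m \<in> nodes P t" for t m
    using ev(1)[OF that] by (intro integrable_mult_right integrable_real_indicator)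
      (auto simp: pr.emeasure_eq_measure)
  have int_g: "integral\<^sup>L ?M g = tree_cost z" "integrable ?M g"
  proof -
    have "integral\<^sup>L ?M g = (\<Sum>t=1..T. \<Sum>m\<in>nodes P t. c t m * pr.prob (ev t m))"
      unfolding g_def using int ev
      by (subst Bochner_Integration.integral_sum, force intro!: Bochner_Integration.integrable_sum,
          intro sum.cong refl, subst Bochner_Integration.integral_sum) (auto simp: sets.Int_space_eq2)
    also have "\<dots> = tree_cost z"
      unfolding tree_cost_def c_def using ev(2) by (intro sum.cong) auto
    finally show "integral\<^sup>L ?M g = tree_cost z" .
    show "integrable ?M g"
      unfolding g_def using int by (intro Bochner_Integration.integrable_sum) auto
  qed
  have AE: "AE s in ?M. f s = g s"
  proof -
    have "AE s in ?M. \<forall>t\<in>{..T}. x t s = z (hist t s) \<and> hist t s \<in> nodes P t"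
      using x AE_hist by (intro AE_finite_allI AE_conjI) auto
    then show ?thesis using AE_space
    proof eventually_elim
      case (elim s)
      show ?case
        unfolding f_def g_def
      proof (intro sum.cong refl)
        fix t assume t: "t \<in> {1..T}"
        define i where "i = t - 1"
        have i: "t = Suc i" using t by (simp add: i_def)
        have h: "hist t s \<in> nodes P t" "x t s = z (hist t s)" "x i s = z (hist i s)"
          using elim(1) t i by auto
        have "(\<Sum>m\<in>nodes P t. c t m * indicator (ev t m) s) = (\<Sum>m\<in>nodes P t. if m = hist t s then c t (hist t s) else 0)"
          using elim(2) by (intro sum.cong) (auto simp: ev_def indicator_def)
        also have "\<dots> = c t (hist t s)" using h(1) finite_nodes[of t] t by simp
        finally show "cost P t (x t s) (x (t - 1) s) (noise P t s) = (\<Sum>m\<in>nodes P t. c t m * indicator (ev t m) s)"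
          using h(2,3) i by (simp add: c_def hist_simps)
      qed
    qed
  qed
  have g_meas: "g \<in> borel_measurable ?M" using int_g(2) by (rule borel_measurable_integrable)
  have AEc: "AE s in completion ?M. g s = f s"
    by (rule AE_completion) (use AE in \<open>eventually_elim, simp\<close>)
  \<comment> \<open>On the null set where the noise leaves its support, \<open>f\<close> is arbitrary; every subset of a null
    set is measurable for the completion.\<close>
  have f_meas: "f \<in> borel_measurable (completion ?M)"
  proof (rule measurableI)
    fix S :: "real set" assume S: "S \<in> sets borel"
    let ?N = "{s \<in> space (completion ?M). \<not> g s = f s}"
    have N: "?N \<in> null_sets (completion ?M)" using AEc by (simp only: completion.AE_iff_null_sets)
    then have "f -` S \<inter> ?N \<in> null_sets (completion ?M)"
      by (rule completion.complete2[rotated]) auto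
    moreover have "g -` S \<inter> space (completion ?M) \<in> sets (completion ?M)"
      using measurable_sets[OF measurable_completion[OF g_meas] S] .
    ultimately have "(g -` S \<inter> space (completion ?M) - ?N) \<union> (f -` S \<inter> ?N) \<in> sets (completion ?M)"
      using N by (intro sets.Un sets.Diff) (auto dest: null_setsD2)
    also have "(g -` S \<inter> space (completion ?M) - ?N) \<union> (f -` S \<inter> ?N) = f -` S \<inter> space (completion ?M)"
      by auto
    finally show "f -` S \<inter> space (completion ?M) \<in> sets (completion ?M)" .
  qed simp
  have "sp_objective P x = integral\<^sup>L (completion ?M) f"
    unfolding sp_objective_def f_def[abs_def] ..
  also have "\<dots> = integral\<^sup>L (completion ?M) g"
    by (rule integral_cong_AE[OF f_meas measurable_completion[OF g_meas]]) (use AEc in \<open>eventually_elim, simp\<close>)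
  also have "\<dots> = integral\<^sup>L ?M g" by (rule integral_completion[OF g_meas])
  finally show ?thesis using int_g(1) by simp
qed

lemma tree_policy_hist:
  assumes "t \<le> T"
  shows "AE s in pspace P. tree_policy P z t s = z (hist t s)"
  using AE_hist[OF assms] by eventually_elim (simp add: tree_policy_def hist_def del: upt_Suc)

lemma sp_feasible_tree_policy:
  assumes z: "feasible_tree z"
  shows "sp_feasible P (tree_policy P z)"
  unfolding sp_feasible_def
proof (intro conjI ballI)
  show "tree_policy P z 0 s = x_init P" for s
    using z by (simp add: tree_policy_def nodes_0 feasible_tree_def)
  fix t assume t: "t \<in> {1..T}"
  define i where "i = t - 1"
  have i: "t = Suc i" using t by (simp add: i_def)
  have space: "space (filt P t) = space (pspace P)" by (simp add: filt_def space_measure_of_conv)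
  have fin: "finite (nodes P t)" using finite_nodes t by simp
  have eq: "tree_policy P z t s = (\<Sum>m\<in>nodes P t. indicator {s \<in> space (pspace P). hist t s = m} s *\<^sub>R z m)"
    if "s \<in> space (filt P t)" for s
  proof -
    have "(\<Sum>m\<in>nodes P t. indicator {s \<in> space (pspace P). hist t s = m} s *\<^sub>R z m)
        = (\<Sum>m\<in>nodes P t. if m = hist t s then z (hist t s) else 0)"
      using that space by (intro sum.cong) (auto simp: indicator_def)
    then show ?thesis using fin by (simp add: tree_policy_def hist_def del: upt_Suc)
  qed
  show "tree_policy P z t \<in> borel_measurable (filt P t)"
  proof (subst measurable_cong[OF eq])
    show "(\<lambda>s. \<Sum>m\<in>nodes P t. indicator {s \<in> space (pspace P). hist t s = m} s *\<^sub>R z m)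
        \<in> borel_measurable (filt P t)"
    proof (intro borel_measurable_sum borel_measurable_scaleR borel_measurable_const borel_measurable_indicator)
      show "{s \<in> space (pspace P). hist t s = m} \<in> sets (filt P t)" if "m \<in> nodes P t" for m
        using hist_filt_event[of m t] that t by (simp add: length_node)
    qed
  qed
  have "AE s in pspace P. tree_policy P z t s = z (hist t s)" "AE s in pspace P. tree_policy P z i s = z (hist i s)"
    "AE s in pspace P. hist i s \<in> nodes P i" "AE s in pspace P. noise P t s \<in> support P t"
    using tree_policy_hist AE_hist support_facts(2)[of t] t i by auto
  then show "AE s in pspace P. tree_policy P z t s \<in> feas P t (tree_policy P z (t - 1) s) (noise P t s)"
  proof eventually_elim
    case (elim s)
    then show ?case using z t unfolding feasible_tree_def i by (simp add: hist_simps)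
  qed
qed

text \<open>
  The decision at a node is the value of the policy on the corresponding history. It is feasible
  because every node has positive probability, so an almost sure constraint holds somewhere on it.
\<close>

lemma sp_feasible_obtains_tree:
  assumes x: "sp_feasible P x"
  shows "\<exists>z. feasible_tree z \<and> (\<forall>t\<le>T. \<forall>s\<in>space (pspace P). x t s = z (hist t s))"
proof -
  define z where "z m = x (length m) (SOME s. s \<in> space (pspace P) \<and> hist (length m) s = m)" for m
  have xz: "x t s = z (hist t s)" if t: "t \<le> T" and s: "s \<in> space (pspace P)" for t s
  proof -
    define s' where "s' = (SOME s'. s' \<in> space (pspace P) \<and> hist t s' = hist t s)"
    have s': "s' \<in> space (pspace P) \<and> hist t s' = hist t s"
      unfolding s'_def by (rule someI[of _ s]) (simp add: s)
    have "x t s = x t s'"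
    proof (cases "t = 0")
      case True
      then show ?thesis using x s s' by (simp add: sp_feasible_def)
    next
      case False
      then have "x t \<in> borel_measurable (filt P t)" using x t by (simp add: sp_feasible_def)
      then show ?thesis using filt_measurable_hist s s' by metis
    qed
    then show ?thesis by (simp add: z_def length_hist s'_def)
  qed
  obtain s0 where s0: "s0 \<in> space (pspace P)" using pr.not_empty by blast
  have "z [] = x_init P" using xz[of 0 s0] x s0 by (simp add: hist_simps sp_feasible_def)
  moreover have "z (n @ [\<theta>]) \<in> feas P (Suc t) (z n) \<theta>"
    if t: "t < T" and n: "n \<in> nodes P t" and \<theta>: "\<theta> \<in> support P (Suc t)" for t n \<theta>
  proof -
    let ?A = "{s \<in> space (pspace P). hist (Suc t) s = n @ [\<theta>]}"
    have m: "n @ [\<theta>] \<in> nodes P (Suc t)" using child_node[OF n \<theta>] .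
    have A: "?A \<in> sets (pspace P)" "0 < pr.prob ?A"
      using hist_event[of "n @ [\<theta>]" "Suc t"] node_prob_pos[OF m] length_node[OF n] t by auto
    have AE: "AE s in pspace P. x (Suc t) s \<in> feas P (Suc t) (x t s) (noise P (Suc t) s)"
    proof -
      have "Suc t \<in> {1..T}" using t by simp
      then have "AE s in pspace P. x (Suc t) s \<in> feas P (Suc t) (x (Suc t - 1) s) (noise P (Suc t) s)"
        using x unfolding sp_feasible_def by blast
      then show ?thesis by simp
    qed
    have "\<exists>s\<in>?A. x (Suc t) s \<in> feas P (Suc t) (x t s) (noise P (Suc t) s)"
    proof (rule ccontr)
      assume "\<not> ?thesis"
      then have "s \<notin> ?A" if "x (Suc t) s \<in> feas P (Suc t) (x t s) (noise P (Suc t) s)" for s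
        using that by blast
      with AE have "AE s in pspace P. s \<notin> ?A" by (rule eventually_mono)
      then have "pr.prob ?A = 0" using A(1) by (simp add: pr.prob_eq_0)
      then show False using A(2) by simp
    qed
    then obtain s where s: "s \<in> space (pspace P)" "hist (Suc t) s = n @ [\<theta>]"
      "x (Suc t) s \<in> feas P (Suc t) (x t s) (noise P (Suc t) s)" by blast
    then show ?thesis using xz[of t s] xz[of "Suc t" s] t by (simp add: hist_simps)
  qed
  ultimately show ?thesis using xz unfolding feasible_tree_def by blast
qed

lemma sp_objective_ge:
  assumes "sp_feasible P x"
  shows "q 1 (x_init P) \<le> sp_objective P x"
proof -
  obtain z where z: "feasible_tree z" "\<forall>t\<le>T. \<forall>s\<in>space (pspace P). x t s = z (hist t s)"
    using sp_feasible_obtains_tree[OF assms] by blast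
  then have "sp_objective P x = tree_cost z" by (intro sp_objective_tree AE_I2) auto
  then show ?thesis using tree_cost_bounds(1)[OF z(1)] by simp
qed

lemma sp_objective_optimal_tree:
  assumes "optimal_tree z"
  shows "sp_feasible P (tree_policy P z)" "sp_objective P (tree_policy P z) = q 1 (x_init P)"
proof -
  have f: "feasible_tree z" using assms by (simp add: optimal_tree_def)
  show "sp_feasible P (tree_policy P z)" by (rule sp_feasible_tree_policy[OF f])
  show "sp_objective P (tree_policy P z) = q 1 (x_init P)"
    using sp_objective_tree[of "tree_policy P z" z, OF tree_policy_hist] tree_cost_bounds(2)[OF f assms] by simp
qed

lemma sp_optimal_tree_policy: "optimal_tree z \<Longrightarrow> sp_optimal P (tree_policy P z)"
  unfolding sp_optimal_def using sp_objective_optimal_tree sp_objective_ge by simp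

lemma sp_value_eq: "sp_value P = first_stage_value P"
proof (rule antisym)
  obtain z where z: "optimal_tree z" using optimal_tree_exists by blast
  show "sp_value P \<le> first_stage_value P"
    unfolding sp_value_def first_stage_value_eq(1)
    by (rule INF_lower2[of "tree_policy P z"]) (simp_all add: sp_objective_optimal_tree[OF z])
  show "first_stage_value P \<le> sp_value P"
    unfolding sp_value_def first_stage_value_eq(1) by (intro INF_greatest) (use sp_objective_ge in simp)
qed

end

section \<open>One run of the algorithm\<close>

locale regular_run = regular_msp P for P :: "('n::finite, 'q::finite, 'p::finite, 'k::finite, 's) msp" +
  fixes eps :: "nat \<Rightarrow> nat \<Rightarrow> real" and \<omega> :: "nat \<Rightarrow> nat \<Rightarrow> real^'k" and r :: "('n, 'q, 'p, 'k) run"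
  assumes eps_nonneg: "\<And>t k. t \<in> {1..horizon P} \<Longrightarrow> 1 \<le> k \<Longrightarrow> 0 \<le> eps t k"
    and eps_lim: "\<And>t. t \<in> {1..horizon P} \<Longrightarrow> (\<lambda>k. eps t k) \<longlonglongrightarrow> 0"
    and run: "isddp_run P eps \<omega> r"
    and scenario_range: "\<And>k. 1 \<le> k \<Longrightarrow> \<omega> k \<in> (\<Pi>\<^sub>E t\<in>{2..horizon P}. Theta P t)"
begin

abbreviation lagr_at where
  "lagr_at t \<theta> \<equiv> convex_stage.lagr (cost_fn t \<theta>) (ineq_fn t \<theta>) (A_mat t \<theta>) (B_mat t \<theta>) (b_vec t \<theta>)"
abbreviation grad_y_at where
  "grad_y_at t \<theta> \<equiv> convex_stage.grad_y (cost_fn t \<theta>) (ineq_fn t \<theta>) (A_mat t \<theta>)"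
abbreviation grad_x_at where
  "grad_x_at t \<theta> \<equiv> convex_stage.grad_x (cost_fn t \<theta>) (ineq_fn t \<theta>) (B_mat t \<theta>)"
abbreviation range_at where
  "range_at t \<theta> \<equiv> slater_stage.res_range (D t) (A_mat t \<theta>) (B_mat t \<theta>) (b_vec t \<theta>)"

definition v :: "nat \<Rightarrow> nat \<Rightarrow> real^'n \<Rightarrow> real" where
  "v k t x = real_of_ereal (Qapp r k t x)"

abbreviation sampled :: "nat \<Rightarrow> nat \<Rightarrow> (real^'k) list" where
  "sampled k t \<equiv> sampled_node P (\<omega> k) t"

text \<open>
  The cut of stage \<open>t\<close> at iteration \<open>k\<close> is built at the node \<open>snode k t\<close> of stage \<open>t - 1\<close>, around the
  trial decision \<open>trial k t\<close>, from one contribution for each realization \<open>\<theta>\<close> of stage \<open>t\<close>.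
\<close>

abbreviation snode where "snode k t \<equiv> sampled k (t - 1)"
abbreviation trial where "trial k t \<equiv> fwd r k (snode k t)"
abbreviation ch_theta where "ch_theta k t \<theta> \<equiv> theta_m P r k t (snode k t) (snode k t @ [\<theta>])"
abbreviation ch_eta where "ch_eta k t \<theta> \<equiv> eta_m P r k t (snode k t) (snode k t @ [\<theta>])"
abbreviation ch_beta where "ch_beta k t \<theta> \<equiv> beta_m P r k t (snode k t) (snode k t @ [\<theta>])"

definition child_data :: "nat \<Rightarrow> nat \<Rightarrow> real^'k \<Rightarrow> real^'n \<Rightarrow> real^'q \<Rightarrow> real^'p \<Rightarrow> bool" where
  "child_data k t \<theta> y l u \<longleftrightarrow> (let x = trial k t; V = v k (Suc t) in
    l \<in> range_at t \<theta> x \<and> (\<forall>i. 0 \<le> u $ i) \<and>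
    (\<forall>z\<in>D t. sval t \<theta> V x - eps t k \<le> lagr_at t \<theta> V x l u z) \<and>
    y \<in> feas P t x \<theta> \<and> cost P t y x \<theta> + V y \<le> sval t \<theta> V x + eps t k \<and>
    ch_theta k t \<theta> = ereal (cost_fn t \<theta> (y, x) + V y + (\<Sum>i\<in>UNIV. u $ i * ineq_fn t \<theta> i (y, x))) \<and>
    ch_beta k t \<theta> = grad_x_at t \<theta> y x l u \<and>
    ch_eta k t \<theta> = (SUP z\<in>D t. ereal (grad_y_at t \<theta> y x l u \<bullet> (y - z) + V y - V z)))"

lemma sampled_in_nodes:
  assumes "1 \<le> k" "1 \<le> t" "t \<le> T"
  shows "sampled k t \<in> nodes P t"
proof -
  have len: "length (sampled k t) = t" using assms(2) by (simp add: sampled_node_def del: upt_Suc)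
  have "sampled k t ! j \<in> support P (Suc j)" if "j < t" for j
  proof (cases j)
    case 0
    then show ?thesis using support_one by (simp add: sampled_node_def)
  next
    case (Suc i)
    then have "sampled k t ! j = \<omega> k (Suc j)" using that by (simp add: sampled_node_def del: upt_Suc)
    moreover have "Suc j \<in> {2..T}" using Suc that assms by auto
    ultimately show ?thesis using PiE_mem[OF scenario_range[OF assms(1)]] by (simp add: support_def)
  qed
  then show ?thesis using len by (simp add: nodes_def)
qed

lemma forward:
  assumes "1 \<le> k" "t < T" "n \<in> nodes P t" "\<theta> \<in> support P (Suc t)"
  shows "eps_min (eps (Suc t) k) (\<lambda>y. stage_obj P (Suc t) (Qapp r (k - 1) (Suc (Suc t))) y (fwd r k n) \<theta>)
     (feas P (Suc t) (fwd r k n) \<theta>) (fwd r k (n @ [\<theta>]))"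
proof -
  have "n @ [\<theta>] \<in> children P n" using assms by (simp add: children_eq)
  moreover have "Suc t \<in> {1..T}" using assms by simp
  ultimately show ?thesis
    using run assms(1,3) unfolding isddp_run_def forward_pass_def by fastforce
qed

lemma fwd_root: "1 \<le> k \<Longrightarrow> fwd r k [] = x_init P"
  using run unfolding isddp_run_def forward_pass_def by blast

lemma fwd_feasible:
  "1 \<le> k \<Longrightarrow> t < T \<Longrightarrow> n \<in> nodes P t \<Longrightarrow> \<theta> \<in> support P (Suc t) \<Longrightarrow>
    fwd r k (n @ [\<theta>]) \<in> feas P (Suc t) (fwd r k n) \<theta>"
  using forward unfolding eps_min_def by blast

lemma fwd_in_D:
  assumes "1 \<le> k" "t \<le> T" "n \<in> nodes P t"
  shows "fwd r k n \<in> D t"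
proof (cases t)
  case 0
  then show ?thesis using assms by (simp add: nodes_0 D_0 fwd_root)
next
  case (Suc i)
  then obtain n' \<theta> where "n = n' @ [\<theta>]" "n' \<in> nodes P i" "\<theta> \<in> support P (Suc i)"
    using assms(3) by (auto simp: nodes_Suc)
  then show ?thesis using fwd_feasible[of k i n' \<theta>] feas_subset Suc assms by fastforce
qed

lemma trial_in_D: "1 \<le> k \<Longrightarrow> t \<in> {2..T} \<Longrightarrow> trial k t \<in> D (t - 1)"
  using sampled_in_nodes[of k "t - 1"] fwd_in_D[of k "t - 1"] by fastforce

lemma eps_bounded:
  assumes "t \<in> {1..T}"
  shows "\<exists>E\<ge>0. \<forall>k. eps t k \<le> E"
proof -
  have "Bseq (eps t)" using eps_lim[OF assms] by (intro convergent_imp_Bseq convergentI)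
  then obtain E where "0 < E" "\<forall>k. norm (eps t k) \<le> E" by (auto simp: Bseq_def)
  then show ?thesis by (intro exI[of _ E]) (auto intro: order_trans[OF abs_ge_self])
qed

lemma backward:
  assumes "1 \<le> k" "t \<in> {2..T}" "\<theta> \<in> support P t"
  defines "n \<equiv> sampled k (t - 1)"
  shows "eps_min (eps t k) (\<lambda>y. stage_obj P t (Qapp r k (Suc t)) y (fwd r k n) \<theta>)
      (feas P t (fwd r k n) \<theta>) (bwd r k (n @ [\<theta>]))"
    and "ctype P t = S2 \<Longrightarrow> eps_max (eps t k) (dual_fun P t (Qapp r k (Suc t)) (fwd r k n) \<theta>)
      (dual_feas P t (fwd r k n) \<theta>) (lam r k (n @ [\<theta>]), mu r k (n @ [\<theta>]))"
    and "Qapp r k t = (\<lambda>z. max (Qapp r (k - 1) t z) (cut P r k t n z))"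
proof -
  have "n \<in> nodes P (t - 1)" unfolding n_def using sampled_in_nodes assms(1,2) by auto
  then have c: "n @ [\<theta>] \<in> children P n" using assms by (simp add: children_eq)
  have b: "backward_pass P eps (\<omega> k) r k" using run assms(1) unfolding isddp_run_def by blast
  note * = bspec[OF b[unfolded backward_pass_def] assms(2), folded n_def, unfolded Let_def]
  show "Qapp r k t = (\<lambda>z. max (Qapp r (k - 1) t z) (cut P r k t n z))"
    using * by blast
  show "eps_min (eps t k) (\<lambda>y. stage_obj P t (Qapp r k (Suc t)) y (fwd r k n) \<theta>)
      (feas P t (fwd r k n) \<theta>) (bwd r k (n @ [\<theta>]))"
    using * c by fastforce
  show "eps_max (eps t k) (dual_fun P t (Qapp r k (Suc t)) (fwd r k n) \<theta>)
      (dual_feas P t (fwd r k n) \<theta>) (lam r k (n @ [\<theta>]), mu r k (n @ [\<theta>]))" if "ctype P t = S2"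
    using * c that by fastforce
qed

text \<open>
  What the backward pass provides at a child of the sampled node, in terms of the stage in normal
  form. For a stage of type S1 the multipliers are zero.
\<close>

lemma child_multipliers:
  assumes k: "1 \<le> k" and t: "t \<in> {2..T}" and \<theta>: "\<theta> \<in> support P t"
    and Q: "\<And>z. Qapp r k (Suc t) z = ereal (v k (Suc t) z)" and V: "convex_on UNIV (v k (Suc t))"
  shows "\<exists>y l u. child_data k t \<theta> y l u"
proof -
  have t1: "t \<in> {1..T}" using t by auto
  obtain \<rho> \<kappa> where "slater_stage (D t) (D (t - 1)) (cost_fn t \<theta>) (ineq_fn t \<theta>)
      (A_mat t \<theta>) (B_mat t \<theta>) (b_vec t \<theta>) \<rho> \<kappa>"
    using stage_slater[OF t] \<theta> by blast
  then interpret st: slater_stage "D t" "D (t - 1)" "cost_fn t \<theta>" "ineq_fn t \<theta>"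
      "A_mat t \<theta>" "B_mat t \<theta>" "b_vec t \<theta>" \<rho> \<kappa> .
  define n where "n = snode k t"
  define x where "x = fwd r k n"
  define y where "y = bwd r k (n @ [\<theta>])"
  define V where "V = v k (Suc t)"
  note Q = Q[folded V_def] and V = V[folded V_def]
  have x: "x \<in> D (t - 1)" unfolding x_def n_def by (rule trial_in_D[OF k t])
  have Vc: "continuous_on (D t) V"
    using convex_on_continuous[OF open_UNIV V] continuous_on_subset by blast
  have VX: "convex_on (D t) V" using convex_on_subset[OF V] st.X_convex by blast
  have obj: "stage_obj P t (Qapp r k (Suc t)) z w \<theta> = ereal (cost P t z w \<theta> + V z)" for z w
    by (simp add: stage_obj_def Q)
  have sv: "(INF z\<in>feas P t x \<theta>. stage_obj P t (Qapp r k (Suc t)) z x \<theta>) = ereal (sval t \<theta> V x)"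
    using stage_val_eq[OF t1 \<theta> Vc x, of "Qapp r k (Suc t)"] Q by (simp add: stage_val_def)
  have em: "eps_min (eps t k) (\<lambda>y. stage_obj P t (Qapp r k (Suc t)) y x \<theta>) (feas P t x \<theta>) y"
    using backward(1)[OF k t \<theta>] unfolding x_def y_def n_def .
  have y: "y \<in> feas P t x \<theta>" using em by (simp add: eps_min_def)
  have y_opt: "cost P t y x \<theta> + V y \<le> sval t \<theta> V x + eps t k"
    using em unfolding eps_min_def sv unfolding obj by simp
  show ?thesis
  proof (cases "ctype P t = S2")
    case S2: True
    define l where "l = lam r k (n @ [\<theta>])"
    define u where "u = mu r k (n @ [\<theta>])"
    have ex: "eps_max (eps t k) (dual_fun P t (Qapp r k (Suc t)) x \<theta>) (dual_feas P t x \<theta>) (l, u)"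
      using backward(2)[OF k t \<theta> S2] unfolding x_def l_def u_def n_def .
    have res: "eq_res P t z x \<theta> = st.res z x" for z
      unfolding st.res_def eq_res_def using S2 by (simp add: A_mat_def B_mat_def b_vec_def)
    have df: "dual_feas P t x \<theta> = st.res_range x \<times> {u. \<forall>i. 0 \<le> u $ i}"
      by (simp add: dual_feas_def st.res_range_def res)
    have dual: "dual_fun P t (Qapp r k (Suc t)) x \<theta> (l', u') = (INF z\<in>D t. ereal (st.lagr V x l' u' z))" for l' u'
      unfolding dual_fun_def obj st.lagr_def res
      using S2 by (simp add: cost_fn_def ineq_fn_def inner_vec_def[of u'] add.assoc)
    have lu: "l \<in> st.res_range x" "\<forall>i. 0 \<le> u $ i"
      using ex unfolding eps_max_def df by auto
    obtain l0 u0 where lu0: "l0 \<in> st.res_range x" "\<forall>i. 0 \<le> u0 $ i" "\<forall>z\<in>D t. st.val V x \<le> st.lagr V x l0 u0 z"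
      using st.strong_duality[OF VX Vc x] by blast
    have "ereal (sval t \<theta> V x) \<le> dual_fun P t (Qapp r k (Suc t)) x \<theta> (l0, u0)"
      unfolding dual using lu0(3) sval_eq[OF t1 \<theta>] by (intro INF_greatest) simp
    also have "\<dots> \<le> (SUP z\<in>dual_feas P t x \<theta>. dual_fun P t (Qapp r k (Suc t)) x \<theta> z)"
      by (rule SUP_upper) (use lu0 df in simp)
    finally have "ereal (sval t \<theta> V x) - ereal (eps t k) \<le>
        (SUP z\<in>dual_feas P t x \<theta>. dual_fun P t (Qapp r k (Suc t)) x \<theta> z) - ereal (eps t k)"
      by (intro ereal_minus_mono) auto
    also have "\<dots> \<le> dual_fun P t (Qapp r k (Suc t)) x \<theta> (l, u)"
      using ex unfolding eps_max_def by blast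
    finally have "ereal (sval t \<theta> V x - eps t k) \<le> (INF z\<in>D t. ereal (st.lagr V x l u z))"
      unfolding dual by simp
    then have low: "sval t \<theta> V x - eps t k \<le> st.lagr V x l u z" if "z \<in> D t" for z
      using INF_lower[OF that, of "\<lambda>z. ereal (st.lagr V x l u z)"] by (meson ereal_less_eq(3) order_trans)
    have th: "theta_m P r k t n (n @ [\<theta>])
        = ereal (cost_fn t \<theta> (y, x) + V y + (\<Sum>i\<in>UNIV. u $ i * ineq_fn t \<theta> i (y, x)))"
      unfolding theta_m_def Let_def x_def[symmetric] y_def[symmetric] u_def[symmetric] Q
      using S2 by (simp add: cost_fn_def ineq_fn_def inner_vec_def)
    have be: "beta_m P r k t n (n @ [\<theta>]) = st.grad_x y x l u"
      unfolding beta_m_def Let_def x_def[symmetric] y_def[symmetric] u_def[symmetric] l_def[symmetric] st.grad_x_def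
      using S2 by (simp add: cost_fn_def ineq_fn_def B_mat_def)
    have et: "eta_m P r k t n (n @ [\<theta>]) = (SUP z\<in>D t. ereal (st.grad_y y x l u \<bullet> (y - z) + V y - V z))"
      unfolding eta_m_def Let_def x_def[symmetric] y_def[symmetric] u_def[symmetric] l_def[symmetric] st.grad_y_def Q
      using S2 by (simp add: cost_fn_def ineq_fn_def A_mat_def)
    show ?thesis
      using lu low y y_opt th be et
      unfolding child_data_def Let_def n_def[symmetric] x_def[symmetric] V_def[symmetric] by blast
  next
    case False
    then have S1: "ctype P t = S1" by (cases "ctype P t") auto
    have l: "0 \<in> st.res_range x" using st.res_range_subspace(1)[OF x] by (rule subspace_0)
    have "feas P t x \<theta> = D t" using S1 by (simp add: feas_def)
    then have low: "sval t \<theta> V x - eps t k \<le> st.lagr V x 0 0 z" if "z \<in> D t" for z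
      using sval_le[OF t1 \<theta> Vc x, of z] that eps_nonneg[OF t1 k]
      unfolding st.lagr_def by (simp add: cost_fn_def)
    have th: "theta_m P r k t n (n @ [\<theta>])
        = ereal (cost_fn t \<theta> (y, x) + V y + (\<Sum>i\<in>UNIV. (0::real^'p) $ i * ineq_fn t \<theta> i (y, x)))"
      unfolding theta_m_def Let_def x_def[symmetric] y_def[symmetric] Q
      using S1 by (simp add: cost_fn_def)
    have be: "beta_m P r k t n (n @ [\<theta>]) = st.grad_x y x 0 0"
      unfolding beta_m_def Let_def x_def[symmetric] y_def[symmetric] st.grad_x_def
      using S1 by (simp add: cost_fn_def)
    have et: "eta_m P r k t n (n @ [\<theta>]) = (SUP z\<in>D t. ereal (st.grad_y y x 0 0 \<bullet> (y - z) + V y - V z))"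
      unfolding eta_m_def Let_def x_def[symmetric] y_def[symmetric] st.grad_y_def Q
      using S1 by (simp add: cost_fn_def)
    have u: "\<forall>i. 0 \<le> (0::real^'p) $ i" by simp
    show ?thesis
      using l u low y y_opt th be et
      unfolding child_data_def Let_def n_def[symmetric] x_def[symmetric] V_def[symmetric] by blast
  qed
qed

text \<open>
  The regularity of the approximations of one stage, with constants that do not depend on the
  iteration (but may depend on the run).
\<close>

definition Q_regular :: "nat \<Rightarrow> bool" where
  "Q_regular t \<longleftrightarrow> (\<exists>L M. \<forall>k\<ge>1. (\<forall>z. Qapp r k t z = ereal (v k t z)) \<and> convex_on UNIV (v k t) \<and>
     L-lipschitz_on UNIV (v k t) \<and> (\<forall>x\<in>D (t - 1). v k t x \<le> q t x \<and> \<bar>v k t x\<bar> \<le> M))"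

text \<open>
  The dual value is at least the approximate stage value minus \<open>\<epsilon>\<close>, which is bounded below uniformly in
  the iteration; this bounds the multipliers.
\<close>

lemma child_multipliers_bounded:
  assumes t: "t \<in> {2..T}" and \<theta>: "\<theta> \<in> support P t" and Q: "Q_regular (Suc t)"
  shows "\<exists>G\<ge>0. \<forall>k\<ge>1. \<exists>y l u. child_data k t \<theta> y l u \<and> norm l \<le> G \<and> (\<Sum>i\<in>UNIV. u $ i) \<le> G"
proof -
  have t1: "t \<in> {1..T}" using t by auto
  obtain \<rho> \<kappa> where "slater_stage (D t) (D (t - 1)) (cost_fn t \<theta>) (ineq_fn t \<theta>)
      (A_mat t \<theta>) (B_mat t \<theta>) (b_vec t \<theta>) \<rho> \<kappa>"
    using stage_slater[OF t] \<theta> by blast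
  then interpret st: slater_stage "D t" "D (t - 1)" "cost_fn t \<theta>" "ineq_fn t \<theta>"
      "A_mat t \<theta>" "B_mat t \<theta>" "b_vec t \<theta>" \<rho> \<kappa> .
  obtain L M where Q': "\<And>k. 1 \<le> k \<Longrightarrow> (\<forall>z. Qapp r k (Suc t) z = ereal (v k (Suc t) z)) \<and>
      convex_on UNIV (v k (Suc t)) \<and> L-lipschitz_on UNIV (v k (Suc t)) \<and>
      (\<forall>x\<in>D t. v k (Suc t) x \<le> q (Suc t) x \<and> \<bar>v k (Suc t) x\<bar> \<le> M)"
    using Q unfolding Q_regular_def by auto
  obtain E where E: "0 \<le> E" "\<forall>k. eps t k \<le> E" using eps_bounded[OF t1] by blast
  obtain C where C: "0 \<le> C" "\<forall>z\<in>D t \<times> D (t - 1). \<bar>cost_fn t \<theta> z\<bar> \<le> C"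
    using st.bounded_data by blast
  define M1 where "M1 = \<bar>M\<bar> + C + E"
  have M1: "0 \<le> M1" using E C by (simp add: M1_def)
  obtain G where G: "0 \<le> G" "\<And>V x l u. \<forall>y\<in>D t. \<bar>V y\<bar> \<le> M1 \<Longrightarrow> x \<in> D (t - 1) \<Longrightarrow> l \<in> st.res_range x \<Longrightarrow>
      \<forall>i. 0 \<le> u $ i \<Longrightarrow> \<forall>z\<in>D t. - M1 \<le> st.lagr V x l u z \<Longrightarrow> norm l \<le> G \<and> (\<Sum>i\<in>UNIV. u $ i) \<le> G"
    using st.multipliers_bounded[OF M1] by blast
  have "\<exists>y l u. child_data k t \<theta> y l u \<and> norm l \<le> G \<and> (\<Sum>i\<in>UNIV. u $ i) \<le> G" if k: "1 \<le> k" for k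
  proof -
    define x where "x = trial k t"
    define V where "V = v k (Suc t)"
    have VM: "\<bar>V z\<bar> \<le> M" if "z \<in> D t" for z using Q'[OF k] that by (simp add: V_def)
    have x: "x \<in> D (t - 1)" unfolding x_def by (rule trial_in_D[OF k t])
    have Vcx: "convex_on UNIV V" using Q'[OF k] by (simp add: V_def)
    have Vc: "continuous_on (D t) V"
      using convex_on_continuous[OF open_UNIV Vcx] continuous_on_subset by blast
    obtain y l u where d: "child_data k t \<theta> y l u"
      using child_multipliers[OF k t \<theta>] Q'[OF k] by blast
    then have lu: "l \<in> st.res_range x" "\<forall>i. 0 \<le> u $ i"
        "\<forall>z\<in>D t. sval t \<theta> V x - eps t k \<le> st.lagr V x l u z"
      unfolding child_data_def Let_def x_def[symmetric] V_def[symmetric] by blast+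
    have "- (C + M) \<le> sval t \<theta> V x"
    proof -
      obtain z where z: "z \<in> feas P t x \<theta>" "sval t \<theta> V x = cost P t z x \<theta> + V z"
        using sval_attained[OF t1 \<theta> Vc x] by blast
      then have zD: "z \<in> D t" using feas_subset by blast
      have "\<bar>cost_fn t \<theta> (z, x)\<bar> \<le> C" using C(2) zD x by blast
      then show ?thesis using VM[OF zD] z(2) by (simp add: cost_fn_def)
    qed
    then have "- M1 \<le> sval t \<theta> V x - eps t k" using spec[OF E(2), of k] unfolding M1_def by linarith
    then have low: "\<forall>z\<in>D t. - M1 \<le> st.lagr V x l u z" using lu(3) by force
    have "\<forall>z\<in>D t. \<bar>V z\<bar> \<le> M1" using VM C E unfolding M1_def by fastforce
    from G(2)[OF this x lu(1,2) low] d show ?thesis by blast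
  qed
  then show ?thesis using G(1) by blast
qed

text \<open>
  The slope is bounded because the multipliers are. The height at the trial decision is the value of the
  Lagrangian at the backward decision, hence close to the approximate stage value. The correction vanishes
  because the backward decision nearly minimizes the Lagrangian.
\<close>

lemma child_cut:
  assumes t: "t \<in> {2..T}" and \<theta>: "\<theta> \<in> support P t" and Q: "Q_regular (Suc t)"
  shows "\<exists>K\<ge>0. \<forall>k\<ge>1. \<exists>th et. ch_theta k t \<theta> = ereal th \<and> ch_eta k t \<theta> = ereal et \<and>
      norm (ch_beta k t \<theta>) \<le> K \<and> sval t \<theta> (v k (Suc t)) (trial k t) - eps t k \<le> th \<and>
      (\<forall>x\<in>D (t - 1). th - et + ch_beta k t \<theta> \<bullet> (x - trial k t) \<le> sval t \<theta> (v k (Suc t)) x)" (is ?cut)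
    and "0 < \<delta> \<Longrightarrow> \<forall>\<^sub>F k in sequentially. ch_eta k t \<theta> \<le> ereal \<delta>"
proof -
  have t1: "t \<in> {1..T}" using t by auto
  obtain \<rho> \<kappa> where "slater_stage (D t) (D (t - 1)) (cost_fn t \<theta>) (ineq_fn t \<theta>)
      (A_mat t \<theta>) (B_mat t \<theta>) (b_vec t \<theta>) \<rho> \<kappa>"
    using stage_slater[OF t] \<theta> by blast
  then interpret st: slater_stage "D t" "D (t - 1)" "cost_fn t \<theta>" "ineq_fn t \<theta>"
      "A_mat t \<theta>" "B_mat t \<theta>" "b_vec t \<theta>" \<rho> \<kappa> .
  have Vcx: "convex_on UNIV (v k (Suc t))" if "1 \<le> k" for k
    using Q that unfolding Q_regular_def by blast
  obtain G where G: "0 \<le> G" and data: "\<And>k. 1 \<le> k \<Longrightarrow>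
      \<exists>y l u. child_data k t \<theta> y l u \<and> norm l \<le> G \<and> (\<Sum>i\<in>UNIV. u $ i) \<le> G"
    using child_multipliers_bounded[OF t \<theta> Q] by blast
  \<comment> \<open>The backward decision is primal feasible and primal optimal up to \<open>\<epsilon>\<close>, the multipliers are
    dual optimal up to \<open>\<epsilon>\<close>, so together they minimize the Lagrangian up to \<open>2 \<epsilon>\<close>.\<close>
  have lagr_y: "y \<in> st.feas_set x" "y \<in> D t" "sval t \<theta> V x - eps t k \<le> th"
      "\<forall>z\<in>D t. st.lagr V x l u y \<le> st.lagr V x l u z + 2 * eps t k"
    if d: "child_data k t \<theta> y l u" and x_def: "x = trial k t" and V_def: "V = v k (Suc t)"
      and th_def: "th = cost_fn t \<theta> (y, x) + V y + (\<Sum>i\<in>UNIV. u $ i * ineq_fn t \<theta> i (y, x))"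
    for k y l u x V th
  proof -
    have low: "\<forall>z\<in>D t. sval t \<theta> V x - eps t k \<le> st.lagr V x l u z" and u: "\<forall>i. 0 \<le> u $ i"
      and y: "y \<in> feas P t x \<theta>" "cost P t y x \<theta> + V y \<le> sval t \<theta> V x + eps t k"
      using d unfolding child_data_def Let_def x_def[symmetric] V_def[symmetric] by blast+
    show yf: "y \<in> st.feas_set x" using y(1) feas_eq[OF t1 \<theta>] by simp
    then have yD: "y \<in> D t" "st.res y x = 0" "\<And>i. ineq_fn t \<theta> i (y, x) \<le> 0"
      by (auto simp: st.feas_set_def)
    show "y \<in> D t" by (rule yD(1))
    have eq: "st.lagr V x l u y = th"
      unfolding st.lagr_def yD(2) th_def by simp
    have "(\<Sum>i\<in>UNIV. u $ i * ineq_fn t \<theta> i (y, x)) \<le> 0"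
      using u yD(3) by (intro sum_nonpos mult_nonneg_nonpos) auto
    then have "th \<le> sval t \<theta> V x + eps t k"
      using y(2) unfolding th_def by (simp add: cost_fn_def)
    then show "\<forall>z\<in>D t. st.lagr V x l u y \<le> st.lagr V x l u z + 2 * eps t k"
      unfolding eq using low by force
    show "sval t \<theta> V x - eps t k \<le> th" using bspec[OF low yD(1)] unfolding eq .
  qed
  show ?cut
  proof -
    obtain K where K: "0 \<le> K" "\<And>y x l u. y \<in> D t \<Longrightarrow> x \<in> D (t - 1) \<Longrightarrow> \<forall>i. 0 \<le> u $ i \<Longrightarrow> norm l \<le> G \<Longrightarrow>
        (\<Sum>i\<in>UNIV. u $ i) \<le> G \<Longrightarrow> norm (st.grad_x y x l u) \<le> K"
      using st.grad_x_bounded[OF G] by blast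
    have "\<exists>th et. ch_theta k t \<theta> = ereal th \<and> ch_eta k t \<theta> = ereal et \<and>
      norm (ch_beta k t \<theta>) \<le> K \<and> sval t \<theta> (v k (Suc t)) (trial k t) - eps t k \<le> th \<and>
      (\<forall>x\<in>D (t - 1). th - et + ch_beta k t \<theta> \<bullet> (x - trial k t) \<le> sval t \<theta> (v k (Suc t)) x)"
      if k: "1 \<le> k" for k
    proof -
      obtain y l u where d: "child_data k t \<theta> y l u" and lu: "norm l \<le> G" "(\<Sum>i\<in>UNIV. u $ i) \<le> G"
        using data[OF k] by blast
      define x where "x = trial k t"
      define V where "V = v k (Suc t)"
      define th where "th = cost_fn t \<theta> (y, x) + V y + (\<Sum>i\<in>UNIV. u $ i * ineq_fn t \<theta> i (y, x))"
      note y = lagr_y[OF d x_def V_def th_def]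
      have eqs: "ch_theta k t \<theta> = ereal th" "ch_beta k t \<theta> = st.grad_x y x l u"
          "ch_eta k t \<theta> = (SUP z\<in>D t. ereal (st.grad_y y x l u \<bullet> (y - z) + V y - V z))"
        and u: "\<forall>i. 0 \<le> u $ i"
        using d unfolding child_data_def Let_def x_def[symmetric] V_def[symmetric] th_def by blast+
      have x: "x \<in> D (t - 1)" unfolding x_def by (rule trial_in_D[OF k t])
      have Vc: "continuous_on (D t) V"
        unfolding V_def using convex_on_continuous[OF open_UNIV Vcx[OF k]] continuous_on_subset by blast
      define h where "h z = st.grad_y y x l u \<bullet> (y - z) + V y - V z" for z
      have "continuous_on (D t) h" unfolding h_def by (intro continuous_intros Vc)
      then have "bounded (h ` D t)" by (intro compact_imp_bounded compact_continuous_image st.X_compact)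
      then obtain H where H: "\<forall>z\<in>D t. \<bar>h z\<bar> \<le> H" unfolding bounded_iff by auto
      have "(SUP z\<in>D t. ereal (h z)) \<le> ereal H" using H by (intro SUP_least) (force simp: abs_le_iff)
      moreover have "ereal (h y) \<le> (SUP z\<in>D t. ereal (h z))" by (rule SUP_upper[OF y(2)])
      ultimately obtain et where et: "(SUP z\<in>D t. ereal (h z)) = ereal et"
        by (cases "SUP z\<in>D t. ereal (h z)") auto
      have h_le: "h z \<le> et" if "z \<in> D t" for z
        using SUP_upper[OF that, of "\<lambda>z. ereal (h z)"] unfolding et by simp
      have valid: "th - et + st.grad_x y x l u \<bullet> (x' - x) \<le> sval t \<theta> V x'" if x': "x' \<in> D (t - 1)" for x'
      proof -
        obtain z where z: "z \<in> feas P t x' \<theta>" "sval t \<theta> V x' = cost P t z x' \<theta> + V z"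
          using sval_attained[OF t1 \<theta> Vc x'] by blast
        then have "z \<in> st.feas_set x'" using feas_eq[OF t1 \<theta>] by simp
        then show ?thesis
          using st.cut_valid[OF y(1) x _ h_le[unfolded h_def] _ x', where z = z] u z(2)
          by (simp add: cost_fn_def th_def)
      qed
      show ?thesis
        unfolding x_def[symmetric] V_def[symmetric] eqs(1,2)
        using eqs(3) et[unfolded h_def] K(2)[OF y(2) x u lu] y(3) valid by auto
    qed
    then show ?thesis using K(1) by blast
  qed
  show "\<forall>\<^sub>F k in sequentially. ch_eta k t \<theta> \<le> ereal \<delta>" if \<delta>: "0 < \<delta>"
  proof -
    obtain \<delta>0 where \<delta>0: "0 < \<delta>0" and gap: "\<And>V x y l u \<delta>' z. convex_on (D t) V \<Longrightarrow> x \<in> D (t - 1) \<Longrightarrow> y \<in> D t \<Longrightarrow>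
       \<forall>i. 0 \<le> u $ i \<Longrightarrow> (\<Sum>i\<in>UNIV. u $ i) \<le> G \<Longrightarrow> \<delta>' \<le> \<delta>0 \<Longrightarrow> \<forall>z\<in>D t. st.lagr V x l u y \<le> st.lagr V x l u z + \<delta>' \<Longrightarrow>
       z \<in> D t \<Longrightarrow> st.grad_y y x l u \<bullet> (y - z) + V y - V z \<le> \<delta>"
      using st.near_minimizer_gap[OF G \<delta>] by meson
    have "\<forall>\<^sub>F k in sequentially. eps t k < \<delta>0 / 2"
      using eps_lim[OF t1] \<delta>0 by (intro order_tendstoD(2)) auto
    then show ?thesis using eventually_ge_at_top[of 1]
    proof eventually_elim
      case (elim k)
      obtain y l u where d: "child_data k t \<theta> y l u" and lu: "(\<Sum>i\<in>UNIV. u $ i) \<le> G"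
        using data[OF elim(2)] by blast
      note y = lagr_y[OF d refl refl refl]
      have eta: "ch_eta k t \<theta> = (SUP z\<in>D t. ereal (st.grad_y y (trial k t) l u \<bullet> (y - z)
            + v k (Suc t) y - v k (Suc t) z))" and u: "\<forall>i. 0 \<le> u $ i"
        using d unfolding child_data_def Let_def by blast+
      have VX: "convex_on (D t) (v k (Suc t))" using convex_on_subset[OF Vcx[OF elim(2)]] st.X_convex by blast
      have "2 * eps t k \<le> \<delta>0" using elim(1) by simp
      from gap[OF VX trial_in_D[OF elim(2) t] y(2) u lu this y(4)]
      show ?case unfolding eta by (intro SUP_least) simp
    qed
  qed
qed

lemma v_continuous:
  assumes "Q_regular t" "1 \<le> k"
  shows "continuous_on S (v k t)"
proof -
  have "continuous_on UNIV (v k t)"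
    using assms unfolding Q_regular_def by (metis lipschitz_on_continuous_on)
  then show ?thesis using continuous_on_subset by blast
qed

lemma cut_properties:
  assumes t: "t \<in> {2..T}" and Q: "Q_regular (Suc t)"
  shows "\<exists>G\<ge>0. \<forall>k\<ge>1. \<exists>a b. norm b \<le> G \<and> (\<forall>z. cut P r k t (snode k t) z = ereal (a + b \<bullet> (z - trial k t))) \<and>
      (\<forall>z\<in>D (t - 1). a + b \<bullet> (z - trial k t) \<le> q t z)" (is ?affine)
    and "0 < \<delta> \<Longrightarrow> \<forall>\<^sub>F k in sequentially.
      ereal ((\<Sum>\<theta>\<in>support P t. noise_prob P t \<theta> * sval t \<theta> (v k (Suc t)) (trial k t)) - \<delta>)
        \<le> cut P r k t (snode k t) (trial k t)"
proof -
  have t1: "t \<in> {1..T}" using t by auto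
  let ?S = "support P t" and ?p = "noise_prob P t"
  have "\<forall>\<theta>\<in>?S. \<exists>K\<ge>0. \<forall>k\<ge>1. \<exists>th et. ch_theta k t \<theta> = ereal th \<and> ch_eta k t \<theta> = ereal et \<and>
      norm (ch_beta k t \<theta>) \<le> K \<and> sval t \<theta> (v k (Suc t)) (trial k t) - eps t k \<le> th \<and>
      (\<forall>x\<in>D (t - 1). th - et + ch_beta k t \<theta> \<bullet> (x - trial k t) \<le> sval t \<theta> (v k (Suc t)) x)"
    using child_cut(1)[OF t _ Q] by blast
  then obtain K where K: "\<And>\<theta>. \<theta> \<in> ?S \<Longrightarrow> 0 \<le> K \<theta>"
    and cc: "\<And>\<theta> k. \<theta> \<in> ?S \<Longrightarrow> 1 \<le> k \<Longrightarrow> \<exists>th et. ch_theta k t \<theta> = ereal th \<and> ch_eta k t \<theta> = ereal et \<and>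
      norm (ch_beta k t \<theta>) \<le> K \<theta> \<and> sval t \<theta> (v k (Suc t)) (trial k t) - eps t k \<le> th \<and>
      (\<forall>x\<in>D (t - 1). th - et + ch_beta k t \<theta> \<bullet> (x - trial k t) \<le> sval t \<theta> (v k (Suc t)) x)"
    by metis
  define th where "th k \<theta> = real_of_ereal (ch_theta k t \<theta>)" for k \<theta>
  define et where "et k \<theta> = real_of_ereal (ch_eta k t \<theta>)" for k \<theta>
  have te: "ch_theta k t \<theta> = ereal (th k \<theta>)" "ch_eta k t \<theta> = ereal (et k \<theta>)" "norm (ch_beta k t \<theta>) \<le> K \<theta>"
      "sval t \<theta> (v k (Suc t)) (trial k t) - eps t k \<le> th k \<theta>"
      "\<And>x. x \<in> D (t - 1) \<Longrightarrow> th k \<theta> - et k \<theta> + ch_beta k t \<theta> \<bullet> (x - trial k t) \<le> sval t \<theta> (v k (Suc t)) x"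
    if "\<theta> \<in> ?S" "1 \<le> k" for \<theta> k
    using cc[OF that] unfolding th_def et_def by auto
  have cut: "cut P r k t (snode k t) z = ereal ((\<Sum>\<theta>\<in>?S. ?p \<theta> * (th k \<theta> - et k \<theta>))
        + (\<Sum>\<theta>\<in>?S. ?p \<theta> *\<^sub>R ch_beta k t \<theta>) \<bullet> (z - trial k t))"
    if k: "1 \<le> k" for k z
  proof -
    have n: "snode k t \<in> nodes P (t - 1)" using sampled_in_nodes k t by auto
    have St: "Suc (t - 1) = t" using t by simp
    have tp: "trans_prob P (snode k t @ [\<theta>]) = ?p \<theta>" for \<theta>
      using trans_prob_child[OF n, of \<theta>] unfolding St .
    have "(\<Sum>m\<in>children P (snode k t). ereal (trans_prob P m) * theta_m P r k t (snode k t) m)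
        = (\<Sum>\<theta>\<in>?S. ereal (?p \<theta> * th k \<theta>))"
      unfolding sum_children[OF n] St tp using te(1)[OF _ k] by (intro sum.cong) auto
    moreover have "(\<Sum>m\<in>children P (snode k t). ereal (trans_prob P m) * eta_m P r k t (snode k t) m)
        = (\<Sum>\<theta>\<in>?S. ereal (?p \<theta> * et k \<theta>))"
      unfolding sum_children[OF n] St tp using te(2)[OF _ k] by (intro sum.cong) auto
    moreover have "(\<Sum>m\<in>children P (snode k t). trans_prob P m *\<^sub>R beta_m P r k t (snode k t) m)
        = (\<Sum>\<theta>\<in>?S. ?p \<theta> *\<^sub>R ch_beta k t \<theta>)"
      unfolding sum_children[OF n] St tp ..
    ultimately show ?thesis
      unfolding cut_def by (simp add: right_diff_distrib sum_subtractf)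
  qed
  have "(\<Sum>\<theta>\<in>?S. ?p \<theta> * (th k \<theta> - et k \<theta>)) + (\<Sum>\<theta>\<in>?S. ?p \<theta> *\<^sub>R ch_beta k t \<theta>) \<bullet> (z - trial k t) \<le> q t z"
    if k: "1 \<le> k" and z: "z \<in> D (t - 1)" for k z
  proof -
    have "(\<Sum>\<theta>\<in>?S. ?p \<theta> * (th k \<theta> - et k \<theta>)) + (\<Sum>\<theta>\<in>?S. ?p \<theta> *\<^sub>R ch_beta k t \<theta>) \<bullet> (z - trial k t)
        = (\<Sum>\<theta>\<in>?S. ?p \<theta> * (th k \<theta> - et k \<theta> + ch_beta k t \<theta> \<bullet> (z - trial k t)))"
      by (simp add: inner_sum_left distrib_left sum.distrib)
    also have "\<dots> \<le> (\<Sum>\<theta>\<in>?S. ?p \<theta> * sval t \<theta> (q (Suc t)) z)"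
    proof (intro sum_mono mult_left_mono noise_prob_nonneg)
      fix \<theta> assume \<theta>: "\<theta> \<in> ?S"
      note te(5)[OF \<theta> k z]
      also have "sval t \<theta> (v k (Suc t)) z \<le> sval t \<theta> (q (Suc t)) z"
      proof (rule sval_mono[OF t1 \<theta> v_continuous[OF Q k] _ z])
        show "continuous_on (D t) (q (Suc t))" using q_continuous t by simp
        show "v k (Suc t) y \<le> q (Suc t) y" if "y \<in> D t" for y
          using Q k that unfolding Q_regular_def by force
      qed
      finally show "th k \<theta> - et k \<theta> + ch_beta k t \<theta> \<bullet> (z - trial k t) \<le> sval t \<theta> (q (Suc t)) z" .
    qed
    finally show ?thesis using q_eq[OF t1 z] by simp
  qed
  moreover have "norm (\<Sum>\<theta>\<in>?S. ?p \<theta> *\<^sub>R ch_beta k t \<theta>) \<le> (\<Sum>\<theta>\<in>?S. ?p \<theta> * K \<theta>)" if "1 \<le> k" for k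
    using te(3)[OF _ that] noise_prob_nonneg by (intro sum_norm_le) (simp add: mult_left_mono)
  moreover have "0 \<le> (\<Sum>\<theta>\<in>?S. ?p \<theta> * K \<theta>)" by (intro sum_nonneg mult_nonneg_nonneg K noise_prob_nonneg)
  ultimately show ?affine using cut by blast
  show "\<forall>\<^sub>F k in sequentially. ereal ((\<Sum>\<theta>\<in>?S. ?p \<theta> * sval t \<theta> (v k (Suc t)) (trial k t)) - \<delta>)
        \<le> cut P r k t (snode k t) (trial k t)" if \<delta>: "0 < \<delta>"
  proof -
    have "\<forall>\<^sub>F k in sequentially. \<forall>\<theta>\<in>?S. ch_eta k t \<theta> \<le> ereal (\<delta> / 2)"
      using child_cut(2)[OF t _ Q, of _ "\<delta> / 2"] \<delta> support_facts(1)[OF t1]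
      by (intro eventually_ball_finite) auto
    moreover have "\<forall>\<^sub>F k in sequentially. eps t k < \<delta> / 2"
      using eps_lim[OF t1] \<delta> by (intro order_tendstoD(2)) auto
    ultimately show ?thesis using eventually_ge_at_top[of 1]
    proof eventually_elim
      case (elim k)
      have "(\<Sum>\<theta>\<in>?S. ?p \<theta> * sval t \<theta> (v k (Suc t)) (trial k t)) - \<delta>
          = (\<Sum>\<theta>\<in>?S. ?p \<theta> * (sval t \<theta> (v k (Suc t)) (trial k t) - \<delta>))"
        using sum_noise_prob[OF t1] by (simp add: right_diff_distrib sum_subtractf flip: sum_distrib_right)
      also have "\<dots> \<le> (\<Sum>\<theta>\<in>?S. ?p \<theta> * (th k \<theta> - et k \<theta>))"
      proof (intro sum_mono mult_left_mono noise_prob_nonneg)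
        fix \<theta> assume \<theta>: "\<theta> \<in> ?S"
        then have "et k \<theta> \<le> \<delta> / 2" using bspec[OF elim(1) \<theta>] te(2)[OF \<theta> elim(3)] by simp
        then show "sval t \<theta> (v k (Suc t)) (trial k t) - \<delta> \<le> th k \<theta> - et k \<theta>"
          using te(4)[OF \<theta> elim(3)] elim(2) by linarith
      qed
      finally show ?case unfolding cut[OF elim(3)] by simp
    qed
  qed
qed

text \<open>
  The approximations of iterations \<open>k \<ge> 1\<close> are maxima of finitely many cuts with a common bound on
  their slopes; the initial value \<open>-\<infinity>\<close> disappears with the first cut, which also bounds all
  later approximations below.
\<close>

lemma Q_regular_step:
  assumes t: "t \<in> {2..T}" and Q: "Q_regular (Suc t)"
  shows "Q_regular t" and "1 \<le> k \<Longrightarrow> v k t x \<le> v (Suc k) t x"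
proof -
  obtain G where G: "\<And>k. 1 \<le> k \<Longrightarrow> \<exists>a b. norm b \<le> G \<and>
      (\<forall>z. cut P r k t (snode k t) z = ereal (a + b \<bullet> (z - trial k t))) \<and>
      (\<forall>z\<in>D (t - 1). a + b \<bullet> (z - trial k t) \<le> q t z)"
    using cut_properties(1)[OF t Q] by blast
  have "support P t \<noteq> {}" using sum_noise_prob[of t] t by auto
  then obtain \<theta> where \<theta>: "\<theta> \<in> support P t" by blast
  have upd: "Qapp r k t = (\<lambda>z. max (Qapp r (k - 1) t z) (cut P r k t (snode k t) z))" if "1 \<le> k" for k
    by (rule backward(3)[OF that t \<theta>])
  have Q0: "Qapp r 0 t z = -\<infinity>" for z using run t unfolding isddp_run_def by simp
  have reg: "(\<forall>z. Qapp r k t z = ereal (v k t z)) \<and> convex_on UNIV (v k t) \<and> G-lipschitz_on UNIV (v k t) \<and>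
      (\<forall>x\<in>D (t - 1). v k t x \<le> q t x) \<and> (\<forall>x. v 1 t x \<le> v k t x)" if "1 \<le> k" for k
    using that
  proof (induction k rule: dec_induct)
    case base
    obtain a b where ab: "norm b \<le> G"
      "\<And>z. cut P r 1 t (snode 1 t) z = ereal (a + b \<bullet> (z - trial 1 t))"
      "\<And>z. z \<in> D (t - 1) \<Longrightarrow> a + b \<bullet> (z - trial 1 t) \<le> q t z"
      using G[of 1] by auto
    have Q1: "Qapp r 1 t z = ereal (a + b \<bullet> (z - trial 1 t))" for z
      using fun_cong[OF upd[of 1], of z] ab(2)[of z] Q0 by simp
    have v1: "v 1 t = (\<lambda>z. a + b \<bullet> (z - trial 1 t))"
      unfolding v_def Q1 by simp
    show ?case using Q1 ab(3) affine_regular[OF ab(1), of a] unfolding v1 by simp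
  next
    case (step k)
    obtain a b where ab: "norm b \<le> G"
      "\<And>z. cut P r (Suc k) t (snode (Suc k) t) z = ereal (a + b \<bullet> (z - trial (Suc k) t))"
      "\<And>z. z \<in> D (t - 1) \<Longrightarrow> a + b \<bullet> (z - trial (Suc k) t) \<le> q t z"
      using G[of "Suc k"] by auto
    let ?c = "\<lambda>z. a + b \<bullet> (z - trial (Suc k) t)"
    have Q1: "Qapp r (Suc k) t z = ereal (max (v k t z) (?c z))" for z
      using fun_cong[OF upd[of "Suc k"], of z] ab(2)[of z] step.IH by simp
    have v1: "v (Suc k) t = (\<lambda>z. max (v k t z) (?c z))"
      unfolding v_def[of "Suc k"] Q1 by (simp only: real_of_ereal.simps)
    show ?case
      unfolding v1 using Q1 step.IH ab(3) affine_regular[OF ab(1), of a]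
      by (auto intro!: convex_on_max_fun lipschitz_on_max intro: max.coboundedI1)
  qed
  show "v k t x \<le> v (Suc k) t x" if "1 \<le> k"
  proof -
    have "Qapp r k t x \<le> Qapp r (Suc k) t x" using fun_cong[OF upd[of "Suc k"], of x] by simp
    then show ?thesis using reg[OF that] reg[of "Suc k"] by simp
  qed
  have cpt: "compact (D (t - 1))" using prev_stage_data(3)[of t] t by simp
  have bd: "\<exists>M. \<forall>x\<in>D (t - 1). \<bar>h x\<bar> \<le> M" if "continuous_on (D (t - 1)) h" for h :: "real^'n \<Rightarrow> real"
    using compact_imp_bounded[OF compact_continuous_image[OF that cpt]] unfolding bounded_iff by auto
  have "continuous_on (D (t - 1)) (v 1 t)"
    using reg[of 1] lipschitz_on_continuous_on continuous_on_subset by blast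
  then obtain M1 where M1: "\<forall>x\<in>D (t - 1). \<bar>v 1 t x\<bar> \<le> M1" using bd by blast
  have "continuous_on (D (t - 1)) (q t)" using q_continuous[of "t - 1"] t by auto
  then obtain Mq where Mq: "\<forall>x\<in>D (t - 1). \<bar>q t x\<bar> \<le> Mq" using bd by blast
  show "Q_regular t"
    unfolding Q_regular_def
  proof (rule exI[of _ G], rule exI[of _ "max M1 Mq"], intro allI impI)
    fix k :: nat assume k: "1 \<le> k"
    have "\<bar>v k t x\<bar> \<le> max M1 Mq" if "x \<in> D (t - 1)" for x
    proof -
      have "v 1 t x \<le> v k t x" "v k t x \<le> q t x" using reg[OF k] that by auto
      moreover have "\<bar>v 1 t x\<bar> \<le> M1" "\<bar>q t x\<bar> \<le> Mq" using M1 Mq that by auto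
      ultimately show ?thesis by (simp add: abs_le_iff) linarith
    qed
    then show "(\<forall>z. Qapp r k t z = ereal (v k t z)) \<and> convex_on UNIV (v k t) \<and>
     G-lipschitz_on UNIV (v k t) \<and> (\<forall>x\<in>D (t - 1). v k t x \<le> q t x \<and> \<bar>v k t x\<bar> \<le> max M1 Mq)"
      using reg[OF k] by blast
  qed
qed

lemma Q_end: "Qapp r k (Suc T) z = 0" "v k (Suc T) z = 0"
  using run unfolding isddp_run_def v_def by simp_all

lemma Q_regular:
  assumes "2 \<le> t" "t \<le> Suc T"
  shows "Q_regular t"
  using assms(2)
proof (induction t rule: inc_induct)
  case base
  have "v k (Suc T) = (\<lambda>_. 0)" for k by (rule ext) (rule Q_end)
  then show ?case
    unfolding Q_regular_def
    by (intro exI[of _ 0] exI[of _ 0]) (auto simp: Q_end q_end zero_ereal_def lipschitz_on_def convex_on_const)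
next
  case (step n)
  then show ?case using Q_regular_step(1)[of n] assms(1) by simp
qed

lemma v_mono:
  assumes "2 \<le> t" "t \<le> Suc T" "1 \<le> k"
  shows "v k t x \<le> v (Suc k) t x"
proof (cases "t = Suc T")
  case True
  then show ?thesis by (simp add: Q_end)
next
  case False
  then show ?thesis using Q_regular_step(2)[OF _ Q_regular] assms by simp
qed

lemma v_le_q:
  assumes "2 \<le> t" "t \<le> Suc T" "1 \<le> k" "x \<in> D (t - 1)"
  shows "v k t x \<le> q t x"
  using Q_regular[OF assms(1,2)] assms(3,4) unfolding Q_regular_def by blast

lemma Qapp_eq:
  assumes "2 \<le> t" "t \<le> Suc T" "1 \<le> k"
  shows "Qapp r k t x = ereal (v k t x)"
  using Q_regular[OF assms(1,2)] assms(3) unfolding Q_regular_def by blast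

lemma v_cont:
  assumes "2 \<le> t" "t \<le> Suc T" "1 \<le> k"
  shows "continuous_on S (v k t)"
  by (rule v_continuous[OF Q_regular[OF assms(1,2)] assms(3)])

section \<open>Vanishing gaps\<close>

text \<open>
  The error at the forward decision of the approximation that the forward pass of the same iteration has
  used. It is determined before the \<open>k\<close>-th scenario is sampled.
\<close>

definition gap :: "nat \<Rightarrow> (real^'k) list \<Rightarrow> nat \<Rightarrow> real" where
  "gap t n k = q t (fwd r k n) - v (k - 1) t (fwd r k n)"

lemma gap_nonneg:
  assumes "2 \<le> t" "t \<le> Suc T" "2 \<le> k" "n \<in> nodes P (t - 1)"
  shows "0 \<le> gap t n k"
proof -
  have "fwd r k n \<in> D (t - 1)" using fwd_in_D[of k "t - 1" n] assms by auto
  then show ?thesis using v_le_q[of t "k - 1" "fwd r k n"] assms by (simp add: gap_def)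
qed

text \<open>
  The forward decision is feasible for the exact stage problem too, where its objective value is larger by the
  gap at this decision.
\<close>

lemma forward_optimal:
  assumes t: "t \<in> {1..T}" and n: "n \<in> nodes P (t - 1)" and \<theta>: "\<theta> \<in> support P t" and k: "2 \<le> k"
  shows "cost P t (fwd r k (n @ [\<theta>])) (fwd r k n) \<theta> + v (k - 1) (Suc t) (fwd r k (n @ [\<theta>]))
      \<le> sval t \<theta> (v (k - 1) (Suc t)) (fwd r k n) + eps t k"
    and "sval t \<theta> (q (Suc t)) (fwd r k n)
      \<le> sval t \<theta> (v (k - 1) (Suc t)) (fwd r k n) + eps t k + gap (Suc t) (n @ [\<theta>]) k"
proof -
  have St: "Suc (t - 1) = t" using t by simp
  have x: "fwd r k n \<in> D (t - 1)" using fwd_in_D[of k "t - 1" n] t n k by auto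
  have Q: "Qapp r (k - 1) (Suc t) z = ereal (v (k - 1) (Suc t) z)" for z
    using Qapp_eq[of "Suc t" "k - 1" z] t k by simp
  have c: "continuous_on (D t) (v (k - 1) (Suc t))" using v_cont[of "Suc t" "k - 1"] t k by simp
  have cq: "continuous_on (D t) (q (Suc t))" using q_continuous t by simp
  have em: "eps_min (eps t k) (\<lambda>y. stage_obj P t (Qapp r (k - 1) (Suc t)) y (fwd r k n) \<theta>)
     (feas P t (fwd r k n) \<theta>) (fwd r k (n @ [\<theta>]))"
  proof -
    have "t - 1 < T" using t by auto
    from forward[OF _ this n, of k \<theta>] show ?thesis using \<theta> k unfolding St by simp
  qed
  have sv: "(INF y\<in>feas P t (fwd r k n) \<theta>. stage_obj P t (Qapp r (k - 1) (Suc t)) y (fwd r k n) \<theta>)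
      = ereal (sval t \<theta> (v (k - 1) (Suc t)) (fwd r k n))"
    using stage_val_eq[OF t \<theta> c x, of "Qapp r (k - 1) (Suc t)"] Q by (simp add: stage_val_def)
  show *: "cost P t (fwd r k (n @ [\<theta>])) (fwd r k n) \<theta> + v (k - 1) (Suc t) (fwd r k (n @ [\<theta>]))
      \<le> sval t \<theta> (v (k - 1) (Suc t)) (fwd r k n) + eps t k"
    using em unfolding eps_min_def sv unfolding stage_obj_def Q by simp
  have "fwd r k (n @ [\<theta>]) \<in> feas P t (fwd r k n) \<theta>" using em by (simp add: eps_min_def)
  from sval_le[OF t \<theta> cq x this] *
  show "sval t \<theta> (q (Suc t)) (fwd r k n)
      \<le> sval t \<theta> (v (k - 1) (Suc t)) (fwd r k n) + eps t k + gap (Suc t) (n @ [\<theta>]) k"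
    by (simp add: gap_def)
qed

text \<open>
  If the gaps of the children vanish, then the approximate and exact stage values at \<open>x\<^sub>n\<^sup>k\<close> get
  close, and the cut constructed when \<open>n\<close> is sampled reaches the approximate ones up to a vanishing
  error.
\<close>

lemma sampled_gap_closes:
  assumes t: "t \<in> {2..T}" and n: "n \<in> nodes P (t - 1)" and \<delta>: "0 < \<delta>"
    and IH: "\<And>\<theta>. \<theta> \<in> support P t \<Longrightarrow> gap (Suc t) (n @ [\<theta>]) \<longlonglongrightarrow> 0"
  shows "\<forall>\<^sub>F k in sequentially. snode k t = n \<longrightarrow> q t (fwd r k n) - v k t (fwd r k n) \<le> \<delta>"
proof -
  have t1: "t \<in> {1..T}" using t by auto
  let ?S = "support P t" and ?p = "noise_prob P t"
  have "\<forall>\<^sub>F k in sequentially. \<forall>\<theta>\<in>?S. gap (Suc t) (n @ [\<theta>]) k < \<delta> / 3"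
    using IH \<delta> support_facts(1)[OF t1]
    by (intro eventually_ball_finite ballI order_tendstoD(2)) auto
  moreover have "\<forall>\<^sub>F k in sequentially. eps t k < \<delta> / 3"
    using eps_lim[OF t1] \<delta> by (intro order_tendstoD(2)) auto
  moreover have "\<forall>\<^sub>F k in sequentially.
      ereal ((\<Sum>\<theta>\<in>?S. ?p \<theta> * sval t \<theta> (v k (Suc t)) (trial k t)) - \<delta> / 3)
        \<le> cut P r k t (snode k t) (trial k t)"
    using cut_properties(2)[OF t Q_regular, of "\<delta> / 3"] t \<delta> by simp
  ultimately show ?thesis using eventually_ge_at_top[of 2]
  proof eventually_elim
    case (elim k)
    show ?case
    proof
      assume s: "snode k t = n"
      let ?x = "fwd r k n"
      have x: "?x \<in> D (t - 1)" using fwd_in_D[of k "t - 1" n] t n elim(4) by auto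
      have "?S \<noteq> {}" using sum_noise_prob[OF t1] by auto
      then obtain \<theta>0 where \<theta>0: "\<theta>0 \<in> support P t" by blast
      have "cut P r k t n ?x \<le> Qapp r k t ?x"
        using backward(3)[OF _ t \<theta>0, of k] elim(4) s by simp
      also have "\<dots> = ereal (v k t ?x)" using Qapp_eq[of t k ?x] t elim(4) by simp
      finally have v: "(\<Sum>\<theta>\<in>?S. ?p \<theta> * sval t \<theta> (v k (Suc t)) ?x) - \<delta> / 3 \<le> v k t ?x"
        using elim(3) unfolding s by (meson ereal_less_eq(3) order_trans)
      have "q t ?x = (\<Sum>\<theta>\<in>?S. ?p \<theta> * sval t \<theta> (q (Suc t)) ?x)" by (rule q_eq[OF t1 x])
      also have "\<dots> \<le> (\<Sum>\<theta>\<in>?S. ?p \<theta> * (sval t \<theta> (v k (Suc t)) ?x + 2 * \<delta> / 3))"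
      proof (intro sum_mono mult_left_mono noise_prob_nonneg)
        fix \<theta> assume \<theta>: "\<theta> \<in> ?S"
        have "sval t \<theta> (v (k - 1) (Suc t)) ?x \<le> sval t \<theta> (v k (Suc t)) ?x"
        proof (rule sval_mono[OF t1 \<theta> _ _ x])
          show "continuous_on (D t) (v (k - 1) (Suc t))" "continuous_on (D t) (v k (Suc t))"
            using v_cont t elim(4) by simp_all
          show "v (k - 1) (Suc t) y \<le> v k (Suc t) y" for y
            using v_mono[of "Suc t" "k - 1" y] t elim(4) by simp
        qed
        then show "sval t \<theta> (q (Suc t)) ?x \<le> sval t \<theta> (v k (Suc t)) ?x + 2 * \<delta> / 3"
          using forward_optimal(2)[OF t1 n \<theta> elim(4)] bspec[OF elim(1) \<theta>] elim(2) by simp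
      qed
      also have "\<dots> = (\<Sum>\<theta>\<in>?S. ?p \<theta> * sval t \<theta> (v k (Suc t)) ?x) + 2 * \<delta> / 3"
      proof -
        have "(\<Sum>\<theta>\<in>?S. ?p \<theta> * (s \<theta> + d)) = (\<Sum>\<theta>\<in>?S. ?p \<theta> * s \<theta>) + d" for s d
          using sum_noise_prob[OF t1] by (simp add: distrib_left sum.distrib flip: sum_distrib_right)
        then show ?thesis .
      qed
      finally show "q t ?x - v k t ?x \<le> \<delta>" using v by simp
    qed
  qed
qed

text \<open>
  If a gap were infinitely often large, then by assumption it would be large before infinitely many of the
  iterations that sample its node; but these iterations close it, so it is small before some of them.
\<close>

theorem gap_tendsto_0:
  assumes sampling: "\<And>t n j. t \<in> {2..T} \<Longrightarrow> n \<in> nodes P (t - 1) \<Longrightarrow>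
      \<exists>\<^sub>\<infinity>k. 2 \<le> k \<and> inverse (real (Suc j)) \<le> gap t n k \<Longrightarrow>
      \<exists>\<^sub>\<infinity>k. (2 \<le> k \<and> inverse (real (Suc j)) \<le> gap t n k) \<and> snode k t = n"
    and "2 \<le> t" "t \<le> Suc T" "n \<in> nodes P (t - 1)"
  shows "gap t n \<longlonglongrightarrow> 0"
  using assms(3,4)
proof (induction t arbitrary: n rule: inc_induct)
  case base
  then show ?case unfolding gap_def[abs_def] by (simp add: q_end Q_end)
next
  case (step t)
  have t: "t \<in> {2..T}" using step.hyps assms(2) by auto
  note n = step.prems
  have St: "Suc (t - 1) = t" using t by simp
  have IH: "gap (Suc t) (n @ [\<theta>]) \<longlonglongrightarrow> 0" if "\<theta> \<in> support P t" for \<theta>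
  proof (rule step.IH)
    have "n @ [\<theta>] \<in> nodes P (Suc (t - 1))" using child_node[OF n] that St by simp
    then show "n @ [\<theta>] \<in> nodes P (Suc t - 1)" using St by simp
  qed
  have small': "\<forall>\<^sub>F k in sequentially. gap t n k < inverse (real (Suc j))" for j
  proof (rule ccontr)
    define \<delta> where "\<delta> = inverse (real (Suc j))"
    have \<delta>: "0 < \<delta>" by (simp add: \<delta>_def)
    assume "\<not> (\<forall>\<^sub>F k in sequentially. gap t n k < inverse (real (Suc j)))"
    then have "\<not> (\<forall>\<^sub>F k in sequentially. gap t n k < \<delta>)" unfolding \<delta>_def .
    then have "\<exists>\<^sub>\<infinity>k. \<delta> \<le> gap t n k"
      by (simp add: not_eventually not_less frequently_cofinite[symmetric] cofinite_eq_sequentially)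
    then have "\<exists>\<^sub>\<infinity>k. 2 \<le> k \<and> \<delta> \<le> gap t n k"
      using MOST_ge_nat[of 2] by (rule INFM_conjI[THEN INFM_mono]) auto
    then have inf: "\<exists>\<^sub>\<infinity>k. (2 \<le> k \<and> \<delta> \<le> gap t n k) \<and> snode k t = n" 
      unfolding \<delta>_def by (rule sampling[OF t n])
    define K where "K = {k. (2 \<le> k \<and> \<delta> \<le> gap t n k) \<and> snode k t = n}"
    have K: "infinite K" using inf by (simp add: K_def frequently_cofinite)
    obtain Lf where Lf: "Lf-lipschitz_on (D (t - 1)) (q t)" using q_lipschitz[of t] t by auto
    obtain L where L: "\<And>k. 1 \<le> k \<Longrightarrow> L-lipschitz_on (D (t - 1)) (v k t)"
      using Q_regular[of t] t lipschitz_on_subset[OF _ subset_UNIV] unfolding Q_regular_def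
      by (metis (no_types, lifting) Suc_leI atLeastAtMost_iff le_SucI)
    have "\<exists>k\<in>K. q t (fwd r k n) - v (k - 1) t (fwd r k n) < \<delta>"
    proof (rule gap_before_visit[OF _ K _ Lf L _ _ \<delta>])
      show "compact (D (t - 1))" using prev_stage_data(3)[of t] t by simp
      show "2 \<le> k" if "k \<in> K" for k using that by (simp add: K_def)
      show "v k t y \<le> v (Suc k) t y" if "1 \<le> k" for k y using v_mono[of t k y] t that by simp
      show "fwd r k n \<in> D (t - 1)" if "1 \<le> k" for k using fwd_in_D[OF that _ n] t by auto
      have "\<forall>\<^sub>F k in sequentially. snode k t = n \<longrightarrow> q t (fwd r k n) - v k t (fwd r k n) \<le> \<delta> / 2"
        using sampled_gap_closes[OF t n _ IH, of "\<delta> / 2"] \<delta> by simp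
      then show "\<forall>\<^sub>F k in sequentially. k \<in> K \<longrightarrow> q t (fwd r k n) - v k t (fwd r k n) \<le> \<delta> / 2"
        by eventually_elim (simp add: K_def)
    qed
    then show False by (auto simp: K_def gap_def)
  qed
  have small: "\<forall>\<^sub>F k in sequentially. gap t n k < \<delta>" if \<delta>: "0 < \<delta>" for \<delta>
  proof -
    obtain j where "inverse (real (Suc j)) < \<delta>" using reals_Archimedean[OF \<delta>] by blast
    then show ?thesis using small'[of j] by (auto elim: eventually_mono)
  qed
  show ?case
  proof (rule order_tendstoI)
    show "\<forall>\<^sub>F k in sequentially. a < gap t n k" if "a < 0" for a
      using eventually_ge_at_top[of 2]
    proof eventually_elim
      case (elim k)
      then show ?case using gap_nonneg[of t k n] t n that by simp
    qed
  qed (rule small)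
qed

section \<open>Consequences of vanishing gaps\<close>

text \<open>The approximation of iteration \<open>k\<close> lies between the one that defines the gap and the exact function.\<close>

lemma approximation_tendsto:
  assumes t: "2 \<le> t" "t \<le> Suc T" "n \<in> nodes P (t - 1)" and gap: "gap t n \<longlonglongrightarrow> 0"
  shows "(\<lambda>k. cost_to_go P t (fwd r k n) - Qapp r k t (fwd r k n)) \<longlonglongrightarrow> 0"
proof -
  have D: "fwd r k n \<in> D (t - 1)" if "1 \<le> k" for k using fwd_in_D[OF that _ t(3)] t by simp
  have "(\<lambda>k. q t (fwd r k n) - v k t (fwd r k n)) \<longlonglongrightarrow> 0"
  proof (rule tendsto_sandwich[OF _ _ tendsto_const gap])
    show "\<forall>\<^sub>F k in sequentially. 0 \<le> q t (fwd r k n) - v k t (fwd r k n)"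
      using eventually_ge_at_top[of 1]
    proof eventually_elim
      case (elim k)
      then show ?case using v_le_q[OF t(1,2) elim D[OF elim]] by simp
    qed
    show "\<forall>\<^sub>F k in sequentially. q t (fwd r k n) - v k t (fwd r k n) \<le> gap t n k"
      using eventually_ge_at_top[of 2]
    proof eventually_elim
      case (elim k)
      then show ?case using v_mono[OF t(1,2), of "k - 1" "fwd r k n"] by (simp add: gap_def)
    qed
  qed
  then have "(\<lambda>k. ereal (q t (fwd r k n) - v k t (fwd r k n))) \<longlonglongrightarrow> 0"
    unfolding zero_ereal_def by (rule tendsto_ereal)
  moreover have "\<forall>\<^sub>F k in sequentially. ereal (q t (fwd r k n) - v k t (fwd r k n))
      = cost_to_go P t (fwd r k n) - Qapp r k t (fwd r k n)"
    using eventually_ge_at_top[of 1]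
  proof eventually_elim
    case (elim k)
    then show ?case using ctg_eq[of t "fwd r k n"] Qapp_eq[OF t(1,2) elim] D[OF elim] t by simp
  qed
  ultimately show ?thesis by (rule Lim_transform_eventually)
qed

text \<open>
  Both approximate first stage values are below the optimal value, up to \<open>\<epsilon>\<close>, and above it, up to
  \<open>\<epsilon>\<close> and the gap of the first stage decision.
\<close>

lemma first_stage_tendsto:
  assumes gap: "gap 2 [xi_one P] \<longlonglongrightarrow> 0"
  shows "(\<lambda>k. stage_obj P 1 (Qapp r (k - 1) 2) (fwd r k [xi_one P]) (x_init P) (xi_one P)) \<longlonglongrightarrow> first_stage_value P"
    and "(\<lambda>k. stage_val P 1 (Qapp r k 2) (x_init P) (xi_one P)) \<longlonglongrightarrow> first_stage_value P"
proof -
  have one: "1 \<in> {1..T}" and two: "2 \<le> Suc T" using horizon_pos by auto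
  have S2: "Suc 1 = 2" by simp
  have xi: "xi_one P \<in> support P 1" unfolding support_one by simp
  have nil: "[] \<in> nodes P (1 - 1)" by (simp add: nodes_0)
  have x0: "x_init P \<in> D (1 - 1)" by (simp add: D_0)
  define a where "a k = cost P 1 (fwd r k [xi_one P]) (x_init P) (xi_one P) + v (k - 1) 2 (fwd r k [xi_one P])" for k
  define s where "s k = sval 1 (xi_one P) (v k 2) (x_init P)" for k
  define Q where "Q = q 1 (x_init P)"
  have Qs: "Q = sval 1 (xi_one P) (q 2) (x_init P)" unfolding Q_def by (rule first_stage_value_eq(2))
  have cq: "continuous_on (D 1) (q 2)" using q_continuous[OF horizon_pos] by (simp add: numeral_2_eq_2)
  have cv: "continuous_on (D 1) (v k 2)" if "1 \<le> k" for k using v_cont[of 2 k] that two by simp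
  have sQ: "s k \<le> Q" if "1 \<le> k" for k
    unfolding s_def Qs
    by (rule sval_mono[OF one xi cv[OF that] cq x0]) (use v_le_q[of 2 k] that two in simp)
  have bounds: "a k \<le> s (k - 1) + eps 1 k" "Q \<le> s (k - 1) + eps 1 k + gap 2 [xi_one P] k" "Q \<le> a k + gap 2 [xi_one P] k"
    if k: "2 \<le> k" for k
  proof -
    have r: "fwd r k [] = x_init P" using fwd_root k by simp
    note * = forward_optimal[OF one nil xi k, unfolded r S2 append_Nil]
    show "a k \<le> s (k - 1) + eps 1 k" using *(1) by (simp add: a_def s_def)
    show "Q \<le> s (k - 1) + eps 1 k + gap 2 [xi_one P] k" using *(2) unfolding Qs s_def .
    have "fwd r k ([] @ [xi_one P]) \<in> feas P (Suc 0) (fwd r k []) (xi_one P)"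
      using k horizon_pos support_one by (intro fwd_feasible) (auto simp: nodes_0)
    then have "fwd r k [xi_one P] \<in> feas P 1 (x_init P) (xi_one P)" using r by simp
    from sval_le[OF one xi cq x0 this] show "Q \<le> a k + gap 2 [xi_one P] k"
      unfolding Qs a_def gap_def by simp
  qed
  have eps: "(\<lambda>k. eps 1 k) \<longlonglongrightarrow> 0" by (rule eps_lim[OF one])
  have a_lim: "a \<longlonglongrightarrow> Q"
  proof (rule tendsto_sandwich)
    show "\<forall>\<^sub>F k in sequentially. Q - gap 2 [xi_one P] k \<le> a k"
      using eventually_ge_at_top[of 2] by eventually_elim (use bounds(3) in \<open>simp add: algebra_simps\<close>)
    show "\<forall>\<^sub>F k in sequentially. a k \<le> Q + eps 1 k"
      using eventually_ge_at_top[of 2]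
    proof eventually_elim
      case (elim k)
      then have "1 \<le> k - 1" by simp
      from sQ[OF this] bounds(1)[OF elim] show ?case by linarith
    qed
    show "(\<lambda>k. Q - gap 2 [xi_one P] k) \<longlonglongrightarrow> Q" using tendsto_diff[OF tendsto_const gap, of Q] by simp
    show "(\<lambda>k. Q + eps 1 k) \<longlonglongrightarrow> Q" using tendsto_add[OF tendsto_const eps, of Q] by simp
  qed
  have s_mono: "s (k - 1) \<le> s k" if "2 \<le> k" for k
    unfolding s_def
    by (rule sval_mono[OF one xi cv cv x0]) (use v_mono[of 2 "k - 1"] that two in auto)
  have s_lim: "s \<longlonglongrightarrow> Q"
  proof (rule tendsto_sandwich)
    show "\<forall>\<^sub>F k in sequentially. Q - (eps 1 k + gap 2 [xi_one P] k) \<le> s k"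
      using eventually_ge_at_top[of 2]
    proof eventually_elim
      case (elim k)
      then show ?case using bounds(2)[OF elim] s_mono[OF elim] by simp
    qed
    show "\<forall>\<^sub>F k in sequentially. s k \<le> Q"
      using eventually_ge_at_top[of 1] by eventually_elim (rule sQ)
    show "(\<lambda>k. Q - (eps 1 k + gap 2 [xi_one P] k)) \<longlonglongrightarrow> Q"
      using tendsto_diff[OF tendsto_const tendsto_add[OF eps gap], of Q] by simp
  qed simp
  have V: "first_stage_value P = ereal Q" unfolding Q_def by (rule first_stage_value_eq(1))
  have ea: "\<forall>\<^sub>F k in sequentially. ereal (a k)
      = stage_obj P 1 (Qapp r (k - 1) 2) (fwd r k [xi_one P]) (x_init P) (xi_one P)"
    using eventually_ge_at_top[of 2]
  proof eventually_elim
    case (elim k)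
    then show ?case using Qapp_eq[of 2 "k - 1" "fwd r k [xi_one P]"] two by (simp add: stage_obj_def a_def)
  qed
  show "(\<lambda>k. stage_obj P 1 (Qapp r (k - 1) 2) (fwd r k [xi_one P]) (x_init P) (xi_one P)) \<longlonglongrightarrow> first_stage_value P"
    unfolding V using tendsto_ereal[OF a_lim] ea by (rule Lim_transform_eventually)
  have es: "\<forall>\<^sub>F k in sequentially. ereal (s k) = stage_val P 1 (Qapp r k 2) (x_init P) (xi_one P)"
    using eventually_ge_at_top[of 1]
  proof eventually_elim
    case (elim k)
    show ?case unfolding s_def
      by (rule stage_val_eq[OF one xi cv[OF elim] x0, symmetric]) (rule Qapp_eq[OF _ two elim], simp)
  qed
  show "(\<lambda>k. stage_val P 1 (Qapp r k 2) (x_init P) (xi_one P)) \<longlonglongrightarrow> first_stage_value P"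
    unfolding V using tendsto_ereal[OF s_lim] es by (rule Lim_transform_eventually)
qed

text \<open>
  Up to \<open>\<epsilon>\<close> and the gap at the child, a forward decision is optimal for the exact stage problem at the
  forward decision of the parent. This near-optimality passes to the limit because the feasibility relation
  is closed and the exact stage value is continuous in the previous decision.
\<close>

lemma accumulation_point_optimal:
  assumes gap: "\<And>t n. 2 \<le> t \<Longrightarrow> t \<le> Suc T \<Longrightarrow> n \<in> nodes P (t - 1) \<Longrightarrow> gap t n \<longlonglongrightarrow> 0"
    and acc: "accumulation_point P r z"
  shows "optimal_tree z"
proof -
  obtain \<phi>0 where \<phi>0: "strict_mono (\<phi>0 :: nat \<Rightarrow> nat)" "\<And>n. n \<in> all_nodes P \<Longrightarrow> (\<lambda>i. fwd r (\<phi>0 i) n) \<longlonglongrightarrow> z n"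
    using acc unfolding accumulation_point_def by blast
  \<comment> \<open>The approximation preceding iteration 1 is \<open>-\<infinity>\<close>, so the first two indices are skipped.\<close>
  define \<phi> where "\<phi> i = \<phi>0 (i + 2)" for i
  have \<phi>2: "2 \<le> \<phi> i" for i using seq_suble[OF \<phi>0(1), of "i + 2"] by (simp add: \<phi>_def)
  then have \<phi>1: "1 \<le> \<phi> i" for i by (rule order_trans[rotated]) simp
  have \<phi>: "strict_mono \<phi>" using \<phi>0(1) by (simp add: \<phi>_def strict_mono_def)
  have lim: "(\<lambda>i. fwd r (\<phi> i) n) \<longlonglongrightarrow> z n" if "n \<in> nodes P t" "t \<le> T" for n t
    unfolding \<phi>_def using LIMSEQ_ignore_initial_segment[OF \<phi>0(2)[OF node_in_all[OF that]], of 2] .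
  have root: "z [] = x_init P"
  proof (rule LIMSEQ_unique)
    show "(\<lambda>i. fwd r (\<phi> i) []) \<longlonglongrightarrow> z []" by (rule lim[of _ 0]) (simp_all add: nodes_0)
    show "(\<lambda>i. fwd r (\<phi> i) []) \<longlonglongrightarrow> x_init P" using fwd_root[OF \<phi>1] by simp
  qed
  have "z (n @ [\<theta>]) \<in> feas P (Suc t) (z n) \<theta> \<and>
     cost P (Suc t) (z (n @ [\<theta>])) (z n) \<theta> + q (Suc (Suc t)) (z (n @ [\<theta>]))
       \<le> sval (Suc t) \<theta> (q (Suc (Suc t))) (z n)"
    if t: "t < T" and n: "n \<in> nodes P t" and \<theta>: "\<theta> \<in> support P (Suc t)" for t n \<theta>
  proof -
    have St: "Suc t \<in> {1..T}" using t by simp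
    have n': "n \<in> nodes P (Suc t - 1)" using n by simp
    have m: "n @ [\<theta>] \<in> nodes P (Suc t)" by (rule child_node[OF n \<theta>])
    have limn: "(\<lambda>i. fwd r (\<phi> i) n) \<longlonglongrightarrow> z n" using lim[OF n] t by simp
    have limm: "(\<lambda>i. fwd r (\<phi> i) (n @ [\<theta>])) \<longlonglongrightarrow> z (n @ [\<theta>])" using lim[OF m] t by simp
    have xD: "fwd r (\<phi> i) n \<in> D (Suc t - 1)" for i using fwd_in_D[OF \<phi>1 _ n] t by simp
    have yD: "fwd r (\<phi> i) (n @ [\<theta>]) \<in> D (Suc t)" for i using fwd_in_D[OF \<phi>1 _ m] t by simp
    have yf: "fwd r (\<phi> i) (n @ [\<theta>]) \<in> feas P (Suc t) (fwd r (\<phi> i) n) \<theta>" for i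
      by (rule fwd_feasible[OF \<phi>1 t n \<theta>])
    note closed = feas_closed[OF St \<theta> xD yf limm limn]
    have zD: "z (n @ [\<theta>]) \<in> D (Suc t)" using closed(2) feas_subset by blast
    have cq: "continuous_on (D (Suc t)) (q (Suc (Suc t)))" using q_continuous t by simp
    obtain Lq where Lq: "Lq-lipschitz_on (D (Suc t)) (q (Suc (Suc t)))" using q_lipschitz[of "Suc (Suc t)"] t by auto
    obtain K where K: "K-lipschitz_on (D (Suc t - 1)) (sval (Suc t) \<theta> (q (Suc (Suc t))))"
      using sval_lipschitz[OF St \<theta> Lq] by blast
    have gap0: "(\<lambda>i. gap (Suc (Suc t)) (n @ [\<theta>]) (\<phi> i)) \<longlonglongrightarrow> 0"
      using LIMSEQ_subseq_LIMSEQ[OF gap[of "Suc (Suc t)" "n @ [\<theta>]"] \<phi>] m t by (simp add: o_def)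
    have eps0: "(\<lambda>i. eps (Suc t) (\<phi> i)) \<longlonglongrightarrow> 0"
      using LIMSEQ_subseq_LIMSEQ[OF eps_lim[OF St] \<phi>] by (simp add: o_def)
    let ?l = "\<lambda>i. cost P (Suc t) (fwd r (\<phi> i) (n @ [\<theta>])) (fwd r (\<phi> i) n) \<theta> + q (Suc (Suc t)) (fwd r (\<phi> i) (n @ [\<theta>]))"
    let ?u = "\<lambda>i. sval (Suc t) \<theta> (q (Suc (Suc t))) (fwd r (\<phi> i) n) + eps (Suc t) (\<phi> i)
        + gap (Suc (Suc t)) (n @ [\<theta>]) (\<phi> i)"
    have le: "?l i \<le> ?u i" for i
    proof -
      have "sval (Suc t) \<theta> (v (\<phi> i - 1) (Suc (Suc t))) (fwd r (\<phi> i) n) \<le> sval (Suc t) \<theta> (q (Suc (Suc t))) (fwd r (\<phi> i) n)"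
      proof (rule sval_mono[OF St \<theta> _ cq xD])
        show "continuous_on (D (Suc t)) (v (\<phi> i - 1) (Suc (Suc t)))"
          using v_cont[of "Suc (Suc t)" "\<phi> i - 1"] \<phi>2[of i] t by simp
        show "v (\<phi> i - 1) (Suc (Suc t)) y \<le> q (Suc (Suc t)) y" if "y \<in> D (Suc t)" for y
          using v_le_q[of "Suc (Suc t)" "\<phi> i - 1" y] \<phi>2[of i] t that by simp
      qed
      then show ?thesis using forward_optimal(1)[OF St n' \<theta> \<phi>2[of i]] by (simp add: gap_def)
    qed
    have "?l \<longlonglongrightarrow> cost P (Suc t) (z (n @ [\<theta>])) (z n) \<theta> + q (Suc (Suc t)) (z (n @ [\<theta>]))"
    proof (rule tendsto_add)
      show "(\<lambda>i. cost P (Suc t) (fwd r (\<phi> i) (n @ [\<theta>])) (fwd r (\<phi> i) n) \<theta>)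
          \<longlonglongrightarrow> cost P (Suc t) (z (n @ [\<theta>])) (z n) \<theta>"
        by (rule cost_continuous[OF St \<theta> _ limm limn]) (use xD yD zD closed(1) in auto)
      show "(\<lambda>i. q (Suc (Suc t)) (fwd r (\<phi> i) (n @ [\<theta>]))) \<longlonglongrightarrow> q (Suc (Suc t)) (z (n @ [\<theta>]))"
        by (rule continuous_on_tendsto_compose[OF cq limm zD]) (use yD in simp)
    qed
    moreover have "?u \<longlonglongrightarrow> sval (Suc t) \<theta> (q (Suc (Suc t))) (z n)"
    proof -
      have "(\<lambda>i. sval (Suc t) \<theta> (q (Suc (Suc t))) (fwd r (\<phi> i) n)) \<longlonglongrightarrow> sval (Suc t) \<theta> (q (Suc (Suc t))) (z n)"
        by (rule continuous_on_tendsto_compose[OF lipschitz_on_continuous_on[OF K] limn closed(1)]) (use xD in simp)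
      from tendsto_add[OF tendsto_add[OF this eps0] gap0] show ?thesis by simp
    qed
    ultimately have "cost P (Suc t) (z (n @ [\<theta>])) (z n) \<theta> + q (Suc (Suc t)) (z (n @ [\<theta>]))
        \<le> sval (Suc t) \<theta> (q (Suc (Suc t))) (z n)"
      by (rule LIMSEQ_le) (use le in blast)
    then show ?thesis using closed(2) by blast
  qed
  then show ?thesis using root by (simp add: optimal_tree_def feasible_tree_def)
qed

end

section \<open>Almost sure convergence\<close>

context regular_msp
begin

text \<open>
  The events \<open>gap \<ge> 1 / (j + 1)\<close> depend on the preceding scenarios only, so the lemma on repeated draws
  applies to them and to a scenario that passes through the node. Countably many thresholds and
  finitely many nodes give one null set.
\<close>

lemma AE_gaps_vanish:
  assumes runs: "\<And>\<omega>. \<omega> \<in> space (sample_space P) \<Longrightarrow> regular_run P eps \<omega> (R \<omega>)"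
    and alg: "isddp P eps R"
  shows "AE \<omega> in sample_space P. \<forall>t n. 2 \<le> t \<longrightarrow> t \<le> Suc T \<longrightarrow> n \<in> nodes P (t - 1) \<longrightarrow>
    regular_run.gap P (R \<omega>) t n \<longlonglongrightarrow> 0"
proof -
  define E where "E t n j k \<omega> \<longleftrightarrow> 2 \<le> k \<and>
      ereal (inverse (real (Suc j))) \<le> cost_to_go P t (fwd (R \<omega>) k n) - Qapp (R \<omega>) (k - 1) t (fwd (R \<omega>) k n)"
    for t n j k and \<omega> :: "nat \<Rightarrow> nat \<Rightarrow> real^'k"
  have one: "AE \<omega> in sample_space P. (\<exists>\<^sub>\<infinity>k. E t n j k \<omega>) \<longrightarrow> (\<exists>\<^sub>\<infinity>k. E t n j k \<omega> \<and> sampled_node P (\<omega> k) (t - 1) = n)"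
    if t: "t \<in> {2..T}" and n: "n \<in> nodes P (t - 1)" for t n j
  proof -
    have "1 \<le> t - 1" "t - 1 \<le> T" using t by auto
    then obtain \<xi> where \<xi>: "\<xi> \<in> scenarios" "sampled_node P \<xi> (t - 1) = n"
      using scenario_through_node[OF n] by blast
    have n_all: "n \<in> all_nodes P" using node_in_all[OF n] t by auto
    have "AE \<omega> in sample_space P. (\<exists>\<^sub>\<infinity>k. E t n j k \<omega>) \<longrightarrow> (\<exists>\<^sub>\<infinity>k. E t n j k \<omega> \<and> \<omega> k = \<xi>)"
      unfolding sample_space_def
    proof (rule infinitely_often_drawn)
      show "prob_space (scenario_law P)" "finite (space (scenario_law P))"
        "sets (scenario_law P) = Pow (space (scenario_law P))" "\<xi> \<in> space (scenario_law P)"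
        "0 < measure (scenario_law P) {\<xi>}"
        using scenario_law_facts finite_scenarios \<xi>(1) by auto
      fix k :: nat and \<omega> \<omega>' :: "nat \<Rightarrow> nat \<Rightarrow> real^'k"
      assume k: "1 \<le> k" and \<omega>: "\<omega> \<in> space (\<Pi>\<^sub>M k\<in>{1..}. scenario_law P)" "\<omega>' \<in> space (\<Pi>\<^sub>M k\<in>{1..}. scenario_law P)"
        and eq: "\<And>j. j \<in> {1..<k} \<Longrightarrow> \<omega> j = \<omega>' j"
      have \<omega>': "\<omega> \<in> space (sample_space P)" "\<omega>' \<in> space (sample_space P)"
        using \<omega> by (simp_all add: sample_space_def)
      show "E t n j k \<omega> = E t n j k \<omega>'"
      proof (cases "2 \<le> k")
        case True
        have k1: "1 \<le> k - 1" "{1..k - 1} = {1..<k}" using True by auto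
        note adapted = alg[unfolded isddp_def, THEN conjunct2, rule_format, OF \<omega>']
        have "fwd (R \<omega>) k n = fwd (R \<omega>') k n"
          by (rule conjunct1[OF adapted[OF k], rule_format]) (use eq n_all in auto)
        moreover have "Qapp (R \<omega>) (k - 1) t = Qapp (R \<omega>') (k - 1) t"
          by (rule conjunct2[OF adapted[OF k1(1)], rule_format]) (use eq k1(2) t in auto)
        ultimately show ?thesis by (simp add: E_def)
      qed (simp add: E_def)
    qed
    then show ?thesis
    proof eventually_elim
      case (elim \<omega>)
      then show ?case using \<xi>(2) by (blast intro: frequently_elim1)
    qed
  qed
  have "AE \<omega> in sample_space P. \<forall>t\<in>{2..T}. \<forall>n\<in>nodes P (t - 1). \<forall>j.
      (\<exists>\<^sub>\<infinity>k. E t n j k \<omega>) \<longrightarrow> (\<exists>\<^sub>\<infinity>k. E t n j k \<omega> \<and> sampled_node P (\<omega> k) (t - 1) = n)"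
  proof (intro AE_finite_allI)
    show "finite {2..T}" by simp
    show "finite (nodes P (t - 1))" if "t \<in> {2..T}" for t using finite_nodes[of "t - 1"] that by auto
    show "AE \<omega> in sample_space P. \<forall>j. (\<exists>\<^sub>\<infinity>k. E t n j k \<omega>) \<longrightarrow>
        (\<exists>\<^sub>\<infinity>k. E t n j k \<omega> \<and> sampled_node P (\<omega> k) (t - 1) = n)"
      if "t \<in> {2..T}" "n \<in> nodes P (t - 1)" for t n
      unfolding AE_all_countable using one[OF that] by blast
  qed
  then show ?thesis using AE_space
  proof eventually_elim
    case (elim \<omega>)
    interpret run: regular_run P eps \<omega> "R \<omega>" by (rule runs[OF elim(2)])
    have E: "E t n j k \<omega> \<longleftrightarrow> 2 \<le> k \<and> inverse (real (Suc j)) \<le> run.gap t n k"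
      if t: "t \<in> {2..T}" "n \<in> nodes P (t - 1)" for t n j k
    proof (cases "2 \<le> k")
      case True
      have "fwd (R \<omega>) k n \<in> D (t - 1)" using run.fwd_in_D[of k "t - 1" n] True t by auto
      then show ?thesis
        unfolding E_def run.gap_def using True t ctg_eq[of t] run.Qapp_eq[of t "k - 1"] by simp
    qed (simp add: E_def)
    show ?case
    proof (intro allI impI)
      fix t n assume "2 \<le> t" "t \<le> Suc T" "n \<in> nodes P (t - 1)"
      then show "run.gap t n \<longlonglongrightarrow> 0"
      proof (rule run.gap_tendsto_0[rotated])
        fix t n j
        assume t: "t \<in> {2..T}" "n \<in> nodes P (t - 1)"
          and inf: "\<exists>\<^sub>\<infinity>k. 2 \<le> k \<and> inverse (real (Suc j)) \<le> run.gap t n k"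
        have "(\<exists>\<^sub>\<infinity>k. E t n j k \<omega>) \<longrightarrow> (\<exists>\<^sub>\<infinity>k. E t n j k \<omega> \<and> sampled_node P (\<omega> k) (t - 1) = n)"
          using elim(1) t by blast
        then show "\<exists>\<^sub>\<infinity>k. (2 \<le> k \<and> inverse (real (Suc j)) \<le> run.gap t n k) \<and> sampled_node P (\<omega> k) (t - 1) = n"
          unfolding E[OF t] using inf by blast
      qed
    qed
  qed
qed

end

theorem theorem5p3:
  fixes P :: "('n::finite, 'q::finite, 'p::finite, 'k::finite, 's) msp"
    and eps :: "nat \<Rightarrow> nat \<Rightarrow> real"
    and R :: "(nat \<Rightarrow> nat \<Rightarrow> real^'k) \<Rightarrow> ('n, 'q, 'p, 'k) run"
  assumes horizon: "1 \<le> horizon P"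
    and H0: "StoH0 P"
    and H1: "StoH1 P"
    and H2: "StoH2 P"
    and eps_nonneg: "\<And>t k. t \<in> {1..horizon P} \<Longrightarrow> 1 \<le> k \<Longrightarrow> 0 \<le> eps t k"
    and eps_lim: "\<And>t. t \<in> {1..horizon P} \<Longrightarrow> (\<lambda>k. eps t k) \<longlonglongrightarrow> 0"
    and alg: "isddp P eps R"
  shows "(AE \<omega> in sample_space P. \<forall>t\<in>{2..horizon P + 1}. \<forall>n\<in>nodes P (t - 1).
            (\<lambda>k. cost_to_go P t (fwd (R \<omega>) k n) - Qapp (R \<omega>) k t (fwd (R \<omega>) k n)) \<longlonglongrightarrow> 0) \<and>
         first_stage_value P = sp_value P \<and>
         (AE \<omega> in sample_space P.
            (\<lambda>k. stage_obj P 1 (Qapp (R \<omega>) (k - 1) 2) (fwd (R \<omega>) k [xi_one P]) (x_init P) (xi_one P))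
              \<longlonglongrightarrow> first_stage_value P \<and>
            (\<lambda>k. stage_val P 1 (Qapp (R \<omega>) k 2) (x_init P) (xi_one P)) \<longlonglongrightarrow> first_stage_value P) \<and>
         (\<forall>xstar. (\<forall>\<omega>\<in>space (sample_space P). accumulation_point P (R \<omega>) (xstar \<omega>)) \<longrightarrow>
            (AE \<omega> in sample_space P. sp_optimal P (tree_policy P (xstar \<omega>))))"
proof -
  interpret regular_msp P using horizon H0 H1 H2 by unfold_locales
  have runs: "regular_run P eps \<omega> (R \<omega>)" if "\<omega> \<in> space (sample_space P)" for \<omega>
    using alg that eps_nonneg eps_lim sample_space_coord[OF that] unfolding isddp_def
    by unfold_locales auto
  have gaps: "AE \<omega> in sample_space P. \<forall>t n. 2 \<le> t \<longrightarrow> t \<le> Suc T \<longrightarrow> n \<in> nodes P (t - 1) \<longrightarrow>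
      regular_run.gap P (R \<omega>) t n \<longlonglongrightarrow> 0"
    using runs alg by (rule AE_gaps_vanish)
  have i: "AE \<omega> in sample_space P. \<forall>t\<in>{2..T + 1}. \<forall>n\<in>nodes P (t - 1).
      (\<lambda>k. cost_to_go P t (fwd (R \<omega>) k n) - Qapp (R \<omega>) k t (fwd (R \<omega>) k n)) \<longlonglongrightarrow> 0"
    using gaps AE_space
  proof eventually_elim
    case (elim \<omega>)
    interpret run: regular_run P eps \<omega> "R \<omega>" by (rule runs[OF elim(2)])
    show ?case
    proof (intro ballI)
      fix t n assume tn: "t \<in> {2..T + 1}" "n \<in> nodes P (t - 1)"
      then have "run.gap t n \<longlonglongrightarrow> 0" using elim(1) by simp
      then show "(\<lambda>k. cost_to_go P t (fwd (R \<omega>) k n) - Qapp (R \<omega>) k t (fwd (R \<omega>) k n)) \<longlonglongrightarrow> 0"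
        using tn by (intro run.approximation_tendsto) auto
    qed
  qed
  have ii: "AE \<omega> in sample_space P.
      (\<lambda>k. stage_obj P 1 (Qapp (R \<omega>) (k - 1) 2) (fwd (R \<omega>) k [xi_one P]) (x_init P) (xi_one P))
        \<longlonglongrightarrow> first_stage_value P \<and>
      (\<lambda>k. stage_val P 1 (Qapp (R \<omega>) k 2) (x_init P) (xi_one P)) \<longlonglongrightarrow> first_stage_value P"
    using gaps AE_space
  proof eventually_elim
    case (elim \<omega>)
    interpret run: regular_run P eps \<omega> "R \<omega>" by (rule runs[OF elim(2)])
    have "run.gap 2 [xi_one P] \<longlonglongrightarrow> 0" using elim(1) node_1 horizon by simp
    then show ?case using run.first_stage_tendsto by blast
  qed
  have iii: "AE \<omega> in sample_space P. sp_optimal P (tree_policy P (xstar \<omega>))"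
    if acc: "\<forall>\<omega>\<in>space (sample_space P). accumulation_point P (R \<omega>) (xstar \<omega>)" for xstar
    using gaps AE_space
  proof eventually_elim
    case (elim \<omega>)
    interpret run: regular_run P eps \<omega> "R \<omega>" by (rule runs[OF elim(2)])
    show ?case
    proof (rule sp_optimal_tree_policy, rule run.accumulation_point_optimal)
      show "run.gap t n \<longlonglongrightarrow> 0" if "2 \<le> t" "t \<le> Suc T" "n \<in> nodes P (t - 1)" for t n
        using elim(1) that by blast
      show "accumulation_point P (R \<omega>) (xstar \<omega>)" using acc elim(2) by blast
    qed
  qed
  show ?thesis using i ii iii sp_value_eq by auto
qed

end
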